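(* As operators on $L(\mathbf w^{n-1})\oplus L(\mathbf w^n)$, $$E_k=b_{k+1}a_k\ (1\le k\le n-1),\qquad F_k=b_ka_{k+1}\ (1\le k\le n-1),\qquad E_n=a_na_{n-1},\qquad F_n=b_{n-1}b_n.$$
   Context: Quiver varieties. Let $n\ge4$ and let $I=\{1,\dots,n\}$ be the vertex set of the Dynkin graph of type $D_n$, with edges $i - (i+1)$ for $1\le i\le n-2$ and $(n-2) - n$. $H$ is the set of edges with an orientation; $\mathrm{out}(h)$ is the source and $\mathrm{in}(h)$ the target of $h$; $\bar h$ is the reversed edge; $h_{i,j}$ goes from $i$ to $j$. $\Omega=\{h_{i,i+1}:1\le i\le n-2\}\cup\{h_{n-2,n}\}$; $\varepsilon=1$ on $\Omega$ and $-1$ on $H\setminus\Omega$. For a finite-dimensional $I$-graded complex vector space $\mathbf V$, $\mathbf E_{\mathbf V}=\bigoplus_{h\in H}\mathrm{Hom}(\mathbf V_{\mathrm{out}(h)},\mathbf V_{\mathrm{in}(h)})$, $G_{\mathbf V}=\prod_i\mathrm{Aut}(\mathbf V_i)$, and $\Lambda_{\mathbf V}$ is the set of $x\in\mathbf E_{\mathbf V}$ that are nilpotent (for some $N\ge1$ all compositions of $N$ maps $x_h$ along composable oriented edges vanish) and satisfy $\sum_{h:\mathrm{in}(h)=i}\varepsilon(h)x_hx_{\bar h}=0$ for all $i$. For $\mathbf v,\mathbf w\in\mathbb Z_{\ge0}^I$ and $I$-graded spaces $\mathbf V,\mathbf W$ of these graded dimensions, $\Lambda(\mathbf v,\mathbf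 w)=\Lambda_{\mathbf V}\times\bigoplus_i\mathrm{Hom}(\mathbf V_i,\mathbf W_i)\ni(x,j)$; $\Lambda(\mathbf v,\mathbf w)^{\mathrm{st}}$ is the set of $(x,j)$ for which the only $I$-graded $x$-stable subspace $\mathbf S\subset\mathbf V$ with $j(\mathbf S)=0$ is $0$. $G_{\mathbf V}$ acts by $(x,j)\mapsto((g_{\mathrm{in}(h)}x_hg_{\mathrm{out}(h)}^{-1}),(j_ig_i^{-1}))$, freely on $\Lambda(\mathbf v,\mathbf w)^{\mathrm{st}}$, and $\mathcal L(\mathbf v,\mathbf w)=\Lambda(\mathbf v,\mathbf w)^{\mathrm{st}}/G_{\mathbf V}$. Let $\mathbf w^i_j=\delta_{ij}$ and $\mathbf e^k_j=\delta_{kj}$. Constructible functions and Lie algebra operators. $M(A)$ is the space of complex-valued constructible functions on $A$. For $\pi:A\to B$, $\pi^*f=f\circ\pi$, and $\pi_!$ is linear with $\pi_!(\mathbf 1_Z)(y)=\chi(\pi^{-1}(y)\cap Z)$ ($\chi$ = Euler characteristic). $\mathcal F(\mathbf v,\mathbf w;\mathbf v'')$ is the set of $G_{\mathbf V}$-orbits of triples $(x,j,\mathbf S)$ with $(x,j)\in\Lambda(\mathbf v,\mathbf w)^{\mathrm{st}}$ and $\mathbf S\subset\mathbf V$ an $I$-graded $x$-stable subspace of graded dimension $\mathbf v-\mathbf v''$; $\pi_1(x,j,\mathbf S)=(x|_{\mathbf S},j|_{\mathbf S})\in\mathcal L(\mathbf v-\mathbf v'',\mathbf w)$, $\pi_2(x,j,\mathbf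 S)=(x,j)\in\mathcal L(\mathbf v,\mathbf w)$. With $\mathbf v''=\mathbf e^k$, $1\le k\le n$: $E_k:M(\mathcal L(\mathbf v,\mathbf w))\to M(\mathcal L(\mathbf v-\mathbf e^k,\mathbf w))$, $E_kf=(\pi_1)_!\pi_2^*f$, and $F_k:M(\mathcal L(\mathbf v-\mathbf e^k,\mathbf w))\to M(\mathcal L(\mathbf v,\mathbf w))$, $F_kg=(\pi_2)_!\pi_1^*g$. $L(\mathbf w)\subset\bigoplus_{\mathbf v}M(\mathcal L(\mathbf v,\mathbf w))$ is the span of all functions obtained from the constant function $1$ on the point $\mathcal L(\mathbf 0,\mathbf w)$ by applying arbitrary compositions of the $F_k$; it is stable under all $E_k,F_k$. Young diagrams. $\mathcal Y$ is the set of strictly decreasing sequences $Y=(l_1>\dots>l_s)$ of positive integers, $s\ge0$, $l_1\le n-1$. Row $l_i$ has endpoint $n-l_i$. $l(Y)=s$ is the number of rows and $l_k(Y)$ the number of rows with endpoint strictly less than $k$. For $Y\in\mathcal Y$ let $\mathbf v_Y^{+}$ be the vector with $(\mathbf v_Y^+)_r=\#\{i:n-l_i\le r\}$ for $1\le r\le n-2$, $(\mathbf v_Y^+)_n=\lceil s/2\rceil$, $(\mathbf v_Y^+)_{n-1}=\lfloor s/2\rfloor$, and let $\mathbf v_Y^-$ be $\mathbf v_Y^+$ with entries $n-1$ and $n$ interchanged. It is known that $\mathcal L(\mathbf v,\mathbf w^n)$ (resp. $\mathcal L(\mathbf v,\mathbf w^{n-1})$) is a single point if $\mathbf v=\mathbf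 v_Y^+$ (resp. $\mathbf v=\mathbf v_Y^-$) for some $Y\in\mathcal Y$, necessarily unique and denoted $Y_{\mathbf v}$, and is empty otherwise. Clifford operators. For $\mathbf v\in\mathbb Z^n_{\ge 0}$, $\mathbf v^*$ is $\mathbf v$ with entries $n-1$ and $n$ interchanged (likewise $\mathbf w^*$). $\kappa:\mathcal L(\mathbf v,\mathbf w)\to\mathcal L(\mathbf v^*,\mathbf w^* )$ interchanges the roles of vertices $n-1$ and $n$ in $(x,j)$ (i.e. swaps $x_{h_{n-1,n-2}}$ with $x_{h_{n,n-2}}$, $x_{h_{n-2,n-1}}$ with $x_{h_{n-2,n}}$, and $j_{n-1}$ with $j_n$); $\kappa^*$ denotes the induced pullback $M(\mathcal L(\mathbf v,\mathbf w))\to M(\mathcal L(\mathbf v^*,\mathbf w^* ))$. For $1\le k\le n-1$ let $\mathbf y^k_i=1$ if $k\le i\le n-1$ and $0$ otherwise; $\mathbf z^k_i=1$ if $k\le i\le n-2$ or $i=n$ and $0$ otherwise. Consider $\bigsqcup_{\mathbf v}\mathcal L(\mathbf v,\mathbf w)\xleftarrow{\pi_1}\bigsqcup_{\mathbf v}\mathcal F(\mathbf v,\mathbf w;\mathbf y^k)\sqcup\bigsqcup_{\mathbf v}\mathcal F(\mathbf v,\mathbf w;\mathbf z^k)\xrightarrow{\pi_2}\bigsqcup_{\mathbf v}\mathcal L(\mathbf v,\mathbf w)$. For $\mathbf w\in\{\mathbf w^{n-1},\mathbf w^n\}$, $f\in M(\mathcal L(\mathbf v,\mathbf w))$ and $1\le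 k\le n-1$, using the maps of this diagram: $$a_k(f)=(-1)^{l_k(Y_{\mathbf v})}\kappa^*(\pi_1)_!\pi_2^*f,\qquad b_k(f)=(-1)^{l_k(Y_{\mathbf v})}\kappa^*(\pi_2)_!\pi_1^*f,$$ and $$a_n(f)=\begin{cases}(-1)^{l(Y_{\mathbf v})}\kappa^*f&\text{if }\mathbf w_n+l(Y_{\mathbf v})\text{ is even}\\0&\text{if odd}\end{cases},\qquad b_n(f)=\begin{cases}(-1)^{l(Y_{\mathbf v})}\kappa^*f&\text{if }\mathbf w_n+l(Y_{\mathbf v})\text{ is odd}\\0&\text{if even.}\end{cases}$$ These extend linearly to operators on $L(\mathbf w^{n-1})\oplus L(\mathbf w^n)$. *)

theory Defs
  imports
    "HOL-Homology.Homology"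
    "HOL-Library.Function_Algebras"
    "Jordan_Normal_Form.VS_Connect"
begin

section \<open>Euler characteristic\<close>

definition int_independent :: "('g, 'm) monoid_scheme \<Rightarrow> 'g set \<Rightarrow> bool" where
  "int_independent G B \<longleftrightarrow> finite B \<and> B \<subseteq> carrier G \<and>
     (\<forall>c :: 'g \<Rightarrow> int. finprod G (\<lambda>b. b [^]\<^bsub>G\<^esub> c b) B = \<one>\<^bsub>G\<^esub> \<longrightarrow> (\<forall>b\<in>B. c b = 0))"

definition abelian_rank :: "('g, 'm) monoid_scheme \<Rightarrow> nat" where
  "abelian_rank G = Sup {card B | B. int_independent G B}"

definition betti :: "nat \<Rightarrow> 'a topology \<Rightarrow> nat" where
  "betti p X = abelian_rank (homology_group (int p) X)"

text \<open>On complex constructible sets with the analytic topology this number agrees with the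
  Euler characteristic with compact supports, so it is additive there.\<close>

definition euler_char :: "'a topology \<Rightarrow> int" where
  "euler_char X = (\<Sum>p \<in> {p. betti p X \<noteq> 0}. (- 1) ^ p * int (betti p X))"

section \<open>Quotient varieties and constructible functions\<close>

text \<open>A variety \<open>A\<close> is given by a subset \<open>qdom\<close> of an affine space with coordinate functions
  \<open>qcoords\<close> together with a map \<open>qmap\<close> whose fibres on \<open>qdom\<close> are the orbits of a group action;
  the points of \<open>A\<close> are the values of \<open>qmap\<close>.
  The analytic topology on \<open>A\<close> is the quotient topology, and a
  subset of \<open>A\<close> is constructible iff its preimage in \<open>qdom\<close> is (Chevalley's theorem).\<close>

record ('p, 'a) quot_variety =
  qdom :: "'p set"
  qcoords :: "('p \<Rightarrow> complex) set"
  qmap :: "'p \<Rightarrow> 'a"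

definition points :: "('p, 'a) quot_variety \<Rightarrow> 'a set" where
  "points A = qmap A ` qdom A"

definition dom_topology :: "('p, 'a) quot_variety \<Rightarrow> 'p topology" where
  "dom_topology A =
     subtopology (topology_generated_by
       (insert UNIV {c -` U | c U. c \<in> qcoords A \<and> open U})) (qdom A)"

definition analytic_topology :: "('p, 'a) quot_variety \<Rightarrow> 'a topology" where
  "analytic_topology A =
     topology (\<lambda>U. U \<subseteq> points A \<and> openin (dom_topology A) {x \<in> qdom A. qmap A x \<in> U})"

lemma openin_analytic_topology:
  "openin (analytic_topology A) U \<longleftrightarrow>
     U \<subseteq> points A \<and> openin (dom_topology A) {x \<in> qdom A. qmap A x \<in> U}"
proof -
  have int: "{x \<in> qdom A. qmap A x \<in> S \<inter> T} =
      {x \<in> qdom A. qmap A x \<in> S} \<inter> {x \<in> qdom A. qmap A x \<in> T}" for S T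
    by auto
  have un: "{x \<in> qdom A. qmap A x \<in> \<Union>K} = \<Union> ((\<lambda>U. {x \<in> qdom A. qmap A x \<in> U}) ` K)" for K
    by auto
  have "istopology (\<lambda>U. U \<subseteq> points A \<and> openin (dom_topology A) {x \<in> qdom A. qmap A x \<in> U})"
    unfolding istopology_def int un by (blast intro: openin_Int openin_Union)
  then show ?thesis
    by (simp add: analytic_topology_def)
qed

inductive_set poly_functions :: "('p \<Rightarrow> complex) set \<Rightarrow> ('p \<Rightarrow> complex) set"
  for C :: "('p \<Rightarrow> complex) set" where
  const: "(\<lambda>_. z) \<in> poly_functions C"
| coord: "c \<in> C \<Longrightarrow> c \<in> poly_functions C"
| add: "f \<in> poly_functions C \<Longrightarrow> g \<in> poly_functions C \<Longrightarrow> (\<lambda>x. f x + g x) \<in> poly_functions C"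
| mult: "f \<in> poly_functions C \<Longrightarrow> g \<in> poly_functions C \<Longrightarrow> (\<lambda>x. f x * g x) \<in> poly_functions C"

inductive_set constructible_sets :: "('p \<Rightarrow> complex) set \<Rightarrow> 'p set set"
  for C :: "('p \<Rightarrow> complex) set" where
  zeros: "f \<in> poly_functions C \<Longrightarrow> {x. f x = 0} \<in> constructible_sets C"
| compl: "Z \<in> constructible_sets C \<Longrightarrow> - Z \<in> constructible_sets C"
| inter: "Z \<in> constructible_sets C \<Longrightarrow> Z' \<in> constructible_sets C \<Longrightarrow> Z \<inter> Z' \<in> constructible_sets C"

text \<open>\<open>M(A)\<close>. Functions on \<open>A\<close> are extended by zero outside the points of \<open>A\<close>.\<close>

definition constructible_functions :: "('p, 'a) quot_variety \<Rightarrow> ('a \<Rightarrow> complex) set" where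
  "constructible_functions A =
     {f. (\<forall>a. a \<notin> points A \<longrightarrow> f a = 0) \<and> finite (range f) \<and>
         (\<forall>c. \<exists>Z \<in> constructible_sets (qcoords A).
            {x \<in> qdom A. f (qmap A x) = c} = qdom A \<inter> Z)}"

definition pullback :: "('p, 'a) quot_variety \<Rightarrow> ('a \<Rightarrow> 'b) \<Rightarrow> ('b \<Rightarrow> complex) \<Rightarrow> 'a \<Rightarrow> complex" where
  "pullback A \<pi> f = (\<lambda>a. if a \<in> points A then f (\<pi> a) else 0)"

text \<open>The linear map \<open>\<pi>\<^sub>!\<close> on \<open>M(A)\<close>, obtained by writing \<open>f\<close> as the sum of
  \<open>c \<cdot> 1\<^bsub>f = c\<^esub>\<close> over its nonzero values \<open>c\<close>; outside \<open>M(A)\<close> it is given the junk value zero.\<close>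

definition pushforward :: "('p, 'a) quot_variety \<Rightarrow> ('a \<Rightarrow> 'b) \<Rightarrow> ('a \<Rightarrow> complex) \<Rightarrow> 'b \<Rightarrow> complex" where
  "pushforward A \<pi> f = (\<lambda>y.
     if f \<in> constructible_functions A
     then \<Sum>c \<in> f ` points A - {0}.
       c * of_int (euler_char (subtopology (analytic_topology A) {a \<in> points A. \<pi> a = y \<and> f a = c}))
     else 0)"

section \<open>Quiver representations of type \<open>D\<^sub>n\<close>\<close>

type_synonym dimvec = "nat \<Rightarrow> nat"
type_synonym edge = "nat \<times> nat"
type_synonym rep = "(edge \<Rightarrow> complex mat) \<times> (nat \<Rightarrow> complex mat)"
type_synonym graded_sub = "nat \<Rightarrow> complex Matrix.vec set"

text \<open>The oriented edge from \<open>i\<close> to \<open>j\<close> is \<open>(i, j)\<close>, so \<open>out\<close>, \<open>in\<close> and reversal are \<^const>\<open>fst\<close>,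
  \<^const>\<open>snd\<close> and \<^const>\<open>prod.swap\<close>. Dimension vectors are functions on all natural numbers that
  vanish outside \<open>I\<close>; \<open>\<^bold>V\<^sub>i\<close> is the space of column vectors of length \<open>v i\<close>. All families indexed
  by \<open>I\<close> or \<open>H\<close> are extensional.\<close>

definition vertices :: "nat \<Rightarrow> nat set" where
  "vertices n = {1..n}"

definition Omega :: "nat \<Rightarrow> edge set" where
  "Omega n = {(i, i + 1) | i. 1 \<le> i \<and> i \<le> n - 2} \<union> {(n - 2, n)}"

definition edges :: "nat \<Rightarrow> edge set" where
  "edges n = Omega n \<union> prod.swap ` Omega n"

definition eps :: "nat \<Rightarrow> edge \<Rightarrow> complex" where
  "eps n h = (if h \<in> Omega n then 1 else - 1)"

text \<open>Serves both as \<open>\<^bold>e\<^sup>k\<close> and as \<open>\<^bold>w\<^sup>k\<close>.\<close>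

definition unitv :: "nat \<Rightarrow> dimvec" where
  "unitv k = (\<lambda>i. if i = k then 1 else 0)"

definition edge_maps :: "nat \<Rightarrow> dimvec \<Rightarrow> (edge \<Rightarrow> complex mat) set" where
  "edge_maps n v = (\<Pi>\<^sub>E h \<in> edges n. carrier_mat (v (snd h)) (v (fst h)))"

definition framing_maps :: "nat \<Rightarrow> dimvec \<Rightarrow> dimvec \<Rightarrow> (nat \<Rightarrow> complex mat) set" where
  "framing_maps n v w = (\<Pi>\<^sub>E i \<in> vertices n. carrier_mat (w i) (v i))"

definition nilpotent_rep :: "nat \<Rightarrow> dimvec \<Rightarrow> (edge \<Rightarrow> complex mat) \<Rightarrow> bool" where
  "nilpotent_rep n v x \<longleftrightarrow>
     (\<exists>N \<ge> 1. \<forall>h hs. length (h # hs) = N \<longrightarrow> set (h # hs) \<subseteq> edges n \<longrightarrow>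
        successively (\<lambda>h h'. snd h = fst h') (h # hs) \<longrightarrow>
        foldl (\<lambda>A h'. x h' * A) (x h) hs = 0\<^sub>m (v (snd (last (h # hs)))) (v (fst h)))"

definition moment_zero :: "nat \<Rightarrow> dimvec \<Rightarrow> (edge \<Rightarrow> complex mat) \<Rightarrow> bool" where
  "moment_zero n v x \<longleftrightarrow>
     (\<forall>i \<in> vertices n. \<forall>r < v i. \<forall>c < v i.
        (\<Sum>h \<in> {h \<in> edges n. snd h = i}. eps n h * (x h * x (prod.swap h)) $$ (r, c)) = 0)"

definition Lambda_V :: "nat \<Rightarrow> dimvec \<Rightarrow> (edge \<Rightarrow> complex mat) set" where
  "Lambda_V n v = {x \<in> edge_maps n v. nilpotent_rep n v x \<and> moment_zero n v x}"

definition graded_subspaces :: "nat \<Rightarrow> dimvec \<Rightarrow> graded_sub set" where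
  "graded_subspaces n v =
     (\<Pi>\<^sub>E i \<in> vertices n. {S. VectorSpace.subspace class_ring S (module_vec TYPE(complex) (v i))})"

definition graded_dim :: "dimvec \<Rightarrow> graded_sub \<Rightarrow> dimvec" where
  "graded_dim v S = (\<lambda>i. vectorspace.dim class_ring ((module_vec TYPE(complex) (v i))\<lparr>carrier := S i\<rparr>))"

definition x_stable :: "nat \<Rightarrow> (edge \<Rightarrow> complex mat) \<Rightarrow> graded_sub \<Rightarrow> bool" where
  "x_stable n x S \<longleftrightarrow> (\<forall>h \<in> edges n. \<forall>s \<in> S (fst h). x h *\<^sub>v s \<in> S (snd h))"

definition Lambda_st :: "nat \<Rightarrow> dimvec \<Rightarrow> dimvec \<Rightarrow> rep set" where
  "Lambda_st n v w =
     {(x, j). x \<in> Lambda_V n v \<and> j \<in> framing_maps n v w \<and>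
        (\<forall>S \<in> graded_subspaces n v. x_stable n x S \<longrightarrow>
           (\<forall>i \<in> vertices n. \<forall>s \<in> S i. j i *\<^sub>v s = 0\<^sub>v (w i)) \<longrightarrow>
           (\<forall>i \<in> vertices n. S i = {0\<^sub>v (v i)}))}"

definition G_V :: "nat \<Rightarrow> dimvec \<Rightarrow> (nat \<Rightarrow> complex mat) set" where
  "G_V n v = (\<Pi>\<^sub>E i \<in> vertices n. Units (ring_mat TYPE(complex) (v i) ()))"

definition mat_inv :: "nat \<Rightarrow> complex mat \<Rightarrow> complex mat" where
  "mat_inv m A = inv\<^bsub>ring_mat TYPE(complex) m ()\<^esub> A"

definition act_rep :: "nat \<Rightarrow> dimvec \<Rightarrow> (nat \<Rightarrow> complex mat) \<Rightarrow> rep \<Rightarrow> rep" where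
  "act_rep n v g = (\<lambda>(x, j).
     ((\<lambda>h \<in> edges n. g (snd h) * x h * mat_inv (v (fst h)) (g (fst h))),
      (\<lambda>i \<in> vertices n. j i * mat_inv (v i) (g i))))"

definition act_sub :: "nat \<Rightarrow> (nat \<Rightarrow> complex mat) \<Rightarrow> graded_sub \<Rightarrow> graded_sub" where
  "act_sub n g S = (\<lambda>i \<in> vertices n. (\<lambda>s. g i *\<^sub>v s) ` S i)"

definition rep_coords :: "nat \<Rightarrow> dimvec \<Rightarrow> dimvec \<Rightarrow> (rep \<Rightarrow> complex) set" where
  "rep_coords n v w =
     {(\<lambda>(x, j). x h $$ (r, c)) | h r c. h \<in> edges n \<and> r < v (snd h) \<and> c < v (fst h)} \<union>
     {(\<lambda>(x, j). j i $$ (r, c)) | i r c. i \<in> vertices n \<and> r < w i \<and> c < v i}"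

definition rep_orbit :: "nat \<Rightarrow> dimvec \<Rightarrow> rep \<Rightarrow> rep set" where
  "rep_orbit n v p = (\<lambda>g. act_rep n v g p) ` G_V n v"

definition quiver_variety :: "nat \<Rightarrow> dimvec \<Rightarrow> dimvec \<Rightarrow> (rep, rep set) quot_variety" where
  "quiver_variety n v w =
     \<lparr>qdom = Lambda_st n v w, qcoords = rep_coords n v w, qmap = rep_orbit n v\<rparr>"

section \<open>The correspondences \<open>\<F>(\<^bold>v, \<^bold>w; \<^bold>v'')\<close>\<close>

definition triples :: "nat \<Rightarrow> dimvec \<Rightarrow> dimvec \<Rightarrow> dimvec \<Rightarrow> (rep \<times> graded_sub) set" where
  "triples n v w u =
     {((x, j), S). u \<le> v \<and> (x, j) \<in> Lambda_st n v w \<and> S \<in> graded_subspaces n v \<and>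
        x_stable n x S \<and> (\<forall>i \<in> vertices n. graded_dim v S i = v i - u i)}"

definition triple_orbit :: "nat \<Rightarrow> dimvec \<Rightarrow> rep \<times> graded_sub \<Rightarrow> (rep \<times> graded_sub) set" where
  "triple_orbit n v = (\<lambda>(p, S). (\<lambda>g. (act_rep n v g p, act_sub n g S)) ` G_V n v)"

text \<open>Injective linear maps from a space of graded dimension \<open>v'\<close>; the subspace with
  basis the columns of a frame is its column space. The Grassmannian is the quotient of the
  space of frames under taking column spaces.\<close>

definition frames :: "nat \<Rightarrow> dimvec \<Rightarrow> dimvec \<Rightarrow> (nat \<Rightarrow> complex mat) set" where
  "frames n v' v =
     (\<Pi>\<^sub>E i \<in> vertices n. {A \<in> carrier_mat (v i) (v' i). inj_on (\<lambda>c. A *\<^sub>v c) (carrier_vec (v' i))})"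

definition column_spaces :: "nat \<Rightarrow> dimvec \<Rightarrow> (nat \<Rightarrow> complex mat) \<Rightarrow> graded_sub" where
  "column_spaces n v' A = (\<lambda>i \<in> vertices n. (\<lambda>c. A i *\<^sub>v c) ` carrier_vec (v' i))"

definition flag_variety ::
  "nat \<Rightarrow> dimvec \<Rightarrow> dimvec \<Rightarrow> dimvec \<Rightarrow>
    (rep \<times> (nat \<Rightarrow> complex mat), (rep \<times> graded_sub) set) quot_variety" where
  "flag_variety n v w u =
     \<lparr>qdom = {(p, A). A \<in> frames n (v - u) v \<and> (p, column_spaces n (v - u) A) \<in> triples n v w u},
      qcoords = {(\<lambda>(p, A). c p) | c. c \<in> rep_coords n v w} \<union>
        {(\<lambda>(p, A). A i $$ (r, c)) | i r c. i \<in> vertices n \<and> r < v i \<and> c < v i - u i},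
      qmap = (\<lambda>(p, A). triple_orbit n v (p, column_spaces n (v - u) A))\<rparr>"

text \<open>The matrices of \<open>(x|\<^sub>S, j|\<^sub>S)\<close> with respect to all possible bases of \<open>S\<close> form one orbit,
  which is the point \<open>\<pi>\<^sub>1(x, j, S)\<close>.\<close>

definition pi1 ::
  "nat \<Rightarrow> dimvec \<Rightarrow> dimvec \<Rightarrow> dimvec \<Rightarrow> (rep \<times> graded_sub) set \<Rightarrow> rep set" where
  "pi1 n v w u Q =
     {(x', j'). x' \<in> edge_maps n (v - u) \<and> j' \<in> framing_maps n (v - u) w \<and>
        (\<exists>x j S A. ((x, j), S) \<in> Q \<and> A \<in> frames n (v - u) v \<and> S = column_spaces n (v - u) A \<and>
           (\<forall>h \<in> edges n. x h * A (fst h) = A (snd h) * x' h) \<and>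
           (\<forall>i \<in> vertices n. j i * A i = j' i))}"

definition pi2 :: "(rep \<times> graded_sub) set \<Rightarrow> rep set" where
  "pi2 Q = fst ` Q"

text \<open>\<open>(\<pi>\<^sub>1)\<^sub>! \<pi>\<^sub>2\<^sup>*\<close> from functions on \<open>\<L>(\<^bold>v, \<^bold>w)\<close> to functions on \<open>\<L>(\<^bold>v - \<^bold>u, \<^bold>w)\<close>,
  and \<open>(\<pi>\<^sub>2)\<^sub>! \<pi>\<^sub>1\<^sup>*\<close> in the opposite direction.\<close>

definition corr_down ::
  "nat \<Rightarrow> dimvec \<Rightarrow> dimvec \<Rightarrow> dimvec \<Rightarrow> (rep set \<Rightarrow> complex) \<Rightarrow> rep set \<Rightarrow> complex" where
  "corr_down n v w u f =
     pushforward (flag_variety n v w u) (pi1 n v w u) (pullback (flag_variety n v w u) pi2 f)"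

definition corr_up ::
  "nat \<Rightarrow> dimvec \<Rightarrow> dimvec \<Rightarrow> dimvec \<Rightarrow> (rep set \<Rightarrow> complex) \<Rightarrow> rep set \<Rightarrow> complex" where
  "corr_up n v w u f =
     pushforward (flag_variety n v w u) pi2 (pullback (flag_variety n v w u) (pi1 n v w u) f)"

section \<open>The operators \<open>E\<^sub>k\<close>, \<open>F\<^sub>k\<close> and the space \<open>L(\<^bold>w)\<close>\<close>

text \<open>An element of \<open>\<Oplus>\<^sub>v M(\<L>(\<^bold>v, \<^bold>w))\<close> is the family of its components. In \<open>F_op\<close> (and in
  \<open>b_op\<close> below) the component at \<open>v\<close> is zero when the subtracted vector is not \<open>\<le> v\<close>, since
  \<^const>\<open>triples\<close> is then empty.\<close>

type_synonym graded_fun = "dimvec \<Rightarrow> rep set \<Rightarrow> complex"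

definition E_op :: "nat \<Rightarrow> dimvec \<Rightarrow> nat \<Rightarrow> graded_fun \<Rightarrow> graded_fun" where
  "E_op n w k f = (\<lambda>v. corr_down n (v + unitv k) w (unitv k) (f (v + unitv k)))"

definition F_op :: "nat \<Rightarrow> dimvec \<Rightarrow> nat \<Rightarrow> graded_fun \<Rightarrow> graded_fun" where
  "F_op n w k f = (\<lambda>v. corr_up n v w (unitv k) (f (v - unitv k)))"

definition vacuum :: "nat \<Rightarrow> dimvec \<Rightarrow> graded_fun" where
  "vacuum n w = (\<lambda>v p. if v = 0 \<and> p \<in> points (quiver_variety n 0 w) then 1 else 0)"

inductive_set F_words :: "nat \<Rightarrow> dimvec \<Rightarrow> graded_fun set" for n w where
  vac: "vacuum n w \<in> F_words n w"
| step: "f \<in> F_words n w \<Longrightarrow> k \<in> {1..n} \<Longrightarrow> F_op n w k f \<in> F_words n w"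

definition L_space :: "nat \<Rightarrow> dimvec \<Rightarrow> graded_fun set" where
  "L_space n w = Modules.module.span (\<lambda>(c :: complex) f v p. c * f v p) (F_words n w)"

section \<open>Young diagrams\<close>

definition young :: "nat \<Rightarrow> nat list set" where
  "young n = {Y. sorted_wrt (>) Y \<and> set Y \<subseteq> {1..n - 1}}"

definition rows_before :: "nat \<Rightarrow> nat \<Rightarrow> nat list \<Rightarrow> nat" where
  "rows_before n k Y = card {i. i < length Y \<and> n - Y ! i < k}"

definition swap_ends :: "nat \<Rightarrow> nat \<Rightarrow> nat" where
  "swap_ends n i = (if i = n - 1 then n else if i = n then n - 1 else i)"

definition star :: "nat \<Rightarrow> dimvec \<Rightarrow> dimvec" where
  "star n v = v \<circ> swap_ends n"

definition v_plus :: "nat \<Rightarrow> nat list \<Rightarrow> dimvec" where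
  "v_plus n Y r =
     (if 1 \<le> r \<and> r \<le> n - 2 then card {i. i < length Y \<and> n - Y ! i \<le> r}
      else if r = n then nat \<lceil>real (length Y) / 2\<rceil>
      else if r = n - 1 then nat \<lfloor>real (length Y) / 2\<rfloor>
      else 0)"

definition v_minus :: "nat \<Rightarrow> nat list \<Rightarrow> dimvec" where
  "v_minus n Y = star n (v_plus n Y)"

text \<open>\<open>Y\<^sub>v\<close> depends on which of \<open>\<^bold>w\<^sup>n\<close>, \<open>\<^bold>w\<^bsup>n-1\<^esup>\<close> is considered. It is only meaningful if
  \<open>v\<close> has the required form; otherwise \<open>\<L>(\<^bold>v, \<^bold>w)\<close> is empty and carries no nonzero function.\<close>

definition young_of :: "nat \<Rightarrow> dimvec \<Rightarrow> dimvec \<Rightarrow> nat list" where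
  "young_of n w v =
     (THE Y. Y \<in> young n \<and> v = (if w = unitv n then v_plus n Y else v_minus n Y))"

section \<open>Clifford operators\<close>

definition kappa_rep :: "nat \<Rightarrow> rep \<Rightarrow> rep" where
  "kappa_rep n = (\<lambda>(x, j). (x \<circ> map_prod (swap_ends n) (swap_ends n), j \<circ> swap_ends n))"

definition kappa :: "nat \<Rightarrow> rep set \<Rightarrow> rep set" where
  "kappa n Q = kappa_rep n ` Q"

text \<open>\<open>\<kappa>\<^sup>*\<close> from \<open>\<Oplus>\<^sub>v M(\<L>(\<^bold>v, \<^bold>w))\<close> to \<open>\<Oplus>\<^sub>v M(\<L>(\<^bold>v, \<^bold>w\<^sup>*))\<close>: pullback along
  \<open>\<kappa> : \<L>(\<^bold>v, \<^bold>w\<^sup>*) \<rightarrow> \<L>(\<^bold>v\<^sup>*, \<^bold>w)\<close>.\<close>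

definition kappa_pull :: "nat \<Rightarrow> dimvec \<Rightarrow> graded_fun \<Rightarrow> graded_fun" where
  "kappa_pull n w f =
     (\<lambda>v. pullback (quiver_variety n v (star n w)) (kappa n) (f (star n v)))"

definition y_vec :: "nat \<Rightarrow> nat \<Rightarrow> dimvec" where
  "y_vec n k = (\<lambda>i. if k \<le> i \<and> i \<le> n - 1 then 1 else 0)"

definition z_vec :: "nat \<Rightarrow> nat \<Rightarrow> dimvec" where
  "z_vec n k = (\<lambda>i. if k \<le> i \<and> i \<le> n - 2 \<or> i = n then 1 else 0)"

text \<open>The linear extensions of \<open>a\<^sub>k\<close> and \<open>b\<^sub>k\<close>, written by components. The sign is that
  of the component \<open>f v\<close> to which the operator is applied.\<close>

definition a_op :: "nat \<Rightarrow> dimvec \<Rightarrow> nat \<Rightarrow> graded_fun \<Rightarrow> graded_fun" where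
  "a_op n w k f =
     (let sgn = (\<lambda>v. (- 1) ^ rows_before n k (young_of n w v));
          len = (\<lambda>v. length (young_of n w v)) in
      if k = n
      then kappa_pull n w (\<lambda>v p. if even (w n + len v) then (- 1) ^ len v * f v p else 0)
      else kappa_pull n w (\<lambda>v p. \<Sum>u \<in> {y_vec n k, z_vec n k}.
             sgn (v + u) * corr_down n (v + u) w u (f (v + u)) p))"

definition b_op :: "nat \<Rightarrow> dimvec \<Rightarrow> nat \<Rightarrow> graded_fun \<Rightarrow> graded_fun" where
  "b_op n w k f =
     (let sgn = (\<lambda>v. (- 1) ^ rows_before n k (young_of n w v));
          len = (\<lambda>v. length (young_of n w v)) in
      if k = n
      then kappa_pull n w (\<lambda>v p. if odd (w n + len v) then (- 1) ^ len v * f v p else 0)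
      else kappa_pull n w (\<lambda>v p. \<Sum>u \<in> {y_vec n k, z_vec n k}.
             sgn (v - u) * corr_up n v w u (f (v - u)) p))"

text \<open>Operators on the direct sum over \<open>\<^bold>w \<in> {\<^bold>w\<^bsup>n-1\<^esup>, \<^bold>w\<^sup>n}\<close>, whose elements are pairs.
  As \<open>\<kappa>\<^sup>*\<close> exchanges the two values of \<open>\<^bold>w\<close>, the operators \<open>a\<^sub>k\<close>, \<open>b\<^sub>k\<close> exchange the summands.\<close>

definition spin_space :: "nat \<Rightarrow> (graded_fun \<times> graded_fun) set" where
  "spin_space n = L_space n (unitv (n - 1)) \<times> L_space n (unitv n)"

definition E_spin :: "nat \<Rightarrow> nat \<Rightarrow> graded_fun \<times> graded_fun \<Rightarrow> graded_fun \<times> graded_fun" where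
  "E_spin n k = (\<lambda>(f, g). (E_op n (unitv (n - 1)) k f, E_op n (unitv n) k g))"

definition F_spin :: "nat \<Rightarrow> nat \<Rightarrow> graded_fun \<times> graded_fun \<Rightarrow> graded_fun \<times> graded_fun" where
  "F_spin n k = (\<lambda>(f, g). (F_op n (unitv (n - 1)) k f, F_op n (unitv n) k g))"

definition a_spin :: "nat \<Rightarrow> nat \<Rightarrow> graded_fun \<times> graded_fun \<Rightarrow> graded_fun \<times> graded_fun" where
  "a_spin n k = (\<lambda>(f, g). (a_op n (unitv n) k g, a_op n (unitv (n - 1)) k f))"

definition b_spin :: "nat \<Rightarrow> nat \<Rightarrow> graded_fun \<times> graded_fun \<Rightarrow> graded_fun \<times> graded_fun" where
  "b_spin n k = (\<lambda>(f, g). (b_op n (unitv n) k g, b_op n (unitv (n - 1)) k f))"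

end

theory Submission
  imports Defs
begin

text \<open>
The quiver varieties for a framing at one of the two spin vertices are points or empty, and so are
all correspondences between them. The operators therefore act on functions of a discrete parameter,
the set \<open>D \<subseteq> {1..n - 1}\<close> of endpoints of the rows of a Young diagram, where the identities are a
sign check.

Let \<open>p\<close> be the framed spin vertex, \<open>q\<close> the other one, and \<open>m = n - 2\<close> the branch vertex. Composing
the framing with all paths from \<open>V\<^sub>i\<close> to \<open>V\<^sub>p\<close> gives linear forms on \<open>V\<^sub>i\<close>, and stability says that they
have no common zero except \<open>0\<close>. By the preprojective relations the forms on \<open>V\<^sub>m\<close> come from the paths that
alternate between the loops through \<open>p\<close> and through \<open>q\<close>; at every vertex they form one sequence
\<open>f\<^sub>0, f\<^sub>1, \<dots>\<close>, the successive transforms of \<open>f\<^sub>0\<close> under a nilpotent operator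
(\<open>covector_shift\<close>). An independent cyclic sequence of this kind is a basis of the dual
space, so \<open>f\<^sub>k = 0\<close> exactly when \<open>k \<ge> dim V\<^sub>i\<close> (\<open>cyclic_covectors\<close>). Every arrow pulls each form back
to another one of them or to zero, by a rule that does not depend on the representation
(\<open>covector_pull\<close>). Hence in the coordinates given by these forms all matrices are determined by the
dimension vector. So there is at most one orbit (\<open>rep_orbit_eq\<close>), the dimension vectors
that occur are order ideals for the rule, and a subrepresentation is cut out by the forms \<open>f\<^sub>k\<close> with
\<open>k\<close> at least the dimension of the subspace at each vertex (\<open>column_spaces_eq_canonical_sub\<close>). Consequently every
correspondence has at most one point (\<open>points_flag_variety\<close>), and since the Euler characteristic of a
point is \<open>1\<close>, pushing forward and pulling back only transports the value at one point.

The order ideals are the dimension vectors of Young diagrams: along the long arm the dimension grows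
by at most one from each vertex to the next, and the places of growth are the endpoints. In terms of
\<open>D\<close> the operator \<open>a\<^sub>k\<close> removes the endpoint \<open>k\<close> and \<open>b\<^sub>k\<close> adds it, both with the sign of the number of
smaller endpoints, while \<open>E\<^sub>k\<close> moves an endpoint from \<open>k\<close> to \<open>k + 1\<close> if \<open>k \<le> n - 2\<close>; for \<open>k \<in> {n - 1, n}\<close>, \<open>E\<^sub>k\<close> removes
the endpoint \<open>n - 1\<close>, and which of the two does so depends on the parity of \<open>card D\<close>. The vanishing of \<open>a\<^sub>n\<close>
and \<open>b\<^sub>n\<close> in one parity selects the right one. In each product the signs of the two factors agree and cancel.

The varieties in between are not empty when those at the ends are not: the diagrams for which a point
exists are closed under passing to smaller ones (\<open>nonempty_down\<close>), and the diagram in the middle of a product is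
contained in one at its ends.\<close>

section \<open>Euler characteristic of a point\<close>

lemma abelian_rank_trivial:
  assumes "comm_group G" and triv: "trivial_group G"
  shows "abelian_rank G = 0"
proof -
  interpret comm_group G by fact
  have c: "carrier G = {\<one>\<^bsub>G\<^esub>}" using triv by (simp add: trivial_group_def)
  have "B = {}" if B: "int_independent G B" for B
  proof (rule ccontr)
    assume "B \<noteq> {}"
    with B c have B1: "B = {\<one>\<^bsub>G\<^esub>}" by (auto simp: int_independent_def)
    have "finprod G (\<lambda>b. b [^]\<^bsub>G\<^esub> (1::int)) B = \<one>\<^bsub>G\<^esub>"
      by (simp add: B1)
    with B show False
      unfolding int_independent_def B1 by (auto dest!: spec[of _ "\<lambda>_. 1"])
  qed
  moreover have "int_independent G {}"
    by (simp add: int_independent_def)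
  ultimately have "{card B |B. int_independent G B} = {0}"
    by force
  then show ?thesis
    by (simp add: abelian_rank_def)
qed

lemma abelian_rank_infinite_cyclic:
  assumes "comm_group G" and g: "g \<in> carrier G"
    and gen: "carrier G = range (\<lambda>k::int. g [^]\<^bsub>G\<^esub> k)"
    and inj: "inj (\<lambda>k::int. g [^]\<^bsub>G\<^esub> k)"
  shows "abelian_rank G = 1"
proof -
  interpret comm_group G by fact
  have pow_one: "k = 0" if "g [^]\<^bsub>G\<^esub> k = \<one>\<^bsub>G\<^esub>" for k :: int
    using inj that by (metis injD int_pow_0)
  have "card B \<le> 1" if B: "int_independent G B" for B
  proof (rule ccontr)
    assume "\<not> card B \<le> 1"
    moreover have fin: "finite B" and sub: "B \<subseteq> carrier G"
      using B by (auto simp: int_independent_def)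
    ultimately obtain a b where ab: "a \<in> B" "b \<in> B" "a \<noteq> b"
      by (metis card_le_Suc0_iff_eq One_nat_def)
    then obtain k l :: int where kl: "a = g [^]\<^bsub>G\<^esub> k" "b = g [^]\<^bsub>G\<^esub> l"
      using sub gen by (metis imageE subsetD)
    \<comment> \<open>the relation \<open>(g\<^sup>k)\<^sup>l = (g\<^sup>l)\<^sup>k\<close>\<close>
    define c where "c x = (if x = a then l else if x = b then - k else 0)" for x
    have "finprod G (\<lambda>x. x [^]\<^bsub>G\<^esub> c x) B = finprod G (\<lambda>x. x [^]\<^bsub>G\<^esub> c x) {a, b}"
      using ab fin sub
      by (intro finprod_mono_neutral_cong_right) (auto simp: c_def)
    also have "\<dots> = a [^]\<^bsub>G\<^esub> l \<otimes>\<^bsub>G\<^esub> b [^]\<^bsub>G\<^esub> (- k)"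
      using ab sub by (subst finprod_insert) (auto simp: c_def)
    also have "\<dots> = g [^]\<^bsub>G\<^esub> (k * l + l * (- k))"
      using g by (simp only: kl int_pow_pow int_pow_mult)
    also have "\<dots> = \<one>\<^bsub>G\<^esub>"
      by (simp add: mult.commute)
    finally have "\<forall>x\<in>B. c x = 0"
      using B by (simp add: int_independent_def)
    then have "l = 0" "k = 0"
      using ab by (force simp: c_def)+
    then show False
      using ab kl by simp
  qed
  moreover have "int_independent G {g}"
    using g pow_one by (auto simp: int_independent_def)
  then have "1 \<in> {card B |B. int_independent G B}"
    by (force intro: exI[of _ "{g}"])
  ultimately show ?thesis
    unfolding abelian_rank_def by (intro cSup_eq_maximum) auto
qed

lemma euler_char_point:
  assumes X: "topspace X = {a}"
  shows "euler_char X = 1"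
proof -
  let ?f = "restrict (\<lambda>_. a) (standard_simplex 0)"
  let ?q = "homologous_rel_set 0 X {} (frag_of ?f)"
  let ?H = "homology_group 0 X"
  have pc: "path_connected_space X"
    using X by (metis path_connectedin_singleton path_connectedin_topspace singletonI)
  have f: "singular_simplex 0 X ?f"
    using X by (simp add: singular_simplex_def continuous_map_const)
  have iso: "pow ?H ?q \<in> iso integer_group ?H"
    by (rule iso_integer_zeroth_homology_group[OF pc f])
  then have bij: "bij_betw (\<lambda>k::int. ?q [^]\<^bsub>?H\<^esub> k) UNIV (carrier ?H)"
    by (simp add: iso_def integer_group_def)
  interpret H: comm_group ?H by (rule abelian_homology_group)
  have q: "?q \<in> carrier ?H"
  proof -
    have "singular_relcycle 0 X {} (frag_of ?f)"
      by (simp add: chain_boundary_def f singular_chain_of singular_cycle)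
    then show ?thesis
      by (simp add: carrier_relative_homology_group_0)
  qed
  have "betti 0 X = 1"
    unfolding betti_def of_nat_0
    using bij by (intro abelian_rank_infinite_cyclic[OF abelian_homology_group q])
      (auto simp: bij_betw_def)
  moreover have "betti p X = 0" if "p \<noteq> 0" for p
    unfolding betti_def using that
    by (intro abelian_rank_trivial homology_dimension_axiom[OF X] abelian_homology_group) auto
  ultimately have "{p. betti p X \<noteq> 0} = {0}"
    by force
  with \<open>betti 0 X = 1\<close> show ?thesis
    by (simp add: euler_char_def)
qed

lemma euler_char_empty:
  assumes X: "topspace X = {}"
  shows "euler_char X = 0"
proof -
  have "betti p X = 0" for p
    unfolding betti_def
    by (intro abelian_rank_trivial trivial_homology_group_empty[OF X] abelian_homology_group)
  then show ?thesis
    by (simp add: euler_char_def)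
qed

section \<open>Matrices\<close>

lemma transpose_mult_unit_vec:
  fixes A :: "'a :: field mat"
  assumes A: "A \<in> carrier_mat r c" and "i < r"
  shows "A\<^sup>T *\<^sub>v unit_vec r i = Matrix.row A i"
  using assms by (intro eq_vecI) auto

lemma mult_mat_zero_vec:
  fixes A :: "'a :: field mat"
  assumes A: "A \<in> carrier_mat r c"
  shows "A *\<^sub>v 0\<^sub>v c = 0\<^sub>v r"
  using assms by (intro eq_vecI) auto

text \<open>Padding with zero rows makes the matrix square with determinant zero.\<close>

lemma wide_matrix_kernel:
  fixes A :: "'a :: field mat"
  assumes A: "A \<in> carrier_mat r c" and "r < c"
  shows "\<exists>s \<in> carrier_vec c. s \<noteq> 0\<^sub>v c \<and> A *\<^sub>v s = 0\<^sub>v r"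
proof -
  define P where "P = mat c c (\<lambda>(i, k). if i < r then A $$ (i, k) else 0)"
  have P: "P \<in> carrier_mat c c" by (simp add: P_def)
  have "Matrix.row P r = 0\<^sub>v c"
    using \<open>r < c\<close> by (auto simp: P_def)
  then have "det (P\<^sup>T) = 0"
    using \<open>r < c\<close> P transpose_mult_unit_vec[OF P \<open>r < c\<close>]
    by (subst det_0_iff_vec_prod_zero_field[of _ c]) (auto intro!: exI[of _ "unit_vec c r"])
  then have "det P = 0"
    using P by (simp add: det_transpose)
  then obtain s where s: "s \<in> carrier_vec c" "s \<noteq> 0\<^sub>v c" "P *\<^sub>v s = 0\<^sub>v c"
    using det_0_iff_vec_prod_zero_field[OF P] by auto
  have "A *\<^sub>v s = 0\<^sub>v r"
  proof (rule eq_vecI)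
    fix i assume "i < dim_vec (0\<^sub>v r :: 'a Matrix.vec)"
    then have i: "i < r" by simp
    then have "Matrix.row A i = Matrix.row P i"
      using A \<open>r < c\<close> by (auto simp: P_def)
    then have "(A *\<^sub>v s) $ i = (P *\<^sub>v s) $ i"
      using i A \<open>r < c\<close> P by simp
    then show "(A *\<^sub>v s) $ i = 0\<^sub>v r $ i"
      using i s(3) \<open>r < c\<close> by simp
  qed (use A in auto)
  with s show ?thesis by blast
qed

lemma injective_iff_kernel:
  fixes A :: "'a :: field mat"
  assumes A: "A \<in> carrier_mat r c"
  shows "inj_on (\<lambda>s. A *\<^sub>v s) (carrier_vec c) \<longleftrightarrow>
    (\<forall>s \<in> carrier_vec c. A *\<^sub>v s = 0\<^sub>v r \<longrightarrow> s = 0\<^sub>v c)"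
proof
  assume inj: "inj_on (\<lambda>s. A *\<^sub>v s) (carrier_vec c)"
  show "\<forall>s \<in> carrier_vec c. A *\<^sub>v s = 0\<^sub>v r \<longrightarrow> s = 0\<^sub>v c"
    using inj_onD[OF inj] mult_mat_zero_vec[OF A] by auto
next
  assume ker: "\<forall>s \<in> carrier_vec c. A *\<^sub>v s = 0\<^sub>v r \<longrightarrow> s = 0\<^sub>v c"
  show "inj_on (\<lambda>s. A *\<^sub>v s) (carrier_vec c)"
  proof (rule inj_onI)
    fix s t assume st: "s \<in> carrier_vec c" "t \<in> carrier_vec c" "A *\<^sub>v s = A *\<^sub>v t"
    have "A *\<^sub>v t \<in> carrier_vec r" using A st(2) by (rule mult_mat_vec_carrier)
    then have "A *\<^sub>v (s - t) = 0\<^sub>v r"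
      using A st by (simp add: mult_minus_distrib_mat_vec)
    then have "s - t = 0\<^sub>v c"
      using ker st by auto
    then have "s $ i - t $ i = 0" if "i < c" for i
      using st that by (metis carrier_vecD index_minus_vec(1) index_zero_vec(1))
    then show "s = t"
      using st by (intro eq_vecI) auto
  qed
qed

lemma injective_mult_cancel:
  fixes A :: "'a :: field mat"
  assumes A: "A \<in> carrier_mat r c" "inj_on (\<lambda>s. A *\<^sub>v s) (carrier_vec c)"
    and M: "M \<in> carrier_mat c d" "N \<in> carrier_mat c d" and eq: "A * M = A * N"
  shows "M = N"
proof (rule mat_col_eqI)
  fix i assume "i < dim_col N"
  then have i: "i < d" using M by simp
  have "A *\<^sub>v col M i = A *\<^sub>v col N i"
    using A(1) M i eq by (metis col_mult2)
  then show "col M i = col N i"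
    using inj_onD[OF A(2)] M by (metis carrier_matD(1) col_carrier_vec col_dim)
qed (use M in auto)

lemma unit_mat_inverse:
  assumes "A \<in> Units (ring_mat TYPE(complex) r ())"
  shows "mat_inv r A \<in> carrier_mat r r" "A * mat_inv r A = 1\<^sub>m r" "mat_inv r A * A = 1\<^sub>m r"
    "mat_inv r A \<in> Units (ring_mat TYPE(complex) r ())"
proof -
  interpret ring "ring_mat TYPE(complex) r ()" by (rule ring_mat)
  show "A * mat_inv r A = 1\<^sub>m r" "mat_inv r A * A = 1\<^sub>m r"
    "mat_inv r A \<in> Units (ring_mat TYPE(complex) r ())"
    using assms by (simp_all add: mat_inv_def ring_mat_simps Units_r_inv[simplified ring_mat_simps]
        Units_l_inv[simplified ring_mat_simps])
  then show "mat_inv r A \<in> carrier_mat r r"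
    by (auto simp: Units_def ring_mat_simps)
qed

lemma unit_mat_iff_injective:
  "A \<in> Units (ring_mat TYPE(complex) r ()) \<longleftrightarrow>
    A \<in> carrier_mat r r \<and> inj_on (\<lambda>s. A *\<^sub>v s) (carrier_vec r)"
proof -
  have "A \<in> Units (ring_mat TYPE(complex) r ()) \<longleftrightarrow> A \<in> carrier_mat r r \<and> det A \<noteq> 0"
    using det_non_zero_imp_unit[of A r "()"] unit_imp_det_non_zero[of A r "()"]
    by (auto simp: Units_def ring_mat_simps)
  then show ?thesis
    using injective_iff_kernel[of A r r] det_0_iff_vec_prod_zero_field[of A r] by blast
qed

lemma subspace_module_vec_iff:
  "VectorSpace.subspace class_ring S (module_vec TYPE('a :: field) r) \<longleftrightarrow>
    S \<subseteq> carrier_vec r \<and> 0\<^sub>v r \<in> S \<and> (\<forall>s \<in> S. \<forall>t \<in> S. s + t \<in> S) \<and> (\<forall>c. \<forall>s \<in> S. c \<cdot>\<^sub>v s \<in> S)"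
proof -
  interpret vec_space "TYPE('a)" r .
  show ?thesis
    by (auto simp: VectorSpace.subspace_def submodule_def vectorspace_axioms module_axioms
        module_vec_simps class_ring_simps)
qed

lemma subspace_column_space:
  assumes "(A :: 'a :: field mat) \<in> carrier_mat r c"
    and S: "VectorSpace.subspace class_ring S (module_vec TYPE('a) c)"
  shows "VectorSpace.subspace class_ring ((\<lambda>s. A *\<^sub>v s) ` S) (module_vec TYPE('a) r)"
  using assms unfolding subspace_module_vec_iff
  apply (auto simp: image_iff mult_mat_zero_vec)
    apply (metis mult_mat_zero_vec)
   apply (metis mult_add_distrib_mat_vec subsetD)
  by (metis mult_mat_vec subsetD)

text \<open>Rank-nullity for the linear map \<open>A\<close>, whose kernel is zero.\<close>

lemma dim_column_space:
  assumes A: "(A :: 'a :: field mat) \<in> carrier_mat r c"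
    and inj: "inj_on (\<lambda>s. A *\<^sub>v s) (carrier_vec c)"
  shows "vectorspace.dim class_ring
    ((module_vec TYPE('a) r)\<lparr>carrier := (\<lambda>s. A *\<^sub>v s) ` carrier_vec c\<rparr>) = c"
proof -
  interpret V: vec_space "TYPE('a)" c .
  interpret W: vec_space "TYPE('a)" r .
  interpret linear_map class_ring "module_vec TYPE('a) c" "module_vec TYPE('a) r" "\<lambda>s. A *\<^sub>v s"
    apply unfold_locales
    using A
    by (auto simp: module_hom_def module_vec_simps mult_add_distrib_mat_vec mult_mat_vec)
  have ker: "kerT = {0\<^sub>v c}"
    using injective_iff_kernel[OF A] inj mult_mat_zero_vec[OF A]
    by (auto simp: ker_def module_vec_simps)
  interpret K: vectorspace class_ring "(module_vec TYPE('a) c)\<lparr>carrier := {0\<^sub>v c}\<rparr>"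
    using V.subspace_is_vs[OF kerT_is_subspace] by (simp add: ker)
  have "K.basis {}"
    unfolding K.basis_def
    by (auto simp: K.lin_dep_def K.span_def K.lincomb_def  module_vec_simps)
  then have "K.dim = 0"
    using K.dim_basis by fastforce
  then show ?thesis
    using rank_nullity[OF V.fin_dim] V.dim_is_n
    by (simp add: ker im_def module_vec_simps)
qed


section \<open>Injective homomorphisms of framed representations\<close>

lemma edges_vertices:
  assumes "n \<ge> 4" "h \<in> edges n"
  shows "fst h \<in> vertices n" "snd h \<in> vertices n" "prod.swap h \<in> edges n"
  using assms by (auto simp: edges_def Omega_def vertices_def)

definition framed_reps :: "nat \<Rightarrow> dimvec \<Rightarrow> dimvec \<Rightarrow> rep set" where
  "framed_reps n v w = edge_maps n v \<times> framing_maps n v w"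

text \<open>The matrices \<open>A i\<close> have independent columns and intertwine \<open>p'\<close> with \<open>p\<close>. Thus \<open>p'\<close> is the matrix form,
in the basis of columns, of the restriction of \<open>p\<close> to their span. For \<open>v' = v\<close> it says that the
group element \<open>A\<close> takes \<open>p'\<close> to \<open>p\<close>.\<close>

definition embeds :: "nat \<Rightarrow> dimvec \<Rightarrow> dimvec \<Rightarrow> (nat \<Rightarrow> complex mat) \<Rightarrow> rep \<Rightarrow> rep \<Rightarrow> bool" where
  "embeds n v' v A p' p \<longleftrightarrow> A \<in> frames n v' v \<and>
     (\<forall>h \<in> edges n. fst p h * A (fst h) = A (snd h) * fst p' h) \<and>
     (\<forall>i \<in> vertices n. snd p i * A i = snd p' i)"

lemma Lambda_st_reps: "Lambda_st n v w \<subseteq> framed_reps n v w"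
  by (auto simp: Lambda_st_def framed_reps_def Lambda_V_def)

lemma framed_reps_carrier:
  assumes "p \<in> framed_reps n v w"
  shows "h \<in> edges n \<Longrightarrow> fst p h \<in> carrier_mat (v (snd h)) (v (fst h))"
    "i \<in> vertices n \<Longrightarrow> snd p i \<in> carrier_mat (w i) (v i)"
  using assms by (auto simp: framed_reps_def edge_maps_def framing_maps_def PiE_iff)

lemma frames_carrier:
  assumes "A \<in> frames n v' v" "i \<in> vertices n"
  shows "A i \<in> carrier_mat (v i) (v' i)" "inj_on (\<lambda>c. A i *\<^sub>v c) (carrier_vec (v' i))"
  using assms by (auto simp: frames_def PiE_iff)

lemma embeds_path:
  assumes n: "n \<ge> 4" and p: "p \<in> framed_reps n v w" and p': "p' \<in> framed_reps n v' w"
    and A: "embeds n v' v A p' p"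
    and "set (h # hs) \<subseteq> edges n" "successively (\<lambda>h h'. snd h = fst h') (h # hs)"
  shows "foldl (\<lambda>M h'. fst p h' * M) (fst p h) hs \<in> carrier_mat (v (snd (last (h # hs)))) (v (fst h)) \<and>
    foldl (\<lambda>M h'. fst p' h' * M) (fst p' h) hs \<in> carrier_mat (v' (snd (last (h # hs)))) (v' (fst h)) \<and>
    foldl (\<lambda>M h'. fst p h' * M) (fst p h) hs * A (fst h) =
    A (snd (last (h # hs))) * foldl (\<lambda>M h'. fst p' h' * M) (fst p' h) hs"
  using assms(5,6)
proof (induction hs rule: rev_induct)
  case Nil
  then show ?case
    using A framed_reps_carrier(1)[OF p] framed_reps_carrier(1)[OF p'] by (auto simp: embeds_def)
next
  case (snoc k hs)
  have k: "k \<in> edges n" and sn: "snd (last (h # hs)) = fst k"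
    and suc: "successively (\<lambda>h h'. snd h = fst h') (h # hs)"
    using snoc.prems by (auto simp: successively_append_iff simp del: append_Cons simp flip: append_Cons)
  let ?M = "foldl (\<lambda>M h'. fst p h' * M) (fst p h) hs"
  let ?M' = "foldl (\<lambda>M h'. fst p' h' * M) (fst p' h) hs"
  have M: "?M \<in> carrier_mat (v (fst k)) (v (fst h))" "?M' \<in> carrier_mat (v' (fst k)) (v' (fst h))"
    "?M * A (fst h) = A (fst k) * ?M'"
    using snoc.IH[OF _ suc] snoc.prems(1) sn by auto
  have kk: "fst p k \<in> carrier_mat (v (snd k)) (v (fst k))"
    "fst p' k \<in> carrier_mat (v' (snd k)) (v' (fst k))"
    "fst p k * A (fst k) = A (snd k) * fst p' k"
    using framed_reps_carrier(1)[OF p k] framed_reps_carrier(1)[OF p' k] A k by (auto simp: embeds_def)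
  have AA: "A (fst k) \<in> carrier_mat (v (fst k)) (v' (fst k))"
    "A (snd k) \<in> carrier_mat (v (snd k)) (v' (snd k))" "A (fst h) \<in> carrier_mat (v (fst h)) (v' (fst h))"
    using A frames_carrier(1)[of A n v' v] edges_vertices(1,2)[OF n] k snoc.prems(1)
    unfolding embeds_def by (blast, blast, simp)
  have "(fst p k * ?M) * A (fst h) = fst p k * (?M * A (fst h))"
    using M kk AA by simp
  also have "\<dots> = (fst p k * A (fst k)) * ?M'"
    using M(2) kk(1) AA by (simp add: M(3))
  also have "\<dots> = A (snd k) * (fst p' k * ?M')"
    using M(2) kk AA by simp
  finally show ?case
    using M kk by simp
qed

text \<open>A subrepresentation of a stable point of the nilpotent variety is again one: all the defining
  conditions can be tested after applying the injective maps \<open>A i\<close>.\<close>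

lemma embeds_stable:
  assumes n: "n \<ge> 4" and p: "p \<in> Lambda_st n v w" and p': "p' \<in> framed_reps n v' w"
    and A: "embeds n v' v A p' p"
  shows "p' \<in> Lambda_st n v' w"
proof -
  obtain x j x' j' where pp: "p = (x, j)" "p' = (x', j')" by fastforce
  have pr: "p \<in> framed_reps n v w" using p Lambda_st_reps by blast
  have Af: "A \<in> frames n v' v" and Ax: "\<And>h. h \<in> edges n \<Longrightarrow> x h * A (fst h) = A (snd h) * x' h"
    and Aj: "\<And>i. i \<in> vertices n \<Longrightarrow> j i * A i = j' i"
    using A by (auto simp: embeds_def pp)
  note Ac = frames_carrier[OF Af]
  note xc = framed_reps_carrier[OF pr, unfolded pp fst_conv snd_conv]
  note xc' = framed_reps_carrier[OF p', unfolded pp fst_conv snd_conv]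
  note ev = edges_vertices[OF n]
  have cancel: "M = 0\<^sub>m (v' i) d"
    if "i \<in> vertices n" "M \<in> carrier_mat (v' i) d" "A i * M = 0\<^sub>m (v i) d" for i d M
    by (rule injective_mult_cancel[OF Ac[OF that(1)]]) (use that Ac[OF that(1)] in auto)
  have nil: "nilpotent_rep n v' x'"
  proof -
    obtain N where N: "N \<ge> 1" and N0: "\<And>h hs. length (h # hs) = N \<Longrightarrow> set (h # hs) \<subseteq> edges n \<Longrightarrow>
        successively (\<lambda>h h'. snd h = fst h') (h # hs) \<Longrightarrow>
        foldl (\<lambda>A h'. x h' * A) (x h) hs = 0\<^sub>m (v (snd (last (h # hs)))) (v (fst h))"
      using p unfolding pp Lambda_st_def Lambda_V_def nilpotent_rep_def by blast
    have "foldl (\<lambda>A h'. x' h' * A) (x' h) hs = 0\<^sub>m (v' (snd (last (h # hs)))) (v' (fst h))"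
      if h: "length (h # hs) = N" "set (h # hs) \<subseteq> edges n"
        "successively (\<lambda>h h'. snd h = fst h') (h # hs)" for h hs
    proof -
      have l: "last (h # hs) \<in> edges n" using h(2) last_in_set[of "h # hs"] by blast
      have h0: "fst h \<in> vertices n" using h(2) ev by auto
      note e = embeds_path[OF n pr p' A h(2,3), unfolded pp fst_conv]
      show ?thesis
        using e Ac(1)[OF h0] by (intro cancel[OF ev(2)[OF l]]) (auto simp: N0[OF h])
    qed
    then show ?thesis using N unfolding nilpotent_rep_def by blast
  qed
  have mom: "moment_zero n v' x'"
    unfolding moment_zero_def
  proof (intro ballI allI impI)
    fix i r c assume i: "i \<in> vertices n" and r: "r < v' i" and c: "c < v' i"
    let ?H = "{h \<in> edges n. snd h = i}"
    define S where "S r c = (\<Sum>h\<in>?H. eps n h * (x h * x (prod.swap h)) $$ (r, c))" for r c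
    define S' where "S' r c = (\<Sum>h\<in>?H. eps n h * (x' h * x' (prod.swap h)) $$ (r, c))" for r c
    have S0: "S r c = 0" if "r < v i" "c < v i" for r c
      using p i that unfolding pp Lambda_st_def Lambda_V_def moment_zero_def S_def by blast
    let ?M = "mat (v' i) (v' i) (\<lambda>(r, c). S' r c)"
    have eq: "(A i * (x' h * x' (prod.swap h))) = (x h * x (prod.swap h)) * A i" if h: "h \<in> ?H" for h
    proof -
      have hh: "h \<in> edges n" "prod.swap h \<in> edges n" "snd h = i" "fst (prod.swap h) = i"
        "snd (prod.swap h) = fst h"
        using h ev(3) by auto
      have "(x h * x (prod.swap h)) * A i = x h * (x (prod.swap h) * A (fst (prod.swap h)))"
        using xc(1)[OF hh(1)] xc(1)[OF hh(2)] Ac(1)[OF i] hh by simp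
      also have "\<dots> = x h * (A (fst h) * x' (prod.swap h))"
        using Ax[OF hh(2)] by simp
      also have "\<dots> = (x h * A (fst h)) * x' (prod.swap h)"
        using xc(1)[OF hh(1)] xc'(1)[OF hh(2)] Ac(1)[OF ev(1)[OF hh(1)]] by simp
      also have "\<dots> = A i * (x' h * x' (prod.swap h))"
        using Ax[OF hh(1)] xc'(1)[OF hh(1)] xc'(1)[OF hh(2)] Ac(1)[OF i] hh by simp
      finally show ?thesis by simp
    qed
    have "A i * ?M = 0\<^sub>m (v i) (v' i)"
    proof (rule eq_matI)
      fix a b assume "a < dim_row (0\<^sub>m (v i) (v' i) :: complex mat)" "b < dim_col (0\<^sub>m (v i) (v' i) :: complex mat)"
      then have a: "a < v i" and b: "b < v' i" by auto
      have c': "x' h * x' (prod.swap h) \<in> carrier_mat (v' i) (v' i)" and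
        cc: "x h * x (prod.swap h) \<in> carrier_mat (v i) (v i)" if "h \<in> ?H" for h
        using that xc(1)[of h] xc(1)[of "prod.swap h"] xc'(1)[of h] xc'(1)[of "prod.swap h"] ev(3)
        by auto
      have entry: "(A i * N) $$ (a, b) = (\<Sum>k<v' i. A i $$ (a, k) * N $$ (k, b))"
        if "N \<in> carrier_mat (v' i) (v' i)" for N
        using that Ac(1)[OF i] a b by (auto simp: scalar_prod_def atLeast0LessThan)
      have entry': "(N * A i) $$ (a, b) = (\<Sum>k<v i. N $$ (a, k) * A i $$ (k, b))"
        if "N \<in> carrier_mat (v i) (v i)" for N
        using that Ac(1)[OF i] a b by (auto simp: scalar_prod_def atLeast0LessThan)
      have "(A i * ?M) $$ (a, b) = (\<Sum>k<v' i. A i $$ (a, k) * S' k b)"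
        using b by (subst entry) auto
      also have "\<dots> = (\<Sum>h\<in>?H. eps n h * (A i * (x' h * x' (prod.swap h))) $$ (a, b))"
        unfolding S'_def sum_distrib_left
        by (subst sum.swap) (simp add: entry c' sum_distrib_left mult.left_commute)
      also have "\<dots> = (\<Sum>h\<in>?H. eps n h * ((x h * x (prod.swap h)) * A i) $$ (a, b))"
        by (intro sum.cong refl) (simp only: eq)
      also have "\<dots> = (\<Sum>k<v i. S a k * A i $$ (k, b))"
        unfolding S_def sum_distrib_right
        by (subst sum.swap) (simp add: entry' cc sum_distrib_left mult.assoc)
      also have "\<dots> = 0"
        using S0 a by simp
      finally show "(A i * ?M) $$ (a, b) = 0\<^sub>m (v i) (v' i) $$ (a, b)"
        using a b by simp
    qed (use Ac(1)[OF i] in auto)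
    then have "?M = 0\<^sub>m (v' i) (v' i)"
      by (intro cancel[OF i]) auto
    then have "?M $$ (r, c) = 0"
      using r c by simp
    then show "S' r c = 0"
      using r c by simp
  qed
  have stab: "\<forall>i \<in> vertices n. S i = {0\<^sub>v (v' i)}"
    if S: "S \<in> graded_subspaces n v'" "x_stable n x' S"
      "\<forall>i \<in> vertices n. \<forall>s \<in> S i. j' i *\<^sub>v s = 0\<^sub>v (w i)" for S
  proof -
    define T where "T = (\<lambda>i \<in> vertices n. (\<lambda>s. A i *\<^sub>v s) ` S i)"
    have Sc: "S i \<subseteq> carrier_vec (v' i)" if "i \<in> vertices n" for i
      using S(1) that by (auto simp: graded_subspaces_def PiE_iff subspace_module_vec_iff)
    have "T \<in> graded_subspaces n v"
      using S(1) Ac(1) by (auto simp: T_def graded_subspaces_def PiE_iff intro!: subspace_column_space)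
    moreover have "x_stable n x T"
      unfolding x_stable_def
    proof (intro ballI)
      fix h t assume h: "h \<in> edges n" and "t \<in> T (fst h)"
      then obtain s where s: "s \<in> S (fst h)" "t = A (fst h) *\<^sub>v s"
        using ev(1) by (auto simp: T_def)
      have sc: "s \<in> carrier_vec (v' (fst h))" using s Sc ev h by blast
      have "x h *\<^sub>v t = (x h * A (fst h)) *\<^sub>v s"
        using s(2) xc(1)[OF h] Ac(1)[OF ev(1)[OF h]] sc by simp
      also have "\<dots> = A (snd h) *\<^sub>v (x' h *\<^sub>v s)"
        using Ax[OF h] xc'(1)[OF h] Ac(1)[OF ev(2)[OF h]] sc by simp
      also have "\<dots> \<in> T (snd h)"
        using S(2) s(1) h ev(2)[OF h] by (auto simp: T_def x_stable_def)
      finally show "x h *\<^sub>v t \<in> T (snd h)" .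
    qed
    moreover have "\<forall>i \<in> vertices n. \<forall>s \<in> T i. j i *\<^sub>v s = 0\<^sub>v (w i)"
    proof (intro ballI)
      fix i t assume i: "i \<in> vertices n" and "t \<in> T i"
      then obtain s where s: "s \<in> S i" "t = A i *\<^sub>v s" by (auto simp: T_def)
      then have "j i *\<^sub>v t = (j i * A i) *\<^sub>v s"
        using xc(2)[OF i] Ac(1)[OF i] Sc[OF i] by (metis assoc_mult_mat_vec subsetD)
      then show "j i *\<^sub>v t = 0\<^sub>v (w i)"
        using S(3) i s Aj by auto
    qed
    ultimately have T0: "\<forall>i \<in> vertices n. T i = {0\<^sub>v (v i)}"
      using p unfolding pp Lambda_st_def by blast
    show ?thesis
    proof
      fix i assume i: "i \<in> vertices n"
      have "s = 0\<^sub>v (v' i)" if "s \<in> S i" for s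
      proof -
        have "A i *\<^sub>v s = 0\<^sub>v (v i)" using T0 i that by (auto simp: T_def)
        then show ?thesis
          using injective_iff_kernel[OF Ac(1)[OF i]] Ac(2)[OF i] Sc[OF i] that by blast
      qed
      moreover have "0\<^sub>v (v' i) \<in> S i"
        using S(1) i by (auto simp: graded_subspaces_def PiE_iff subspace_module_vec_iff)
      ultimately show "S i = {0\<^sub>v (v' i)}" by blast
    qed
  qed
  show ?thesis
    using p' nil mom stab unfolding pp Lambda_st_def Lambda_V_def framed_reps_def by blast
qed


lemma embeds_comp:
  assumes n: "n \<ge> 4" and p: "p \<in> framed_reps n v w" and p': "p' \<in> framed_reps n v' w"
    and p'': "p'' \<in> framed_reps n v'' w"
    and A: "embeds n v' v A p' p" and B: "embeds n v'' v' B p'' p'"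
  shows "embeds n v'' v (\<lambda>i \<in> vertices n. A i * B i) p'' p"
proof -
  note pc = framed_reps_carrier[OF p] framed_reps_carrier[OF p'] framed_reps_carrier[OF p'']
  have Ac: "A i \<in> carrier_mat (v i) (v' i)" and Ai: "inj_on (\<lambda>c. A i *\<^sub>v c) (carrier_vec (v' i))"
    if "i \<in> vertices n" for i
    using A frames_carrier[OF _ that] by (auto simp: embeds_def)
  have Bc: "B i \<in> carrier_mat (v' i) (v'' i)" and Bi: "inj_on (\<lambda>c. B i *\<^sub>v c) (carrier_vec (v'' i))"
    if "i \<in> vertices n" for i
    using B frames_carrier[OF _ that] by (auto simp: embeds_def)
  have "(\<lambda>i \<in> vertices n. A i * B i) \<in> frames n v'' v"
  proof -
    have "inj_on (\<lambda>c. (A i * B i) *\<^sub>v c) (carrier_vec (v'' i))" if i: "i \<in> vertices n" for i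
    proof -
      have "inj_on (\<lambda>c. A i *\<^sub>v (B i *\<^sub>v c)) (carrier_vec (v'' i))"
      proof -
        have "(\<lambda>c. B i *\<^sub>v c) ` carrier_vec (v'' i) \<subseteq> carrier_vec (v' i)"
          using mult_mat_vec_carrier[OF Bc[OF i]] by blast
        from comp_inj_on[OF Bi[OF i] inj_on_subset[OF Ai[OF i] this]] show ?thesis
          by (simp add: o_def)
      qed
      then show ?thesis
        using Ac[OF i] Bc[OF i] by (simp add: inj_on_def)
    qed
    then show ?thesis
      unfolding frames_def using Ac Bc by (auto intro!: mult_carrier_mat)
  qed
  moreover have "fst p h * (A (fst h) * B (fst h)) = (A (snd h) * B (snd h)) * fst p'' h"
    if h: "h \<in> edges n" for h
  proof -
    note v = edges_vertices[OF n h]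
    have "fst p h * (A (fst h) * B (fst h)) = (fst p h * A (fst h)) * B (fst h)"
      using pc(1)[OF h] Ac[OF v(1)] Bc[OF v(1)] by simp
    also have "\<dots> = A (snd h) * (fst p' h * B (fst h))"
      using A h pc(3)[OF h] Ac[OF v(2)] Bc[OF v(1)] by (simp add: embeds_def)
    also have "\<dots> = (A (snd h) * B (snd h)) * fst p'' h"
      using B h pc(5)[OF h] Ac[OF v(2)] Bc[OF v(2)] by (simp add: embeds_def)
    finally show ?thesis .
  qed
  moreover have "snd p i * (A i * B i) = snd p'' i" if i: "i \<in> vertices n" for i
  proof -
    have "snd p i * (A i * B i) = (snd p i * A i) * B i"
      using pc(2)[OF i] Ac[OF i] Bc[OF i] by simp
    then show ?thesis
      using A B i by (simp add: embeds_def)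
  qed
  ultimately show ?thesis
    using edges_vertices[OF n] by (simp add: embeds_def)
qed

lemma column_spaces_graded_subspace:
  assumes A: "A \<in> frames n v' v"
  shows "column_spaces n v' A \<in> graded_subspaces n v"
    "i \<in> vertices n \<Longrightarrow> graded_dim v (column_spaces n v' A) i = v' i"
proof -
  have "VectorSpace.subspace class_ring (carrier_vec r) (module_vec TYPE(complex) r)" for r
    by (auto simp: subspace_module_vec_iff)
  then show "column_spaces n v' A \<in> graded_subspaces n v"
    using frames_carrier(1)[OF A]
    by (auto simp: column_spaces_def graded_subspaces_def PiE_iff intro!: subspace_column_space)
  show "graded_dim v (column_spaces n v' A) i = v' i" if "i \<in> vertices n"
    using dim_column_space[OF frames_carrier[OF A that]] that
    by (simp add: graded_dim_def column_spaces_def)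
qed

text \<open>The matrices of the restriction exist because every image \<open>x\<^sub>h s\<close> of a basis vector is again a
combination of the columns.\<close>

lemma column_spaces_stable_iff:
  assumes n: "n \<ge> 4" and p: "p \<in> framed_reps n v w" and A: "A \<in> frames n v' v"
  shows "x_stable n (fst p) (column_spaces n v' A) \<longleftrightarrow>
    (\<exists>p' \<in> framed_reps n v' w. embeds n v' v A p' p)"
proof
  note xc = framed_reps_carrier[OF p] and Ac = frames_carrier[OF A] and ev = edges_vertices[OF n]
  assume stab: "x_stable n (fst p) (column_spaces n v' A)"
  have "\<exists>M \<in> carrier_mat (v' (snd h)) (v' (fst h)). fst p h * A (fst h) = A (snd h) * M"
    if h: "h \<in> edges n" for h
  proof -
    have "\<exists>c \<in> carrier_vec (v' (snd h)). fst p h *\<^sub>v col (A (fst h)) k = A (snd h) *\<^sub>v c"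
      if k: "k < v' (fst h)" for k
    proof -
      have "A (fst h) *\<^sub>v unit_vec (v' (fst h)) k = col (A (fst h)) k"
        using Ac(1)[OF ev(1)[OF h]] k by (intro eq_vecI) auto
      then have "col (A (fst h)) k \<in> column_spaces n v' A (fst h)"
        using ev(1)[OF h]
        by (auto simp: column_spaces_def intro!: image_eqI[of _ _ "unit_vec (v' (fst h)) k"])
      then have "fst p h *\<^sub>v col (A (fst h)) k \<in> column_spaces n v' A (snd h)"
        using stab h by (simp add: x_stable_def)
      then show ?thesis
        using ev(2)[OF h] by (auto simp: column_spaces_def)
    qed
    then obtain c where c: "\<And>k. k < v' (fst h) \<Longrightarrow> c k \<in> carrier_vec (v' (snd h))"
      "\<And>k. k < v' (fst h) \<Longrightarrow> fst p h *\<^sub>v col (A (fst h)) k = A (snd h) *\<^sub>v c k"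
      by metis
    define M where "M = mat (v' (snd h)) (v' (fst h)) (\<lambda>(r, k). c k $ r)"
    have Mc: "M \<in> carrier_mat (v' (snd h)) (v' (fst h))" by (simp add: M_def)
    have colM: "col M k = c k" if "k < v' (fst h)" for k
      using c(1)[OF that] that by (auto simp: M_def)
    have "fst p h * A (fst h) = A (snd h) * M"
    proof (rule mat_col_eqI)
      fix k assume "k < dim_col (A (snd h) * M)"
      then have k: "k < v' (fst h)" using Mc by simp
      show "col (fst p h * A (fst h)) k = col (A (snd h) * M) k"
        unfolding col_mult2[OF xc(1)[OF h] Ac(1)[OF ev(1)[OF h]] k]
          col_mult2[OF Ac(1)[OF ev(2)[OF h]] Mc k] colM[OF k] by (rule c(2)[OF k])
    qed (use xc(1)[OF h] Ac(1)[OF ev(1)[OF h]] Ac(1)[OF ev(2)[OF h]] Mc in auto)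
    with Mc show ?thesis by blast
  qed
  then obtain x' where x': "\<And>h. h \<in> edges n \<Longrightarrow> x' h \<in> carrier_mat (v' (snd h)) (v' (fst h))"
    "\<And>h. h \<in> edges n \<Longrightarrow> fst p h * A (fst h) = A (snd h) * x' h"
    by metis
  let ?p' = "(restrict x' (edges n), (\<lambda>i \<in> vertices n. snd p i * A i))"
  have "?p' \<in> framed_reps n v' w"
    using x'(1) xc(2) Ac(1) by (auto simp: framed_reps_def edge_maps_def framing_maps_def)
      (meson mult_carrier_mat)
  moreover have "embeds n v' v A ?p' p"
    using A x'(2) by (simp add: embeds_def)
  ultimately show "\<exists>p' \<in> framed_reps n v' w. embeds n v' v A p' p" by blast
next
  note xc = framed_reps_carrier[OF p] and Ac = frames_carrier[OF A] and ev = edges_vertices[OF n]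
  assume "\<exists>p' \<in> framed_reps n v' w. embeds n v' v A p' p"
  then obtain p' where p': "p' \<in> framed_reps n v' w" and e: "embeds n v' v A p' p" by blast
  show "x_stable n (fst p) (column_spaces n v' A)"
    unfolding x_stable_def
  proof (intro ballI)
    fix h s assume h: "h \<in> edges n" and "s \<in> column_spaces n v' A (fst h)"
    then obtain c where c: "c \<in> carrier_vec (v' (fst h))" "s = A (fst h) *\<^sub>v c"
      using ev(1)[OF h] by (auto simp: column_spaces_def)
    have x': "fst p' h \<in> carrier_mat (v' (snd h)) (v' (fst h))"
      by (rule framed_reps_carrier(1)[OF p' h])
    have "fst p h *\<^sub>v s = (fst p h * A (fst h)) *\<^sub>v c"
      using c xc(1)[OF h] Ac(1)[OF ev(1)[OF h]] by simp
    also have "\<dots> = A (snd h) *\<^sub>v (fst p' h *\<^sub>v c)"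
      using e h c x' Ac(1)[OF ev(2)[OF h]] by (simp add: embeds_def)
    finally show "fst p h *\<^sub>v s \<in> column_spaces n v' A (snd h)"
      using ev(2)[OF h] c(1) x' by (simp add: column_spaces_def)
  qed
qed

lemma G_V_eq_frames: "G_V n v = frames n v v"
  unfolding G_V_def frames_def by (intro PiE_cong) (auto simp: unit_mat_iff_injective)

lemma act_rep_eq_iff_embeds:
  assumes n: "n \<ge> 4" and p: "p \<in> framed_reps n v w" and p': "p' \<in> framed_reps n v w"
    and g: "g \<in> G_V n v"
  shows "act_rep n v g p' = p \<longleftrightarrow> embeds n v v g p' p"
proof -
  obtain x j x' j' where pp: "p = (x, j)" "p' = (x', j')" by fastforce
  note xc = framed_reps_carrier[OF p, unfolded pp fst_conv snd_conv]
    and xc' = framed_reps_carrier[OF p', unfolded pp fst_conv snd_conv] and ev = edges_vertices[OF n]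
  have gu: "g i \<in> Units (ring_mat TYPE(complex) (v i) ())" if "i \<in> vertices n" for i
    using g that by (auto simp: G_V_def)
  note gi = unit_mat_inverse[OF gu]
  have gc: "g i \<in> carrier_mat (v i) (v i)" if "i \<in> vertices n" for i
    using gu[OF that] by (simp add: unit_mat_iff_injective)
  have move: "M * mat_inv (v i) (g i) = N \<longleftrightarrow> N * g i = M"
    if i: "i \<in> vertices n" and M: "M \<in> carrier_mat d (v i)" "N \<in> carrier_mat d (v i)" for i M N d
  proof
    assume "M * mat_inv (v i) (g i) = N"
    then have "N * g i = M * (mat_inv (v i) (g i) * g i)"
      using M gc[OF i] gi(1)[OF i] by (metis assoc_mult_mat)
    then show "N * g i = M" using gi[OF i] M by simp
  next
    assume "N * g i = M"
    then have "M * mat_inv (v i) (g i) = N * (g i * mat_inv (v i) (g i))"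
      using M gc[OF i] gi(1)[OF i] by (metis assoc_mult_mat)
    then show "M * mat_inv (v i) (g i) = N" using gi[OF i] M by simp
  qed
  have xe: "x \<in> extensional (edges n)" "j \<in> extensional (vertices n)"
    using p by (auto simp: pp framed_reps_def edge_maps_def framing_maps_def PiE_iff)
  have "act_rep n v g p' = p \<longleftrightarrow>
      (\<forall>h \<in> edges n. g (snd h) * x' h * mat_inv (v (fst h)) (g (fst h)) = x h) \<and>
      (\<forall>i \<in> vertices n. j' i * mat_inv (v i) (g i) = j i)"
    using xe by (auto simp: pp act_rep_def fun_eq_iff restrict_def extensional_def)
  also have "\<dots> \<longleftrightarrow> (\<forall>h \<in> edges n. x h * g (fst h) = g (snd h) * x' h) \<and>
      (\<forall>i \<in> vertices n. j i * g i = j' i)"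
    using xc xc' mult_carrier_mat[OF gc xc'(1)] ev(1,2)
    by (intro arg_cong2[of _ _ _ _ "(\<and>)"] ball_cong refl move) blast+
  also have "\<dots> \<longleftrightarrow> embeds n v v g p' p"
    using g by (simp add: embeds_def pp G_V_eq_frames)
  finally show ?thesis .
qed

lemma act_rep_in_reps:
  assumes n: "n \<ge> 4" and p: "p \<in> framed_reps n v w" and g: "g \<in> G_V n v"
  shows "act_rep n v g p \<in> framed_reps n v w"
proof -
  have gu: "g i \<in> Units (ring_mat TYPE(complex) (v i) ())" if "i \<in> vertices n" for i
    using g that by (auto simp: G_V_def)
  have gc: "g i \<in> carrier_mat (v i) (v i)" if "i \<in> vertices n" for i
    using gu[OF that] by (simp add: unit_mat_iff_injective)
  note gi = unit_mat_inverse(1)[OF gu] and xc = framed_reps_carrier[OF p] and ev = edges_vertices[OF n]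
  have "g (snd h) * fst p h * mat_inv (v (fst h)) (g (fst h)) \<in> carrier_mat (v (snd h)) (v (fst h))"
    if h: "h \<in> edges n" for h
    using mult_carrier_mat[OF mult_carrier_mat[OF gc xc(1)] gi] ev(1,2) h by blast
  moreover have "snd p i * mat_inv (v i) (g i) \<in> carrier_mat (w i) (v i)" if "i \<in> vertices n" for i
    using mult_carrier_mat[OF xc(2) gi] that by blast
  ultimately show ?thesis
    by (auto simp: act_rep_def framed_reps_def edge_maps_def framing_maps_def split_beta)
qed

lemma embeds_inverse:
  assumes n: "n \<ge> 4" and p: "p \<in> framed_reps n v w" and p': "p' \<in> framed_reps n v w"
    and A: "embeds n v v A p' p"
  shows "embeds n v v (\<lambda>i \<in> vertices n. mat_inv (v i) (A i)) p p'"
proof -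
  let ?B = "\<lambda>i \<in> vertices n. mat_inv (v i) (A i)"
  have AG: "A \<in> G_V n v" using A by (simp add: embeds_def G_V_eq_frames)
  then have gu: "A i \<in> Units (ring_mat TYPE(complex) (v i) ())" if "i \<in> vertices n" for i
    using that by (auto simp: G_V_def)
  have gc: "A i \<in> carrier_mat (v i) (v i)" if "i \<in> vertices n" for i
    using gu[OF that] by (simp add: unit_mat_iff_injective)
  note gi = unit_mat_inverse[OF gu] and xc = framed_reps_carrier[OF p] framed_reps_carrier[OF p']
    and ev = edges_vertices[OF n]
  have "fst p' h * ?B (fst h) = ?B (snd h) * fst p h" if h: "h \<in> edges n" for h
  proof -
    note v = ev(1,2)[OF h]
    have "fst p' h * ?B (fst h) = ((?B (snd h) * A (snd h)) * fst p' h) * ?B (fst h)"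
      using gi[OF v(2)] xc(3)[OF h] v by simp
    also have "\<dots> = ?B (snd h) * ((A (snd h) * fst p' h) * ?B (fst h))"
      using gi(1)[OF v(1)] gi(1)[OF v(2)] gc[OF v(2)] xc(3)[OF h] v
      by (simp add: assoc_mult_mat[of _ "v (snd h)" "v (snd h)" _ "v (fst h)" _ "v (fst h)"]
        assoc_mult_mat[of _ "v (snd h)" "v (snd h)" _ "v (snd h)" _ "v (fst h)"])
    also have "\<dots> = ?B (snd h) * (fst p h * (A (fst h) * ?B (fst h)))"
      using gi(1)[OF v(1)] gc[OF v(1)] xc(1)[OF h] v A h
      by (simp add: embeds_def flip: assoc_mult_mat[of _ "v (snd h)" "v (fst h)" _ "v (fst h)" _ "v (fst h)"])
    also have "\<dots> = ?B (snd h) * fst p h"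
      using gi[OF v(1)] xc(1)[OF h] v by simp
    finally show ?thesis .
  qed
  moreover have "snd p' i * ?B i = snd p i" if i: "i \<in> vertices n" for i
  proof -
    have "snd p' i * ?B i = snd p i * (A i * ?B i)"
      using A i gi(1)[OF i] gc[OF i] xc(2)[OF i]
      by (simp add: embeds_def flip: assoc_mult_mat[of _ "w i" "v i" _ "v i" _ "v i"])
    then show ?thesis using gi[OF i] xc(2)[OF i] i by simp
  qed
  moreover have "?B \<in> frames n v v"
    using gi(4) by (auto simp: G_V_eq_frames[symmetric] G_V_def)
  ultimately show ?thesis by (simp add: embeds_def)
qed

lemma act_sub_column_spaces:
  assumes g: "g \<in> G_V n v" and A: "A \<in> frames n v' v"
  shows "act_sub n g (column_spaces n v' A) = column_spaces n v' (\<lambda>i \<in> vertices n. g i * A i)"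
proof -
  have "(\<lambda>s. g i *\<^sub>v s) ` (\<lambda>c. A i *\<^sub>v c) ` carrier_vec (v' i) =
      (\<lambda>c. (g i * A i) *\<^sub>v c) ` carrier_vec (v' i)" if i: "i \<in> vertices n" for i
  proof -
    have "g i \<in> carrier_mat (v i) (v i)"
      using g i by (auto simp: G_V_eq_frames frames_carrier)
    then show ?thesis
      using frames_carrier(1)[OF A i] unfolding image_image
      by (intro image_cong refl) simp
  qed
  then show ?thesis
    by (auto simp: act_sub_def column_spaces_def restrict_def fun_eq_iff)
qed


section \<open>Cyclic sequences of covectors\<close>

lemma transpose_mult_vec_comp:
  assumes "(A :: 'a :: field mat) \<in> carrier_mat a b" "B \<in> carrier_mat b c" "y \<in> carrier_vec a"
  shows "B\<^sup>T *\<^sub>v (A\<^sup>T *\<^sub>v y) = (A * B)\<^sup>T *\<^sub>v y"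
  using assms by (simp add: transpose_mult)

lemma transpose_mult_vec_comp4:
  assumes "(A :: 'a :: field mat) \<in> carrier_mat a b" "B \<in> carrier_mat b c" "C \<in> carrier_mat c d"
    "D \<in> carrier_mat d e" "y \<in> carrier_vec a"
  shows "(A * B * C * D)\<^sup>T *\<^sub>v y = D\<^sup>T *\<^sub>v (C\<^sup>T *\<^sub>v (B\<^sup>T *\<^sub>v (A\<^sup>T *\<^sub>v y)))"
proof -
  have AB: "A * B \<in> carrier_mat a c" and ABC: "A * B * C \<in> carrier_mat a d"
    using assms by auto
  show ?thesis
    unfolding transpose_mult_vec_comp[OF assms(1,2,5)] transpose_mult_vec_comp[OF AB assms(3,5)]
      transpose_mult_vec_comp[OF ABC assms(4,5)] ..
qed

lemma transpose_carrier_vec [intro]: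
  assumes "(A :: 'a :: field mat) \<in> carrier_mat a b"
  shows "A\<^sup>T *\<^sub>v y \<in> carrier_vec b"
  using assms by (intro carrier_vecI) simp

lemma zero_mult_vec [simp]: "y \<in> carrier_vec b \<Longrightarrow> 0\<^sub>m a b *\<^sub>v y = (0\<^sub>v a :: 'a :: field Matrix.vec)"
  by (intro eq_vecI) auto

text \<open>The dual picture of a single nilpotent Jordan block. Let \<open>N\<close> be the first index with \<open>y N = 0\<close>. The
covectors before it separate points, so \<open>d \<le> N\<close>. They are independent, so \<open>N \<le> d\<close>: applying a power
of the shift to a linear relation leaves a nonzero multiple of \<open>y (N - 1)\<close>.\<close>

lemma cyclic_covectors:
  fixes y :: "nat \<Rightarrow> 'a :: field Matrix.vec"
  assumes y: "\<And>k. y k \<in> carrier_vec d" and T: "T \<in> carrier_mat d d"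
    and shift: "\<And>k. T\<^sup>T *\<^sub>v y k = y (Suc k)" and "y K = 0\<^sub>v d"
    and sep: "\<And>s. s \<in> carrier_vec d \<Longrightarrow> (\<And>k. y k \<bullet> s = 0) \<Longrightarrow> s = 0\<^sub>v d"
  shows "y k = 0\<^sub>v d \<longleftrightarrow> d \<le> k"
proof -
  define N where "N = (LEAST k. y k = 0\<^sub>v d)"
  have yN: "y N = 0\<^sub>v d" unfolding N_def by (rule LeastI) fact
  have nz: "y k \<noteq> 0\<^sub>v d" if "k < N" for k
    using not_less_Least that unfolding N_def by blast
  have Tt: "T\<^sup>T \<in> carrier_mat d d" using T by simp
  have zero: "y k = 0\<^sub>v d" if "N \<le> k" for k
    using that
  proof (induction rule: dec_induct)
    case (step k)
    then show ?case using shift[of k] mult_mat_zero_vec[OF Tt] by simp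
  qed (fact yN)
  have "d \<le> N"
  proof (rule ccontr)
    assume "\<not> d \<le> N"
    let ?B = "mat N d (\<lambda>(k, c). y k $ c)"
    obtain s where s: "s \<in> carrier_vec d" "s \<noteq> 0\<^sub>v d" "?B *\<^sub>v s = 0\<^sub>v N"
      using wide_matrix_kernel[of ?B N d] \<open>\<not> d \<le> N\<close> by auto
    have "y k \<bullet> s = 0" for k
    proof (cases "k < N")
      case True
      have "Matrix.row ?B k = y k" using True y[of k] by auto
      then have "y k \<bullet> s = (?B *\<^sub>v s) $ k" using True by simp
      then show ?thesis using s True by simp
    qed (use zero s in auto)
    then show False using sep s by blast
  qed
  moreover have "\<not> d < N"
  proof
    assume "d < N"
    define M where "M i = mat d N (\<lambda>(c, k). y (k + i) $ c)" for i
    have Mc: "M i \<in> carrier_mat d N" for i by (simp add: M_def)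
    obtain a where a: "a \<in> carrier_vec N" "a \<noteq> 0\<^sub>v N" "M 0 *\<^sub>v a = 0\<^sub>v d"
      using wide_matrix_kernel[OF Mc \<open>d < N\<close>] by blast
    have MS: "M (Suc i) = T\<^sup>T * M i" for i
    proof (rule mat_col_eqI)
      fix k assume "k < dim_col (T\<^sup>T * M i)"
      then have k: "k < N" by (simp add: M_def)
      have c: "col (M i) k = y (k + i)" for i using k y[of "k + i"] by (auto simp: M_def)
      show "col (M (Suc i)) k = col (T\<^sup>T * M i) k"
        unfolding col_mult2[OF Tt Mc k] c by (simp add: shift)
    qed (use T Mc in \<open>auto simp: M_def\<close>)
    have M0: "M i *\<^sub>v a = 0\<^sub>v d" for i
    proof (induction i)
      case (Suc i)
      then show ?case
        using mult_mat_zero_vec[OF Tt] by (simp add: MS assoc_mult_mat_vec[OF Tt Mc a(1)])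
    qed (fact a)
    define l where "l = (LEAST k. k < N \<and> a $ k \<noteq> 0)"
    have "\<exists>k. k < N \<and> a $ k \<noteq> 0"
      using a(1,2) by (metis carrier_vecD eq_vecI index_zero_vec)
    then have "l < N \<and> a $ l \<noteq> 0" unfolding l_def by (rule LeastI_ex)
    then have l: "l < N" "a $ l \<noteq> 0" by auto
    have al: "a $ k = 0" if "k < l" for k
      using not_less_Least[of k "\<lambda>k. k < N \<and> a $ k \<noteq> 0"] that l(1) unfolding l_def by auto
    \<comment> \<open>Shifting by \<open>N - 1 - l\<close> kills all terms of the relation but the one with the first nonzero
      coefficient.\<close>
    have "y (N - 1) $ c = 0" if c: "c < d" for c
    proof -
      have "(M (N - 1 - l) *\<^sub>v a) $ c = (\<Sum>k<N. y (k + (N - 1 - l)) $ c * a $ k)"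
        using c a(1) by (auto simp: M_def scalar_prod_def atLeast0LessThan)
      also have "\<dots> = (\<Sum>k<N. if k = l then y (N - 1) $ c * a $ l else 0)"
      proof (intro sum.cong refl)
        fix k assume "k \<in> {..<N}"
        show "y (k + (N - 1 - l)) $ c * a $ k = (if k = l then y (N - 1) $ c * a $ l else 0)"
          using al[of k] l zero[of "k + (N - 1 - l)"] c
          by (cases k l rule: linorder_cases) auto
      qed
      also have "\<dots> = y (N - 1) $ c * a $ l"
        using l by simp
      finally show ?thesis using M0 c l by simp
    qed
    then have "y (N - 1) = 0\<^sub>v d"
      using y[of "N - 1"] by (intro eq_vecI) auto
    then show False using nz[of "N - 1"] l(1) by simp
  qed
  ultimately have "N = d" by simp
  then show ?thesis using nz zero by (meson leI)
qed

section \<open>The covectors of a framed representation\<close>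

text \<open>The framing is at the end vertex \<open>p\<close> of one of the short arms; the other one ends at \<open>q\<close>. Both
assignments of \<open>n - 1\<close> and \<open>n\<close> are kept open, since \<open>\<kappa>\<close> exchanges them.\<close>

locale short_arms =
  fixes n p q :: nat
  assumes n: "n \<ge> 4" and pq: "p = n \<and> q = n - 1 \<or> p = n - 1 \<and> q = n"
begin

text \<open>Linear forms are written as column vectors, so composing a form with a matrix is multiplication by
the transpose. The forms on \<open>V\<^sub>p\<close> and \<open>V\<^sub>q\<close> belong to the paths that run back and forth between \<open>p\<close>
and \<open>q\<close>; step \<open>k\<close> of this walk is at the vertex \<open>tip k\<close>. From there a path continues
to the branch vertex and \<open>d\<close> steps outwards along the long arm. At each vertex the forms are
numbered \<open>0, 1, \<dots>\<close> in the order of their path lengths.\<close>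

definition tip :: "nat \<Rightarrow> nat" where
  "tip k = (if even k then p else q)"

primrec tip_covector :: "rep \<Rightarrow> nat \<Rightarrow> complex Matrix.vec" where
  "tip_covector R 0 = Matrix.row (snd R p) 0"
| "tip_covector R (Suc k) =
     (fst R (tip (Suc k), n - 2))\<^sup>T *\<^sub>v ((fst R (n - 2, tip k))\<^sup>T *\<^sub>v tip_covector R k)"

primrec arm_covector :: "rep \<Rightarrow> nat \<Rightarrow> nat \<Rightarrow> complex Matrix.vec" where
  "arm_covector R k 0 = (fst R (n - 2, tip k))\<^sup>T *\<^sub>v tip_covector R k"
| "arm_covector R k (Suc d) = (fst R (n - 2 - Suc d, n - 2 - d))\<^sup>T *\<^sub>v arm_covector R k d"

definition covector :: "rep \<Rightarrow> nat \<Rightarrow> nat \<Rightarrow> complex Matrix.vec" where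
  "covector R i k =
     (if i = p then tip_covector R (2 * k) else if i = q then tip_covector R (2 * k + 1)
      else arm_covector R k (n - 2 - i))"

text \<open>The index of the form that arises by composing the form number \<open>k\<close> at the target of \<open>h\<close> with
\<open>x\<^sub>h\<close>; \<open>None\<close> if the composition is zero.\<close>

definition pull :: "edge \<Rightarrow> nat \<Rightarrow> nat option" where
  "pull h k =
     (if snd h = p then Some (2 * k) else if snd h = q then Some (2 * k + 1)
      else if fst h = p then (if odd k then Some ((k + 1) div 2) else None)
      else if fst h = q then (if even k then Some (k div 2) else None)
      else if fst h < snd h then Some k else Some (k + 1))"

lemma edge_cases [consumes 1, case_names to_p to_q from_p from_q out inn]:
  assumes "h \<in> edges n"
  obtains "h = (n - 2, p)" | "h = (n - 2, q)" | "h = (p, n - 2)" | "h = (q, n - 2)"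
  | i where "1 \<le> i" "i < n - 2" "h = (i, Suc i)" | i where "1 \<le> i" "i < n - 2" "h = (Suc i, i)"
proof -
  have "h \<in> Omega n \<or> prod.swap h \<in> Omega n"
    using assms by (auto simp: edges_def)
  moreover have "h = (n - 2, n - 1) \<or> h = (n - 2, n) \<or> (\<exists>i\<ge>1. i < n - 2 \<and> h = (i, Suc i))"
    if "h \<in> Omega n" for h
  proof -
    from that consider i where "1 \<le> i" "i \<le> n - 2" "h = (i, i + 1)" | "h = (n - 2, n)"
      by (auto simp: Omega_def)
    then show ?thesis
    proof cases
      case (1 i)
      show ?thesis
      proof (cases "i = n - 2")
        case True
        then have "h = (n - 2, n - 1)" using 1 n by simp
        then show ?thesis by simp
      next
        case False
        then have "1 \<le> i \<and> i < n - 2 \<and> h = (i, Suc i)" using 1 by simp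
        then show ?thesis by blast
      qed
    qed simp
  qed
  ultimately consider "h \<in> {(n - 2, n - 1), (n - 2, n)}" | "prod.swap h \<in> {(n - 2, n - 1), (n - 2, n)}"
    | i where "1 \<le> i" "i < n - 2" "h = (i, Suc i)" | i where "1 \<le> i" "i < n - 2" "prod.swap h = (i, Suc i)"
    by blast
  then show thesis
    using pq that by cases (cases h; auto)+
qed

lemma edges_intros:
  "(n - 2, p) \<in> edges n" "(n - 2, q) \<in> edges n" "(p, n - 2) \<in> edges n" "(q, n - 2) \<in> edges n"
  "1 \<le> i \<Longrightarrow> i < n - 2 \<Longrightarrow> (i, Suc i) \<in> edges n" "1 \<le> i \<Longrightarrow> i < n - 2 \<Longrightarrow> (Suc i, i) \<in> edges n"
proof -
  have "(n - 2, n - 1) \<in> Omega n" "(n - 2, n) \<in> Omega n"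
    "1 \<le> i \<Longrightarrow> i < n - 2 \<Longrightarrow> (i, Suc i) \<in> Omega n"
    using n by (auto simp: Omega_def)
  then show "(n - 2, p) \<in> edges n" "(n - 2, q) \<in> edges n" "(p, n - 2) \<in> edges n" "(q, n - 2) \<in> edges n"
    "1 \<le> i \<Longrightarrow> i < n - 2 \<Longrightarrow> (i, Suc i) \<in> edges n" "1 \<le> i \<Longrightarrow> i < n - 2 \<Longrightarrow> (Suc i, i) \<in> edges n"
    using pq by (force simp: edges_def)+
qed

lemma ends_distinct: "p \<noteq> q" "p > n - 2" "q > n - 2" "p \<le> n" "q \<le> n"
  using n pq by auto

lemma vertex_cases [consumes 1, case_names short_p short_q arm]:
  assumes "i \<in> vertices n"
  obtains "i = p" | "i = q" | "1 \<le> i" "i \<le> n - 2"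
  using assms pq that unfolding vertices_def by force

lemma pull_simps:
  "pull (n - 2, p) k = Some (2 * k)" "pull (n - 2, q) k = Some (2 * k + 1)"
  "pull (p, n - 2) k = (if odd k then Some ((k + 1) div 2) else None)"
  "pull (q, n - 2) k = (if even k then Some (k div 2) else None)"
  "i < n - 2 \<Longrightarrow> pull (i, Suc i) k = Some k" "i < n - 2 \<Longrightarrow> pull (Suc i, i) k = Some (k + 1)"
  using ends_distinct by (auto simp: pull_def)

lemma covector_simps:
  "covector R p k = tip_covector R (2 * k)" "covector R q k = tip_covector R (2 * k + 1)"
  "i \<le> n - 2 \<Longrightarrow> covector R i k = arm_covector R k (n - 2 - i)"
  using ends_distinct by (auto simp: covector_def)

end

locale framed_rep = short_arms +
  fixes v :: dimvec and R :: rep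
  assumes R: "R \<in> framed_reps n v (unitv p)" and moment: "moment_zero n v (fst R)"
begin

abbreviation "X \<equiv> fst R"

lemmas X_carrier = framed_reps_carrier(1)[OF R] and J_carrier = framed_reps_carrier(2)[OF R]

lemma moment_entry:
  assumes "i \<in> vertices n" "r < v i" "c < v i"
  shows "(\<Sum>h \<in> {h \<in> edges n. snd h = i}. eps n h * (X h * X (prod.swap h)) $$ (r, c)) = 0"
  using moment assms by (simp add: moment_zero_def)

lemma relation_tip:
  assumes t: "t = p \<or> t = q"
  shows "X (n - 2, t) * X (t, n - 2) = 0\<^sub>m (v t) (v t)"
proof -
  have e: "{h \<in> edges n. snd h = t} = {(n - 2, t)}"
    using t ends_distinct by (auto elim!: edge_cases intro: edges_intros)
  have tv: "t \<in> vertices n" using t pq n by (auto simp: vertices_def)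
  have "eps n (n - 2, t) = 1"
    using t pq n by (auto simp: eps_def Omega_def)
  then show ?thesis
    using moment_entry[OF tv] X_carrier[of "(n - 2, t)"] X_carrier[of "(t, n - 2)"] t edges_intros
    unfolding e by (intro eq_matI) auto
qed

lemma relation_first: "X (2, 1) * X (1, 2) = 0\<^sub>m (v 1) (v 1)"
proof -
  have n2: "1 < n - 2" using n by simp
  have e: "{h \<in> edges n. snd h = 1} = {(2, 1)}"
    using ends_distinct n edges_intros(6)[of 1] by (auto elim!: edge_cases simp: numeral_2_eq_2)
  have "eps n (2, 1) = - 1"
    using n by (auto simp: eps_def Omega_def)
  then show ?thesis
    using moment_entry[of 1] X_carrier[of "(2, 1)"] X_carrier[of "(1, 2)"] n2
      edges_intros(5,6)[of 1]
    unfolding e by (intro eq_matI) (auto simp: vertices_def numeral_2_eq_2)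
qed

lemma relation_arm:
  assumes i: "1 \<le> i" "Suc i < n - 2"
  shows "X (i, Suc i) * X (Suc i, i) = X (Suc (Suc i), Suc i) * X (Suc i, Suc (Suc i))"
proof -
  have e: "{h \<in> edges n. snd h = Suc i} = {(i, Suc i), (Suc (Suc i), Suc i)}"
  proof -
    have "h = (i, Suc i) \<or> h = (Suc (Suc i), Suc i)" if "h \<in> edges n" "snd h = Suc i" for h
      using that(1) by (cases rule: edge_cases) (use that(2) i ends_distinct in auto)
    moreover have "(i, Suc i) \<in> edges n" "(Suc (Suc i), Suc i) \<in> edges n"
      using edges_intros(5)[of i] edges_intros(6)[of "Suc i"] i by auto
    ultimately show ?thesis by fastforce
  qed
  have "eps n (i, Suc i) = 1" "eps n (Suc (Suc i), Suc i) = - 1"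
    using i by (auto simp: eps_def Omega_def)
  then have "(X (i, Suc i) * X (Suc i, i)) $$ (r, c) =
      (X (Suc (Suc i), Suc i) * X (Suc i, Suc (Suc i))) $$ (r, c)"
    if "r < v (Suc i)" "c < v (Suc i)" for r c
    using moment_entry[of "Suc i" r c] that i unfolding e by (simp add: vertices_def)
  then show ?thesis
    using i X_carrier[OF edges_intros(5)[of i]] X_carrier[OF edges_intros(6)[of i]]
      X_carrier[OF edges_intros(5)[of "Suc i"]] X_carrier[OF edges_intros(6)[of "Suc i"]]
    by (intro eq_matI) auto
qed

lemma relation_branch:
  "X (n - 3, n - 2) * X (n - 2, n - 3) =
    X (p, n - 2) * X (n - 2, p) + X (q, n - 2) * X (n - 2, q)"
proof -
  have n3: "n - 2 = Suc (n - 3)" "n - 3 < n - 2" "1 \<le> n - 3" using n by auto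
  have e: "{h \<in> edges n. snd h = n - 2} = {(n - 3, n - 2), (p, n - 2), (q, n - 2)}"
  proof -
    have "h = (n - 3, n - 2) \<or> h = (p, n - 2) \<or> h = (q, n - 2)" if "h \<in> edges n" "snd h = n - 2" for h
      using that(1) by (cases rule: edge_cases) (use that(2) ends_distinct in auto)
    moreover have "(n - 3, n - 2) \<in> edges n"
      using edges_intros(5)[of "n - 3"] n3 by auto
    ultimately show ?thesis using edges_intros(3,4) by fastforce
  qed
  have ep: "eps n (n - 3, n - 2) = 1" "eps n (p, n - 2) = - 1" "eps n (q, n - 2) = - 1"
    using n3 pq by (auto simp: eps_def Omega_def)
  have "(X (n - 3, n - 2) * X (n - 2, n - 3)) $$ (r, c) =
      (X (p, n - 2) * X (n - 2, p)) $$ (r, c) + (X (q, n - 2) * X (n - 2, q)) $$ (r, c)"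
    if "r < v (n - 2)" "c < v (n - 2)" for r c
  proof -
    have "(\<Sum>h\<in>{(n - 3, n - 2), (p, n - 2), (q, n - 2)}. eps n h * (X h * X (prod.swap h)) $$ (r, c)) = 0"
      using moment_entry[of "n - 2" r c] that n unfolding e by (simp add: vertices_def)
    moreover have "n - 3 \<noteq> p" "n - 3 \<noteq> q" "p \<noteq> q" using ends_distinct n by auto
    ultimately show ?thesis using ep by (simp add: algebra_simps)
  qed
  then show ?thesis
    using n3 X_carrier[OF edges_intros(5)[of "n - 3"]] X_carrier[OF edges_intros(6)[of "n - 3"]]
      X_carrier[OF edges_intros(1)] X_carrier[OF edges_intros(2)]
      X_carrier[OF edges_intros(3)] X_carrier[OF edges_intros(4)]
    by (intro eq_matI) auto
qed

lemma tip_edges: "(n - 2, tip k) \<in> edges n" "(tip k, n - 2) \<in> edges n"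
  using edges_intros by (auto simp: tip_def)

lemma tip_covector_carrier: "tip_covector R k \<in> carrier_vec (v (tip k))"
proof (cases k)
  case 0
  have "p \<in> vertices n" using n pq by (auto simp: vertices_def)
  then show ?thesis using 0 J_carrier[of p] by (auto simp: tip_def intro!: carrier_vecI)
next
  case (Suc l)
  then show ?thesis using X_carrier[OF tip_edges(2)[of k]] by auto
qed

lemma arm_covector_carrier: "d < n - 2 \<Longrightarrow> arm_covector R k d \<in> carrier_vec (v (n - 2 - d))"
proof (cases d)
  case 0
  then show ?thesis using X_carrier[OF tip_edges(1)[of k]] by auto
next
  case (Suc l)
  assume "d < n - 2"
  then have "(n - 2 - d, n - 2 - l) \<in> edges n"
    using edges_intros(5)[of "n - 2 - d"] Suc by (simp add: Suc_diff_Suc)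
  then show ?thesis using Suc X_carrier by fastforce
qed

lemma covector_carrier:
  assumes "i \<in> vertices n"
  shows "covector R i k \<in> carrier_vec (v i)"
  using assms
proof (cases rule: vertex_cases)
  case short_p
  then show ?thesis using tip_covector_carrier[of "2 * k"] short_p by (simp add: covector_simps tip_def)
next
  case short_q
  then show ?thesis using tip_covector_carrier[of "2 * k + 1"] short_q
    by (simp add: covector_simps tip_def del: tip_covector.simps)
next
  case arm
  then have "n - 2 - (n - 2 - i) = i" "n - 2 - i < n - 2" by auto
  then show ?thesis using arm_covector_carrier[of "n - 2 - i" k] arm
    by (simp add: covector_simps del: diff_Suc_Suc diff_diff_left)
qed

text \<open>Going back to the tip just left is zero by the relation there; going to the other tip is
the next step of the walk.\<close>

lemma tip_pull:
  "(X (tip k, n - 2))\<^sup>T *\<^sub>v arm_covector R k 0 = 0\<^sub>v (v (tip k))"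
  "(X (tip (Suc k), n - 2))\<^sup>T *\<^sub>v arm_covector R k 0 = tip_covector R (Suc k)"
proof -
  have XX: "X (n - 2, tip k) * X (tip k, n - 2) = 0\<^sub>m (v (tip k)) (v (tip k))"
    by (rule relation_tip) (simp add: tip_def)
  then show "(X (tip k, n - 2))\<^sup>T *\<^sub>v arm_covector R k 0 = 0\<^sub>v (v (tip k))"
    using transpose_mult_vec_comp[OF _ _ tip_covector_carrier, of "X (n - 2, tip k)" k "v (n - 2)"
        "X (tip k, n - 2)" "v (tip k)"] X_carrier[OF tip_edges(1)[of k]] X_carrier[OF tip_edges(2)[of k]]
      tip_covector_carrier[of k] XX by simp
qed simp

text \<open>A form pulled back one vertex inwards gains one in its index. At the branch vertex the relation
replaces the loop through the arm by the sum of the loops through \<open>p\<close> and \<open>q\<close>, one of which is zero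
and the other extends the walk. Further out the relation replaces the loop by the one starting
inwards, and the claim follows from the previous vertex.\<close>

lemma arm_pull_back:
  assumes "Suc d < n - 2"
  shows "(X (n - 2 - d, n - 2 - Suc d))\<^sup>T *\<^sub>v arm_covector R k (Suc d) = arm_covector R (Suc k) d"
  using assms
proof (induction d)
  case 0
  note c = X_carrier[OF edges_intros(1)] X_carrier[OF edges_intros(2)]
    X_carrier[OF edges_intros(3)] X_carrier[OF edges_intros(4)]
  let ?y = "arm_covector R k 0"
  have n3: "n - 2 = Suc (n - 3)" "1 \<le> n - 3" using n by auto
  have y: "?y \<in> carrier_vec (v (n - 2))" using arm_covector_carrier[of 0 k] n by simp
  have X3: "X (n - 3, n - 2) \<in> carrier_mat (v (n - 2)) (v (n - 3))"
    "X (n - 2, n - 3) \<in> carrier_mat (v (n - 3)) (v (n - 2))"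
    using X_carrier[OF edges_intros(5)[of "n - 3"]] X_carrier[OF edges_intros(6)[of "n - 3"]] n3 by auto
  have "(X (n - 2, n - 3))\<^sup>T *\<^sub>v ((X (n - 3, n - 2))\<^sup>T *\<^sub>v ?y) =
      (X (p, n - 2) * X (n - 2, p) + X (q, n - 2) * X (n - 2, q))\<^sup>T *\<^sub>v ?y"
    by (simp add: transpose_mult_vec_comp[OF X3 y] relation_branch del: arm_covector.simps)
  also have "\<dots> = (X (p, n - 2) * X (n - 2, p))\<^sup>T *\<^sub>v ?y + (X (q, n - 2) * X (n - 2, q))\<^sup>T *\<^sub>v ?y"
    using c y by (subst transpose_add[of _ "v (n - 2)" "v (n - 2)"])
      (auto intro!: add_mult_distrib_mat_vec simp del: arm_covector.simps transpose_mult)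
  also have "\<dots> = (X (n - 2, p))\<^sup>T *\<^sub>v ((X (p, n - 2))\<^sup>T *\<^sub>v ?y) + (X (n - 2, q))\<^sup>T *\<^sub>v ((X (q, n - 2))\<^sup>T *\<^sub>v ?y)"
    using c y by (simp add: transpose_mult_vec_comp del: arm_covector.simps)
  also have "\<dots> = arm_covector R (Suc k) 0"
  proof (cases "even k")
    case True
    then have "tip k = p" "tip (Suc k) = q" by (auto simp: tip_def)
    then show ?thesis
      using tip_pull[of k] c arm_covector_carrier[of 0 "Suc k"] n
      by (simp del: tip_covector.simps(2) add: mult_mat_zero_vec[of _ "v (n - 2)" "v p"])
  next
    case False
    then have "tip k = q" "tip (Suc k) = p" by (auto simp: tip_def)
    then show ?thesis
      using tip_pull[of k] c arm_covector_carrier[of 0 "Suc k"] n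
      by (simp del: tip_covector.simps(2) add: mult_mat_zero_vec[of _ "v (n - 2)" "v q"])
  qed
  finally show ?case using n3 by (simp add: numeral_3_eq_3)
next
  case (Suc d)
  let ?i = "n - 2 - Suc (Suc d)" and ?y = "arm_covector R k (Suc d)"
  have i: "1 \<le> ?i" "Suc ?i < n - 2" "n - 2 - Suc d = Suc ?i" "n - 2 - d = Suc (Suc ?i)"
    using Suc.prems by auto
  have y: "?y \<in> carrier_vec (v (Suc ?i))" using arm_covector_carrier[of "Suc d" k] i Suc.prems by simp
  note c = X_carrier[OF edges_intros(5)[of ?i]] X_carrier[OF edges_intros(6)[of ?i]]
      X_carrier[OF edges_intros(5)[of "Suc ?i"]] X_carrier[OF edges_intros(6)[of "Suc ?i"]]
  have "(X (Suc ?i, ?i))\<^sup>T *\<^sub>v ((X (?i, Suc ?i))\<^sup>T *\<^sub>v ?y) = (X (?i, Suc ?i) * X (Suc ?i, ?i))\<^sup>T *\<^sub>v ?y"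
    using c i y by (intro transpose_mult_vec_comp) (auto simp del: arm_covector.simps)
  also have "\<dots> = (X (Suc ?i, Suc (Suc ?i)))\<^sup>T *\<^sub>v ((X (Suc (Suc ?i), Suc ?i))\<^sup>T *\<^sub>v ?y)"
    unfolding relation_arm[OF i(1,2)]
    using c i y by (intro transpose_mult_vec_comp[symmetric]) (auto simp del: arm_covector.simps)
  also have "(X (Suc (Suc ?i), Suc ?i))\<^sup>T *\<^sub>v ?y = arm_covector R (Suc k) d"
    using Suc.IH Suc.prems i by simp
  also have "(X (Suc ?i, Suc (Suc ?i)))\<^sup>T *\<^sub>v arm_covector R (Suc k) d = arm_covector R (Suc k) (Suc d)"
    using i by simp
  finally show ?case using i by simp
qed

text \<open>The rule does not involve the representation. As soon as the forms are coordinates, it therefore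
determines all matrices.\<close>

lemma covector_pull:
  assumes h: "h \<in> edges n"
  shows "(X h)\<^sup>T *\<^sub>v covector R (snd h) k =
    (case pull h k of None \<Rightarrow> 0\<^sub>v (v (fst h)) | Some l \<Rightarrow> covector R (fst h) l)"
  using h
proof (cases rule: edge_cases)
  case to_p
  then show ?thesis by (simp add: pull_simps covector_simps tip_def)
next
  case to_q
  then show ?thesis by (simp add: pull_simps covector_simps tip_def)
next
  case from_p
  then show ?thesis
    using tip_pull[of k]
    by (auto simp: pull_simps covector_simps tip_def simp del: tip_covector.simps arm_covector.simps)
next
  case from_q
  then show ?thesis
    using tip_pull[of k]
    by (auto simp: pull_simps covector_simps tip_def simp del: tip_covector.simps arm_covector.simps)
next
  case (out i)
  then have "n - 2 - i = Suc (n - 2 - Suc i)" "n - 2 - (n - 2 - i) = i" "n - 2 - (n - 2 - Suc i) = Suc i"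
    by auto
  then show ?thesis
    using out by (simp add: pull_simps covector_simps del: diff_Suc_Suc diff_diff_left)
next
  case (inn i)
  then have "n - 2 - i = Suc (n - 2 - Suc i)" "n - 2 - (n - 2 - i) = i" "n - 2 - (n - 2 - Suc i) = Suc i"
    "n - 2 - i < n - 2"
    by auto
  then show ?thesis
    using inn arm_pull_back[of "n - 2 - Suc i" k]
    by (simp add: pull_simps covector_simps del: arm_covector.simps diff_Suc_Suc diff_diff_left)
qed


text \<open>Here the long arm ends and the loop is zero. This makes the sequences of forms at all vertices
terminate.\<close>

lemma covector_first: "covector R 1 (Suc k) = 0\<^sub>v (v 1)"
proof -
  have n2: "1 < n - 2" "(1, 2) \<in> edges n" "(2, 1) \<in> edges n"
    using n edges_intros(5,6)[of 1] by (auto simp: numeral_2_eq_2)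
  have v: "1 \<in> vertices n" using n by (simp add: vertices_def)
  have "covector R 1 (Suc k) = (X (1, 2))\<^sup>T *\<^sub>v ((X (2, 1))\<^sup>T *\<^sub>v covector R 1 k)"
    using covector_pull[OF n2(2), of "Suc k"] covector_pull[OF n2(3), of k] n2(1)
      pull_simps(5,6)[of 1] by (simp add: numeral_2_eq_2)
  also have "\<dots> = (X (2, 1) * X (1, 2))\<^sup>T *\<^sub>v covector R 1 k"
    using X_carrier[OF n2(2)] X_carrier[OF n2(3)] covector_carrier[OF v]
    by (intro transpose_mult_vec_comp) auto
  finally show ?thesis
    using covector_carrier[OF v] by (simp only: relation_first) simp
qed

lemma covector_arm_eventually_zero:
  assumes "1 \<le> i" "i \<le> n - 2" "i \<le> k"
  shows "covector R i k = 0\<^sub>v (v i)"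
  using assms
proof (induction i arbitrary: k)
  case (Suc i)
  then obtain l where k: "k = Suc l" by (cases k) auto
  show ?case
  proof (cases "i = 0")
    case True
    then show ?thesis using covector_first k by simp
  next
    case False
    then have e: "(Suc i, i) \<in> edges n" using Suc.prems edges_intros(6)[of i] by simp
    have "covector R i l = 0\<^sub>v (v i)" using Suc False k by simp
    moreover have "pull (Suc i, i) l = Some k" using Suc.prems k pull_simps(6)[of i] by simp
    ultimately show ?thesis
      using covector_pull[OF e, of l] X_carrier[OF e] mult_mat_zero_vec[of "(X (Suc i, i))\<^sup>T" "v (Suc i)" "v i"]
      by simp
  qed
qed simp

lemma covector_eventually_zero:
  assumes i: "i \<in> vertices n" and k: "n \<le> k"
  shows "covector R i k = 0\<^sub>v (v i)"
  using i
proof (cases rule: vertex_cases)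
  case short_p
  have "covector R (n - 2) (2 * k - 1) = 0\<^sub>v (v (n - 2))"
    using k n by (intro covector_arm_eventually_zero) auto
  moreover have "pull (p, n - 2) (2 * k - 1) = Some k"
    using k n by (simp add: pull_simps)
  ultimately show ?thesis
    using covector_pull[OF edges_intros(3), of "2 * k - 1"] X_carrier[OF edges_intros(3)]
      mult_mat_zero_vec[of "(X (p, n - 2))\<^sup>T" "v p" "v (n - 2)"] short_p by simp
next
  case short_q
  have "covector R (n - 2) (2 * k) = 0\<^sub>v (v (n - 2))"
    using k n by (intro covector_arm_eventually_zero) auto
  moreover have "pull (q, n - 2) (2 * k) = Some k"
    by (simp add: pull_simps)
  ultimately show ?thesis
    using covector_pull[OF edges_intros(4), of "2 * k"] X_carrier[OF edges_intros(4)]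
      mult_mat_zero_vec[of "(X (q, n - 2))\<^sup>T" "v q" "v (n - 2)"] short_q by simp
next
  case arm
  then show ?thesis using k by (intro covector_arm_eventually_zero) auto
qed

text \<open>Composing pulls along a suitable loop at \<open>i\<close> advances the index by one. For the two tips the
shortest loop that does this runs through the other tip.\<close>

lemma covector_shift:
  assumes i: "i \<in> vertices n"
  shows "\<exists>T \<in> carrier_mat (v i) (v i). \<forall>k. T\<^sup>T *\<^sub>v covector R i k = covector R i (Suc k)"
  using i
proof (cases rule: vertex_cases)
  case short_p
  note c = X_carrier[OF edges_intros(1)] X_carrier[OF edges_intros(2)]
    X_carrier[OF edges_intros(3)] X_carrier[OF edges_intros(4)]
  have m: "n - 2 \<in> vertices n" "q \<in> vertices n" using edges_vertices[OF n edges_intros(2)] by auto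
  let ?T = "X (n - 2, p) * X (q, n - 2) * X (n - 2, q) * X (p, n - 2)"
  have "?T\<^sup>T *\<^sub>v covector R i k = covector R i (Suc k)" for k
  proof -
    have "?T\<^sup>T *\<^sub>v covector R p k = (X (p, n - 2))\<^sup>T *\<^sub>v ((X (n - 2, q))\<^sup>T *\<^sub>v ((X (q, n - 2))\<^sup>T *\<^sub>v
        ((X (n - 2, p))\<^sup>T *\<^sub>v covector R p k)))"
      using c covector_carrier[OF i, of k] short_p by (intro transpose_mult_vec_comp4) auto
    then show ?thesis
      using covector_pull[OF edges_intros(1), of k] covector_pull[OF edges_intros(4), of "2 * k"]
        covector_pull[OF edges_intros(2), of k] covector_pull[OF edges_intros(3), of "2 * k + 1"]
      by (simp add: pull_simps short_p)
  qed
  moreover have "?T \<in> carrier_mat (v i) (v i)" using c short_p by auto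
  ultimately show ?thesis by blast
next
  case short_q
  note c = X_carrier[OF edges_intros(1)] X_carrier[OF edges_intros(2)]
    X_carrier[OF edges_intros(3)] X_carrier[OF edges_intros(4)]
  let ?T = "X (n - 2, q) * X (p, n - 2) * X (n - 2, p) * X (q, n - 2)"
  have "?T\<^sup>T *\<^sub>v covector R i k = covector R i (Suc k)" for k
  proof -
    have "?T\<^sup>T *\<^sub>v covector R q k = (X (q, n - 2))\<^sup>T *\<^sub>v ((X (n - 2, p))\<^sup>T *\<^sub>v ((X (p, n - 2))\<^sup>T *\<^sub>v
        ((X (n - 2, q))\<^sup>T *\<^sub>v covector R q k)))"
      using c covector_carrier[OF i, of k] short_q by (intro transpose_mult_vec_comp4) auto
    then show ?thesis
      using covector_pull[OF edges_intros(2), of k] covector_pull[OF edges_intros(3), of "2 * k + 1"]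
        covector_pull[OF edges_intros(1), of "k + 1"] covector_pull[OF edges_intros(4), of "2 * k + 2"]
      by (simp add: pull_simps short_q)
  qed
  moreover have "?T \<in> carrier_mat (v i) (v i)" using c short_q by auto
  ultimately show ?thesis by blast
next
  case arm
  \<comment> \<open>On the long arm the shift is the loop along an adjacent edge of the arm.\<close>
  have "\<exists>a. (i, a) \<in> edges n \<and> (a, i) \<in> edges n \<and>
      (\<forall>k. \<exists>l. pull (a, i) k = Some l \<and> pull (i, a) l = Some (Suc k))"
  proof (cases "i < n - 2")
    case True
    then show ?thesis using arm edges_intros(5,6)[of i] pull_simps(5,6)[of i]
      by (intro exI[of _ "Suc i"]) auto
  next
    case False
    then have "i = Suc (n - 3)" "n - 3 < n - 2" "1 \<le> n - 3" using arm n by auto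
    then show ?thesis using edges_intros(5,6)[of "n - 3"] pull_simps(5,6)[of "n - 3"]
      by (intro exI[of _ "n - 3"]) auto
  qed
  then obtain a where a: "(i, a) \<in> edges n" "(a, i) \<in> edges n"
    and pl: "\<And>k. \<exists>l. pull (a, i) k = Some l \<and> pull (i, a) l = Some (Suc k)"
    by blast
  let ?T = "X (a, i) * X (i, a)"
  note c = X_carrier[OF a(1)] X_carrier[OF a(2)]
  have "?T\<^sup>T *\<^sub>v covector R i k = covector R i (Suc k)" for k
  proof -
    obtain l where l: "pull (a, i) k = Some l" "pull (i, a) l = Some (Suc k)" using pl by blast
    have "?T\<^sup>T *\<^sub>v covector R i k = (X (i, a))\<^sup>T *\<^sub>v ((X (a, i))\<^sup>T *\<^sub>v covector R i k)"
      using c covector_carrier[OF i, of k] by (simp add: transpose_mult_vec_comp[symmetric])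
    then show ?thesis
      using covector_pull[OF a(2), of k] covector_pull[OF a(1), of l] l by simp
  qed
  moreover have "?T \<in> carrier_mat (v i) (v i)" using c by auto
  ultimately show ?thesis by blast
qed

end


section \<open>Normal form of the stable representations\<close>

context short_arms begin

text \<open>The pairs \<open>(i, k)\<close> with \<open>k \<ge> v i\<close>, which for a stable representation are the indices of the
vanishing forms, are closed under the partial maps \<^const>\<open>pull\<close>. The bound at vertex \<open>1\<close> reflects that the
loop there is zero.\<close>

definition order_ideal :: "dimvec \<Rightarrow> bool" where
  "order_ideal v \<longleftrightarrow> v 1 \<le> 1 \<and>
     (\<forall>h \<in> edges n. \<forall>k l. pull h k = Some l \<longrightarrow> v (snd h) \<le> k \<longrightarrow> v (fst h) \<le> l)"

text \<open>The normal form: the matrices of \<^const>\<open>pull\<close> in the coordinates given by the covectors, the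
framing being the form number \<open>0\<close> at \<open>p\<close>.\<close>

definition std_rep :: "dimvec \<Rightarrow> rep" where
  "std_rep v =
     ((\<lambda>h \<in> edges n. mat (v (snd h)) (v (fst h)) (\<lambda>(k, l). if pull h k = Some l then 1 else 0)),
      (\<lambda>i \<in> vertices n. mat (unitv p i) (v i) (\<lambda>(_, l). if l = 0 then 1 else 0)))"

text \<open>The coordinate change to the normal form; row \<open>k\<close> is the form number \<open>k\<close>.\<close>

definition chart :: "dimvec \<Rightarrow> rep \<Rightarrow> nat \<Rightarrow> complex mat" where
  "chart v R = (\<lambda>i \<in> vertices n. mat (v i) (v i) (\<lambda>(k, c). covector R i k $ c))"

definition canonical_sub :: "dimvec \<Rightarrow> rep \<Rightarrow> dimvec \<Rightarrow> graded_sub" where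
  "canonical_sub v R v' =
     (\<lambda>i \<in> vertices n. {s \<in> carrier_vec (v i). \<forall>k \<ge> v' i. covector R i k \<bullet> s = 0})"

lemma std_rep_reps: "std_rep v \<in> framed_reps n v (unitv p)"
  by (auto simp: std_rep_def framed_reps_def edge_maps_def framing_maps_def)

text \<open>The first \<open>v' i\<close> coordinate vectors span a subrepresentation because \<open>v'\<close> is an order ideal.\<close>

lemma std_rep_embeds:
  assumes v': "order_ideal v'" and le: "\<And>i. i \<in> vertices n \<Longrightarrow> v' i \<le> v i"
  shows "embeds n v' v (\<lambda>i \<in> vertices n. mat (v i) (v' i) (\<lambda>(r, c). if r = c then 1 else 0))
    (std_rep v') (std_rep v)"
proof -
  define E :: "nat \<Rightarrow> complex mat" where "E i = mat (v i) (v' i) (\<lambda>(r, c). if r = c then 1 else 0)" for i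
  have Ec: "E i \<in> carrier_mat (v i) (v' i)" for i by (simp add: E_def)
  have "inj_on (\<lambda>c. E i *\<^sub>v c) (carrier_vec (v' i))" if i: "i \<in> vertices n" for i
  proof (rule inj_onI)
    fix s t :: "complex Matrix.vec"
    assume st: "s \<in> carrier_vec (v' i)" "t \<in> carrier_vec (v' i)" "E i *\<^sub>v s = E i *\<^sub>v t"
    have "(E i *\<^sub>v s) $ r = s $ r" if "s \<in> carrier_vec (v' i)" "r < v' i" for s r
    proof -
      have "(E i *\<^sub>v s) $ r = (\<Sum>k<v' i. (if r = k then 1 else 0) * s $ k)"
        using that le[OF i] by (auto simp: E_def scalar_prod_def atLeast0LessThan)
      also have "\<dots> = (\<Sum>k<v' i. if r = k then s $ k else 0)"
        by (intro sum.cong) auto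
      finally show ?thesis using that by simp
    qed
    then show "s = t" using st by (metis carrier_vecD eq_vecI)
  qed
  then have "restrict E (vertices n) \<in> frames n v' v"
    using Ec by (auto simp: frames_def)
  moreover have "fst (std_rep v) h * E (fst h) = E (snd h) * fst (std_rep v') h"
    if h: "h \<in> edges n" for h
  proof (rule eq_matI)
    fix k l assume "k < dim_row (E (snd h) * fst (std_rep v') h)" "l < dim_col (E (snd h) * fst (std_rep v') h)"
    then have kl: "k < v (snd h)" "l < v' (fst h)"
      using h by (auto simp: E_def std_rep_def)
    have lv: "v' (fst h) \<le> v (fst h)" "v' (snd h) \<le> v (snd h)" using le edges_vertices[OF n h] by auto
    have "(fst (std_rep v) h * E (fst h)) $$ (k, l) =
        (\<Sum>a<v (fst h). (if pull h k = Some a then 1 else 0) * (if a = l then 1 else 0))"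
      using kl h by (auto simp: E_def std_rep_def scalar_prod_def atLeast0LessThan)
    also have "\<dots> = (\<Sum>a<v (fst h). if a = l then (if pull h k = Some l then 1 else 0) else 0)"
      by (intro sum.cong) auto
    also have "\<dots> = (if pull h k = Some l then 1 else 0)"
      using kl lv by simp
    also have "\<dots> = (if k < v' (snd h) \<and> pull h k = Some l then 1 else 0)"
      using v' kl h by (auto simp: order_ideal_def not_less[symmetric])
    also have "\<dots> = (\<Sum>a<v' (snd h). if k = a then (if pull h k = Some l then 1 else 0) else 0)"
      by simp
    also have "\<dots> = (\<Sum>a<v' (snd h). (if k = a then 1 else 0) * (if pull h a = Some l then 1 else 0))"
      by (intro sum.cong) auto
    also have "\<dots> = (E (snd h) * fst (std_rep v') h) $$ (k, l)"
      using kl h by (auto simp: E_def std_rep_def scalar_prod_def atLeast0LessThan)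
    finally show "(fst (std_rep v) h * E (fst h)) $$ (k, l) = (E (snd h) * fst (std_rep v') h) $$ (k, l)" .
  qed (use h in \<open>auto simp: E_def std_rep_def\<close>)
  moreover have "snd (std_rep v) i * E i = snd (std_rep v') i" if i: "i \<in> vertices n" for i
  proof (rule eq_matI)
    fix k l assume "k < dim_row (snd (std_rep v') i)" "l < dim_col (snd (std_rep v') i)"
    then have kl: "k < unitv p i" "l < v' i" using i by (auto simp: std_rep_def)
    have "(snd (std_rep v) i * E i) $$ (k, l) = (\<Sum>a<v i. (if a = 0 then 1 else 0) * (if a = l then 1 else 0))"
      using kl i by (auto simp: E_def std_rep_def scalar_prod_def atLeast0LessThan)
    also have "\<dots> = (\<Sum>a<v i. if a = l then (if l = 0 then 1 else 0) else 0)"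
      by (intro sum.cong) auto
    also have "\<dots> = (if l = 0 then 1 else 0)"
      using kl le[OF i] by simp
    finally show "(snd (std_rep v) i * E i) $$ (k, l) = snd (std_rep v') i $$ (k, l)"
      using kl i by (simp add: std_rep_def)
  qed (use i in \<open>auto simp: E_def std_rep_def\<close>)
  ultimately show ?thesis
    using edges_vertices(1,2)[OF n] unfolding embeds_def E_def[symmetric]
    by (simp add: restrict_def)
qed

text \<open>The forms are built from the framing and the arrows, hence are natural for embeddings.\<close>

lemma covector_embeds:
  assumes R: "R \<in> framed_reps n v (unitv p)" "moment_zero n v (fst R)"
    and R': "R' \<in> framed_reps n v' (unitv p)" "moment_zero n v' (fst R')"
    and A: "embeds n v' v A R' R" and i: "i \<in> vertices n"
  shows "covector R' i k = (A i)\<^sup>T *\<^sub>v covector R i k"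
proof -
  interpret F: framed_rep n p q v R by unfold_locales (use R in auto)
  interpret F': framed_rep n p q v' R' by unfold_locales (use R' in auto)
  have Ac: "A i \<in> carrier_mat (v i) (v' i)" if "i \<in> vertices n" for i
    using A that by (auto simp: embeds_def frames_carrier)
  have move: "(fst R' h)\<^sup>T *\<^sub>v ((A (snd h))\<^sup>T *\<^sub>v y) = (A (fst h))\<^sup>T *\<^sub>v ((fst R h)\<^sup>T *\<^sub>v y)"
    if h: "h \<in> edges n" and y: "y \<in> carrier_vec (v (snd h))" for h y
    using A h transpose_mult_vec_comp[OF Ac F'.X_carrier[OF h] y]
      transpose_mult_vec_comp[OF F.X_carrier[OF h] Ac y] edges_vertices[OF n h]
    by (simp add: embeds_def)
  have tip: "tip_covector R' k = (A (tip k))\<^sup>T *\<^sub>v tip_covector R k" for k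
  proof (induction k)
    case 0
    have p: "p \<in> vertices n" using n pq by (auto simp: vertices_def)
    then have "snd R' p = snd R p * A p" using A by (simp add: embeds_def)
    moreover have "1 = unitv p p" by (simp add: unitv_def)
    then have "Matrix.row (snd R p * A p) 0 = (A p)\<^sup>T *\<^sub>v Matrix.row (snd R p) 0"
      using F.J_carrier[OF p] Ac[OF p] by (intro eq_vecI) (auto intro!: comm_scalar_prod[of _ "v p"] carrier_vecI)
    ultimately show ?case by (simp add: tip_def)
  next
    case (Suc k)
    have "tip_covector R' (Suc k) = (fst R' (tip (Suc k), n - 2))\<^sup>T *\<^sub>v
       ((fst R' (n - 2, tip k))\<^sup>T *\<^sub>v ((A (tip k))\<^sup>T *\<^sub>v tip_covector R k))"
      using Suc by simp
    also have "\<dots> = (A (tip (Suc k)))\<^sup>T *\<^sub>v tip_covector R (Suc k)"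
      using move[OF F.tip_edges(1)[of k]] F.tip_covector_carrier[of k]
        move[OF F.tip_edges(2)[of "Suc k"]] F.arm_covector_carrier[of 0 k] n
      by simp
    finally show ?case .
  qed
  have arm_eq: "arm_covector R' k d = (A (n - 2 - d))\<^sup>T *\<^sub>v arm_covector R k d" if "d < n - 2" for k d
    using that
  proof (induction d)
    case 0
    then show ?case
      using move[OF F.tip_edges(1)[of k]] F.tip_covector_carrier[of k] tip[of k] by simp
  next
    case (Suc d)
    have e: "(n - 2 - Suc d, n - 2 - d) \<in> edges n"
      using edges_intros(5)[of "n - 2 - Suc d"] Suc.prems by (simp add: Suc_diff_Suc)
    show ?case
      using move[OF e] F.arm_covector_carrier[of d k] Suc by simp
  qed
  show ?thesis
    using i
  proof (cases rule: vertex_cases)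
    case short_p
    then show ?thesis using tip[of "2 * k"] by (simp add: covector_simps tip_def)
  next
    case short_q
    then show ?thesis using tip[of "2 * k + 1"]
      by (simp add: covector_simps tip_def del: tip_covector.simps)
  next
    case arm
    then have "n - 2 - (n - 2 - i) = i" "n - 2 - i < n - 2" by auto
    then show ?thesis using arm_eq[of "n - 2 - i" k] arm
      by (simp add: covector_simps del: diff_Suc_Suc diff_diff_left)
  qed
qed

end

locale stable_rep = short_arms +
  fixes v :: dimvec and R :: rep
  assumes stable: "R \<in> Lambda_st n v (unitv p)"
begin

sublocale framed_rep
  using stable by unfold_locales (auto simp: Lambda_st_def Lambda_V_def framed_reps_def)

text \<open>The common kernel of the covectors is a subrepresentation killed by the framing.\<close>

lemma covector_separates:
  assumes i: "i \<in> vertices n" and s: "s \<in> carrier_vec (v i)" "\<And>k. covector R i k \<bullet> s = 0"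
  shows "s = 0\<^sub>v (v i)"
proof -
  define S where "S = (\<lambda>i \<in> vertices n. {s \<in> carrier_vec (v i). \<forall>k. covector R i k \<bullet> s = 0})"
  have "covector R i k \<bullet> (s + t) = covector R i k \<bullet> s + covector R i k \<bullet> t"
    "covector R i k \<bullet> (c \<cdot>\<^sub>v s) = c * (covector R i k \<bullet> s)"
    if "i \<in> vertices n" "s \<in> carrier_vec (v i)" "t \<in> carrier_vec (v i)" for i k s t c
    using that covector_carrier[OF that(1)] by (auto intro!: scalar_prod_add_distrib)
  then have "S \<in> graded_subspaces n v"
    using covector_carrier
    by (auto simp: S_def graded_subspaces_def PiE_iff subspace_module_vec_iff)
  moreover have "x_stable n (fst R) S"
    unfolding x_stable_def
  proof (intro ballI)
    fix h s assume h: "h \<in> edges n" and "s \<in> S (fst h)"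
    note hv = edges_vertices[OF n h]
    have s: "s \<in> carrier_vec (v (fst h))" "\<And>k. covector R (fst h) k \<bullet> s = 0"
      using \<open>s \<in> S (fst h)\<close> hv by (auto simp: S_def)
    have "covector R (snd h) k \<bullet> (fst R h *\<^sub>v s) = 0" for k
    proof -
      have "covector R (snd h) k \<bullet> (fst R h *\<^sub>v s) = ((fst R h)\<^sup>T *\<^sub>v covector R (snd h) k) \<bullet> s"
        using X_carrier[OF h] s(1) covector_carrier[OF hv(2)] by (simp add: transpose_vec_mult_scalar)
      also have "\<dots> = 0"
        using s covector_pull[OF h, of k] by (auto split: option.splits)
      finally show ?thesis .
    qed
    then show "fst R h *\<^sub>v s \<in> S (snd h)"
      using X_carrier[OF h] s(1) hv by (auto simp: S_def)
  qed
  moreover have "\<forall>i \<in> vertices n. \<forall>s \<in> S i. snd R i *\<^sub>v s = 0\<^sub>v (unitv p i)"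
  proof (intro ballI eq_vecI)
    fix i s k assume i: "i \<in> vertices n" and s: "s \<in> S i" and "k < dim_vec (0\<^sub>v (unitv p i) :: complex Matrix.vec)"
    then have "i = p" "k = 0" by (auto simp: unitv_def split: if_splits)
    moreover have "covector R p 0 \<bullet> s = 0" using i s \<open>i = p\<close> by (auto simp: S_def)
    ultimately show "(snd R i *\<^sub>v s) $ k = 0\<^sub>v (unitv p i) $ k"
      using J_carrier[OF i] by (simp add: covector_simps unitv_def)
  qed (use J_carrier in auto)
  ultimately have "S i = {0\<^sub>v (v i)}"
    using stable i by (auto simp: Lambda_st_def split_beta)
  then show ?thesis using i s by (auto simp: S_def)
qed

lemma covector_zero_iff:
  assumes i: "i \<in> vertices n"
  shows "covector R i k = 0\<^sub>v (v i) \<longleftrightarrow> v i \<le> k"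
proof -
  obtain T where "T \<in> carrier_mat (v i) (v i)" "\<And>k. T\<^sup>T *\<^sub>v covector R i k = covector R i (Suc k)"
    using covector_shift[OF i] by blast
  then show ?thesis
    using covector_eventually_zero[OF i order_refl] covector_separates[OF i] covector_carrier[OF i]
    by (intro cyclic_covectors[where T = T and K = n]) auto
qed

text \<open>By the preceding lemma the dimension is the first index of a vanishing form, and forms that vanish
pull back to forms that vanish.\<close>

lemma order_ideal_dim: "order_ideal v"
  unfolding order_ideal_def
proof (intro conjI ballI allI impI)
  have "1 \<in> vertices n" using n by (simp add: vertices_def)
  then show "v 1 \<le> 1" using covector_zero_iff[of 1 1] covector_first[of 0] by simp
next
  fix h k l assume h: "h \<in> edges n" and l: "pull h k = Some l" and k: "v (snd h) \<le> k"
  note hv = edges_vertices[OF n h]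
  have "covector R (fst h) l = (X h)\<^sup>T *\<^sub>v covector R (snd h) k"
    using covector_pull[OF h, of k] l by simp
  also have "\<dots> = 0\<^sub>v (v (fst h))"
  proof -
    have "covector R (snd h) k = 0\<^sub>v (v (snd h))" using covector_zero_iff[OF hv(2)] k by simp
    then show ?thesis
      using X_carrier[OF h] mult_mat_zero_vec[of "(X h)\<^sup>T" "v (fst h)" "v (snd h)"] by simp
  qed
  finally show "v (fst h) \<le> l" using covector_zero_iff[OF hv(1)] by simp
qed

lemma chart_carrier: "i \<in> vertices n \<Longrightarrow> chart v R i \<in> carrier_mat (v i) (v i)"
  by (simp add: chart_def)

lemma chart_mult:
  assumes "i \<in> vertices n" "s \<in> carrier_vec (v i)" "k < v i"
  shows "(chart v R i *\<^sub>v s) $ k = covector R i k \<bullet> s"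
proof -
  have "Matrix.row (chart v R i) k = covector R i k"
    using assms covector_carrier[of i k] by (intro eq_vecI) (auto simp: chart_def)
  then show ?thesis using assms chart_carrier[of i] by simp
qed

lemma chart_frames: "chart v R \<in> frames n v v"
proof -
  have "s = 0\<^sub>v (v i)" if i: "i \<in> vertices n" and s: "s \<in> carrier_vec (v i)"
    and "chart v R i *\<^sub>v s = 0\<^sub>v (v i)" for i s
  proof (rule covector_separates[OF i s])
    show "covector R i k \<bullet> s = 0" for k
      using that chart_mult[OF i s, of k] covector_zero_iff[OF i, of k] s by (cases "k < v i") auto
  qed
  then show ?thesis
    using chart_carrier injective_iff_kernel[OF chart_carrier]
    by (auto simp: frames_def PiE_iff) (simp add: chart_def)
qed

text \<open>This only restates the pull rule row by row, together with the vanishing of the forms from \<open>v i\<close> on.\<close>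

lemma chart_embeds: "embeds n v v (chart v R) R (std_rep v)"
proof -
  have "fst (std_rep v) h * chart v R (fst h) = chart v R (snd h) * X h" if h: "h \<in> edges n" for h
  proof (rule eq_matI)
    note hv = edges_vertices[OF n h]
    fix k c assume "k < dim_row (chart v R (snd h) * X h)" "c < dim_col (chart v R (snd h) * X h)"
    then have kc: "k < v (snd h)" "c < v (fst h)" using chart_carrier[OF hv(2)] X_carrier[OF h] by auto
    have "(fst (std_rep v) h * chart v R (fst h)) $$ (k, c) =
        (\<Sum>l<v (fst h). if pull h k = Some l then covector R (fst h) l $ c else 0)"
      using kc h hv by (auto simp: std_rep_def chart_def scalar_prod_def atLeast0LessThan intro!: sum.cong)
    also have "\<dots> = ((X h)\<^sup>T *\<^sub>v covector R (snd h) k) $ c"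
    proof (cases "pull h k")
      case None
      then show ?thesis using covector_pull[OF h, of k] kc by simp
    next
      case (Some l)
      have "(\<Sum>l'<v (fst h). if pull h k = Some l' then covector R (fst h) l' $ c else 0) =
          (\<Sum>l'<v (fst h). if l' = l then covector R (fst h) l $ c else 0)"
        using Some by (intro sum.cong) auto
      also have "\<dots> = covector R (fst h) l $ c"
        using kc covector_zero_iff[OF hv(1), of l] by auto
      finally show ?thesis using covector_pull[OF h, of k] Some by simp
    qed
    also have "\<dots> = (chart v R (snd h) * X h) $$ (k, c)"
    proof -
      have "Matrix.row (chart v R (snd h)) k = covector R (snd h) k"
        using kc covector_carrier[OF hv(2), of k] hv by (intro eq_vecI) (auto simp: chart_def)
      then show ?thesis
        using kc X_carrier[OF h] chart_carrier[OF hv(2)] covector_carrier[OF hv(2), of k]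
        by (auto intro!: comm_scalar_prod[of _ "v (snd h)"])
    qed
    finally show "(fst (std_rep v) h * chart v R (fst h)) $$ (k, c) = (chart v R (snd h) * X h) $$ (k, c)" .
  qed (use h X_carrier[OF h] edges_vertices[OF n h] in \<open>auto simp: std_rep_def chart_def\<close>)
  moreover have "snd (std_rep v) i * chart v R i = snd R i" if i: "i \<in> vertices n" for i
  proof (rule eq_matI)
    fix k c assume "k < dim_row (snd R i)" "c < dim_col (snd R i)"
    then have kc: "i = p" "k = 0" "c < v i"
      using J_carrier[OF i] by (auto simp: unitv_def split: if_splits)
    have "(snd (std_rep v) i * chart v R i) $$ (k, c) = (\<Sum>l<v i. (if l = 0 then 1 else 0) * covector R i l $ c)"
      using kc i by (auto simp: std_rep_def chart_def scalar_prod_def atLeast0LessThan unitv_def)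
    also have "\<dots> = (\<Sum>l<v i. if l = 0 then covector R i 0 $ c else 0)"
      by (intro sum.cong) auto
    also have "\<dots> = covector R i 0 $ c"
      using kc by simp
    also have "\<dots> = snd R i $$ (k, c)"
      using kc J_carrier[OF i] by (simp add: covector_simps unitv_def)
    finally show "(snd (std_rep v) i * chart v R i) $$ (k, c) = snd R i $$ (k, c)" .
  qed (use i J_carrier[OF i] in \<open>auto simp: std_rep_def chart_def\<close>)
  ultimately show ?thesis
    using chart_frames by (simp add: embeds_def)
qed

lemma std_rep_embeds_into: "\<exists>A. embeds n v v A (std_rep v) R"
  using embeds_inverse[OF n std_rep_reps R chart_embeds] by blast

lemma std_rep_stable: "std_rep v \<in> Lambda_st n v (unitv p)"
  using std_rep_embeds_into embeds_stable[OF n stable std_rep_reps] by blast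


end

section \<open>Orbits and subrepresentations\<close>

context short_arms begin

lemma stable_repI: "R \<in> Lambda_st n v (unitv p) \<Longrightarrow> stable_rep n p q v R"
  by unfold_locales

text \<open>All stable representations of dimension \<open>v\<close> are isomorphic to the standard one.\<close>

lemma rep_orbit_eq:
  assumes R: "R \<in> Lambda_st n v (unitv p)"
  shows "rep_orbit n v R = Lambda_st n v (unitv p)"
proof -
  interpret S: stable_rep n p q v R by (rule stable_repI[OF R])
  show ?thesis
  proof (intro equalityI subsetI)
    fix R' assume "R' \<in> rep_orbit n v R"
    then obtain g where g: "g \<in> G_V n v" "R' = act_rep n v g R" by (auto simp: rep_orbit_def)
    then have R': "R' \<in> framed_reps n v (unitv p)" using act_rep_in_reps[OF n S.R] by simp
    then have "embeds n v v g R R'" using act_rep_eq_iff_embeds[OF n R' S.R g(1)] g(2) by simp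
    then have "embeds n v v (\<lambda>i \<in> vertices n. mat_inv (v i) (g i)) R' R"
      by (rule embeds_inverse[OF n R' S.R])
    then show "R' \<in> Lambda_st n v (unitv p)" by (rule embeds_stable[OF n R R'])
  next
    fix R' assume R': "R' \<in> Lambda_st n v (unitv p)"
    interpret S': stable_rep n p q v R' by (rule stable_repI[OF R'])
    obtain A where "embeds n v v A (std_rep v) R'" using S'.std_rep_embeds_into by blast
    then obtain g where g: "embeds n v v g R R'"
      using embeds_comp[OF n S'.R std_rep_reps S.R _ S.chart_embeds] by blast
    then have "g \<in> G_V n v" by (simp add: embeds_def G_V_eq_frames)
    then show "R' \<in> rep_orbit n v R"
      using act_rep_eq_iff_embeds[OF n S'.R S.R] g by (force simp: rep_orbit_def)
  qed
qed

lemma points_quiver_variety: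
  "points (quiver_variety n v (unitv p)) =
    (if Lambda_st n v (unitv p) = {} then {} else {Lambda_st n v (unitv p)})"
  using rep_orbit_eq[of _ v] by (auto simp: points_def quiver_variety_def)

text \<open>The order ideals contained in \<open>v\<close> are realised by coordinate subspaces of the standard
  representation.\<close>

lemma stable_of_order_ideal:
  assumes R: "R \<in> Lambda_st n v (unitv p)" and v': "order_ideal v'"
    and le: "\<And>i. i \<in> vertices n \<Longrightarrow> v' i \<le> v i"
  shows "Lambda_st n v' (unitv p) \<noteq> {}"
proof -
  interpret S: stable_rep n p q v R by (rule stable_repI[OF R])
  show ?thesis
    using embeds_stable[OF n S.std_rep_stable std_rep_reps std_rep_embeds[OF v' le]] by blast
qed

lemma stable_embeds:
  assumes R: "R \<in> Lambda_st n v (unitv p)" and R': "R' \<in> Lambda_st n v' (unitv p)"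
    and le: "\<And>i. i \<in> vertices n \<Longrightarrow> v' i \<le> v i"
  shows "\<exists>A. embeds n v' v A R' R"
proof -
  interpret S: stable_rep n p q v R by (rule stable_repI[OF R])
  interpret S': stable_rep n p q v' R' by (rule stable_repI[OF R'])
  obtain B where B: "embeds n v v B (std_rep v) R" using S.std_rep_embeds_into by blast
  obtain A where "embeds n v' v A R' (std_rep v)"
    using embeds_comp[OF n std_rep_reps std_rep_reps S'.R std_rep_embeds[OF S'.order_ideal_dim le]
        S'.chart_embeds] by blast
  then show ?thesis
    using embeds_comp[OF n S.R std_rep_reps S'.R B] by blast
qed

text \<open>On the subspace the forms restrict to those of \<open>R'\<close>, so the forms from \<open>v' i\<close> on vanish there. Conversely a
vector killed by those is determined by its first \<open>v' i\<close> forms, and any values of these are attained on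
the subspace, since the chart of \<open>R'\<close> is invertible.\<close>

lemma column_spaces_eq_canonical_sub:
  assumes R: "R \<in> Lambda_st n v (unitv p)" and R': "R' \<in> Lambda_st n v' (unitv p)"
    and A: "embeds n v' v A R' R"
  shows "column_spaces n v' A = canonical_sub v R v'"
proof -
  interpret S: stable_rep n p q v R by (rule stable_repI[OF R])
  interpret S': stable_rep n p q v' R' by (rule stable_repI[OF R'])
  have Ac: "A i \<in> carrier_mat (v i) (v' i)" if "i \<in> vertices n" for i
    using A that by (auto simp: embeds_def frames_carrier)
  have pair: "covector R i k \<bullet> (A i *\<^sub>v c) = covector R' i k \<bullet> c"
    if i: "i \<in> vertices n" and c: "c \<in> carrier_vec (v' i)" for i k c
    using transpose_vec_mult_scalar[OF Ac[OF i] c S.covector_carrier[OF i], of k]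
      covector_embeds[OF S.R S.moment S'.R S'.moment A i, of k] by simp
  have zero: "covector R' i k \<bullet> c = 0" if i: "i \<in> vertices n" and "c \<in> carrier_vec (v' i)" "v' i \<le> k" for i k c
    using S'.covector_zero_iff[OF i, of k] that by simp
  have "(\<lambda>c. A i *\<^sub>v c) ` carrier_vec (v' i) =
      {s \<in> carrier_vec (v i). \<forall>k \<ge> v' i. covector R i k \<bullet> s = 0}" if i: "i \<in> vertices n" for i
  proof (intro equalityI subsetI)
    fix s assume "s \<in> (\<lambda>c. A i *\<^sub>v c) ` carrier_vec (v' i)"
    then obtain c where c: "c \<in> carrier_vec (v' i)" "s = A i *\<^sub>v c" by blast
    then show "s \<in> {s \<in> carrier_vec (v i). \<forall>k \<ge> v' i. covector R i k \<bullet> s = 0}"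
      using pair[OF i c(1)] zero[OF i c(1)] mult_mat_vec_carrier[OF Ac[OF i] c(1)] by simp
  next
    fix s assume s: "s \<in> {s \<in> carrier_vec (v i). \<forall>k \<ge> v' i. covector R i k \<bullet> s = 0}"
    have unit: "chart v' R' i \<in> Units (ring_mat TYPE(complex) (v' i) ())"
      using frames_carrier[OF S'.chart_frames i] by (simp add: unit_mat_iff_injective)
    note inv = unit_mat_inverse[OF unit]
    define t where "t = Matrix.vec (v' i) (\<lambda>k. covector R i k \<bullet> s)"
    have t: "t \<in> carrier_vec (v' i)" by (simp add: t_def)
    define c where "c = mat_inv (v' i) (chart v' R' i) *\<^sub>v t"
    have c: "c \<in> carrier_vec (v' i)" using inv(1) t unfolding c_def by (rule mult_mat_vec_carrier)
    have "chart v' R' i *\<^sub>v c = t"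
      unfolding c_def
      using assoc_mult_mat_vec[OF S'.chart_carrier[OF i] inv(1) t] inv(2) t by simp
    then have ck: "covector R' i k \<bullet> c = covector R i k \<bullet> s" if "k < v' i" for k
      using S'.chart_mult[OF i c that] that by (simp add: t_def)
    have Acc: "A i *\<^sub>v c \<in> carrier_vec (v i)" by (rule mult_mat_vec_carrier[OF Ac[OF i] c])
    have "covector R i k \<bullet> (A i *\<^sub>v c) = covector R i k \<bullet> s" for k
      using ck[of k] pair[OF i c, of k] zero[OF i c, of k] s by (cases "k < v' i") auto
    then have "chart v R i *\<^sub>v (A i *\<^sub>v c) = chart v R i *\<^sub>v s"
      using S.chart_mult[OF i Acc] S.chart_mult[OF i] s S.chart_carrier[OF i]
      by (intro eq_vecI) auto
    then have "A i *\<^sub>v c = s"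
      using inj_onD[OF frames_carrier(2)[OF S.chart_frames i]] Acc s by auto
    then show "s \<in> (\<lambda>c. A i *\<^sub>v c) ` carrier_vec (v' i)" using c by blast
  qed
  then show ?thesis
    by (auto simp: column_spaces_def canonical_sub_def restrict_def fun_eq_iff)
qed

section \<open>The correspondences are points\<close>

definition nonempty :: "dimvec \<Rightarrow> bool" where
  "nonempty v \<longleftrightarrow> Lambda_st n v (unitv p) \<noteq> {}"

text \<open>The single orbit of triples. A subspace is determined by the representation and its dimension, so
the orbit is a graph over the orbit of representations.\<close>

definition flag_point :: "dimvec \<Rightarrow> dimvec \<Rightarrow> (rep \<times> graded_sub) set" where
  "flag_point v u = {(R, canonical_sub v R (v - u)) | R. R \<in> Lambda_st n v (unitv p)}"

lemma triple_orbit_eq: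
  assumes R: "R \<in> Lambda_st n v (unitv p)" and A: "A \<in> frames n v' v"
    and stab: "x_stable n (fst R) (column_spaces n v' A)"
  shows "triple_orbit n v (R, column_spaces n v' A) =
      {(R, canonical_sub v R v') | R. R \<in> Lambda_st n v (unitv p)}"
    and "\<exists>R'. R' \<in> Lambda_st n v' (unitv p) \<and> embeds n v' v A R' R"
proof -
  have Rr: "R \<in> framed_reps n v (unitv p)" using R Lambda_st_reps by blast
  obtain R' where R'r: "R' \<in> framed_reps n v' (unitv p)" and e: "embeds n v' v A R' R"
    using column_spaces_stable_iff[OF n Rr A] stab by blast
  have R': "R' \<in> Lambda_st n v' (unitv p)"
    by (rule embeds_stable[OF n R R'r e])
  then show "\<exists>R'. R' \<in> Lambda_st n v' (unitv p) \<and> embeds n v' v A R' R" using e by blast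
  have "act_sub n g (column_spaces n v' A) = canonical_sub v (act_rep n v g R) v'"
    if g: "g \<in> G_V n v" for g
  proof -
    have gR: "act_rep n v g R \<in> Lambda_st n v (unitv p)"
      using rep_orbit_eq[OF R] g by (auto simp: rep_orbit_def)
    then have gRr: "act_rep n v g R \<in> framed_reps n v (unitv p)" using Lambda_st_reps by blast
    have ge: "embeds n v v g R (act_rep n v g R)"
      using act_rep_eq_iff_embeds[OF n gRr Rr g] by simp
    show ?thesis
      unfolding act_sub_column_spaces[OF g A]
      by (rule column_spaces_eq_canonical_sub[OF gR R' embeds_comp[OF n gRr Rr R'r ge e]])
  qed
  then have "triple_orbit n v (R, column_spaces n v' A) =
      (\<lambda>R. (R, canonical_sub v R v')) ` rep_orbit n v R"
    by (auto simp: triple_orbit_def rep_orbit_def image_image)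
  then show "triple_orbit n v (R, column_spaces n v' A) =
      {(R, canonical_sub v R v') | R. R \<in> Lambda_st n v (unitv p)}"
    using rep_orbit_eq[OF R] by auto
qed

text \<open>A point forces both ends of the correspondence to be nonempty; conversely any point of the
smaller variety embeds into any point of the larger one.\<close>

lemma points_flag_variety:
  "points (flag_variety n v (unitv p) u) =
    (if u \<le> v \<and> nonempty v \<and> nonempty (v - u) then {flag_point v u} else {})"
proof (intro equalityI subsetI)
  fix Q assume "Q \<in> points (flag_variety n v (unitv p) u)"
  then obtain R A where A: "A \<in> frames n (v - u) v"
    and t: "(R, column_spaces n (v - u) A) \<in> triples n v (unitv p) u"
    and Q: "Q = triple_orbit n v (R, column_spaces n (v - u) A)"
    by (auto simp: points_def flag_variety_def)
  have u: "u \<le> v" and R: "R \<in> Lambda_st n v (unitv p)"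
    and st: "x_stable n (fst R) (column_spaces n (v - u) A)"
    using t by (auto simp: triples_def)
  show "Q \<in> (if u \<le> v \<and> nonempty v \<and> nonempty (v - u) then {flag_point v u} else {})"
    using triple_orbit_eq[OF R A st] R u unfolding Q nonempty_def flag_point_def by auto
next
  fix Q assume "Q \<in> (if u \<le> v \<and> nonempty v \<and> nonempty (v - u) then {flag_point v u} else {})"
  then have u: "u \<le> v" and Q: "Q = flag_point v u" and "nonempty v" "nonempty (v - u)"
    by (auto split: if_splits)
  then obtain R R' where R: "R \<in> Lambda_st n v (unitv p)" and R': "R' \<in> Lambda_st n (v - u) (unitv p)"
    by (auto simp: nonempty_def)
  then obtain A where A: "embeds n (v - u) v A R' R"
    using stable_embeds[OF R R'] by auto
  then have Af: "A \<in> frames n (v - u) v" by (simp add: embeds_def)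
  have Rr: "R \<in> framed_reps n v (unitv p)" "R' \<in> framed_reps n (v - u) (unitv p)"
    using R R' Lambda_st_reps by blast+
  have st: "x_stable n (fst R) (column_spaces n (v - u) A)"
    using column_spaces_stable_iff[OF n Rr(1) Af] A Rr(2) by blast
  have "(R, column_spaces n (v - u) A) \<in> triples n v (unitv p) u"
    using u R st column_spaces_graded_subspace[OF Af] by (cases R) (simp add: triples_def)
  then have "triple_orbit n v (R, column_spaces n (v - u) A) \<in> points (flag_variety n v (unitv p) u)"
    using Af by (force simp: points_def flag_variety_def)
  then show "Q \<in> points (flag_variety n v (unitv p) u)"
    using triple_orbit_eq(1)[OF R Af st] by (simp add: Q flag_point_def)
qed

lemma pi2_flag_point: "pi2 (flag_point v u) = Lambda_st n v (unitv p)"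
  by (force simp: pi2_def flag_point_def)

lemma pi1_flag_point:
  assumes u: "u \<le> v" and "nonempty v"
  shows "pi1 n v (unitv p) u (flag_point v u) = Lambda_st n (v - u) (unitv p)"
proof (intro equalityI subsetI)
  fix R' assume "R' \<in> pi1 n v (unitv p) u (flag_point v u)"
  then obtain R A where R: "R \<in> Lambda_st n v (unitv p)" and R': "R' \<in> framed_reps n (v - u) (unitv p)"
    and "embeds n (v - u) v A R' R"
    by (auto simp: pi1_def flag_point_def embeds_def framed_reps_def)
  then show "R' \<in> Lambda_st n (v - u) (unitv p)" by (blast intro: embeds_stable[OF n])
next
  fix R' assume R': "R' \<in> Lambda_st n (v - u) (unitv p)"
  obtain R where R: "R \<in> Lambda_st n v (unitv p)" using \<open>nonempty v\<close> by (auto simp: nonempty_def)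
  obtain A where A: "embeds n (v - u) v A R' R" using stable_embeds[OF R R'] by auto
  have R'r: "R' \<in> framed_reps n (v - u) (unitv p)" using R' Lambda_st_reps by blast
  have "(R, column_spaces n (v - u) A) \<in> flag_point v u"
    using column_spaces_eq_canonical_sub[OF R R' A] R by (cases R) (auto simp: flag_point_def)
  then show "R' \<in> pi1 n v (unitv p) u (flag_point v u)"
    using A R'r unfolding pi1_def embeds_def framed_reps_def
    by (cases R; cases R') force
qed

end


section \<open>Pushforward from a point\<close>

lemma topspace_analytic_topology: "topspace (analytic_topology A) = points A"
proof
  show "topspace (analytic_topology A) \<subseteq> points A"
    by (auto simp: topspace_def openin_analytic_topology)
  have "topspace (dom_topology A) = qdom A"
    by (auto simp: dom_topology_def)
  then have "openin (dom_topology A) (qdom A)"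
    by (metis openin_topspace)
  moreover have "{x \<in> qdom A. qmap A x \<in> points A} = qdom A"
    by (auto simp: points_def)
  ultimately show "points A \<subseteq> topspace (analytic_topology A)"
    by (intro openin_subset) (simp add: openin_analytic_topology)
qed

text \<open>On a variety with at most one point every function is constructible, and the only fibre that
contributes is the point itself.\<close>

lemma pushforward_pullback_point:
  assumes A: "points A \<subseteq> {Q}"
  shows "pushforward A \<pi> (pullback A \<rho> f) y = (if points A = {Q} \<and> \<pi> Q = y then f (\<rho> Q) else 0)"
proof -
  let ?g = "pullback A \<rho> f"
  have "finite (range ?g)"
    by (rule finite_subset[of _ "{0, f (\<rho> Q)}"]) (use A in \<open>auto simp: pullback_def\<close>)
  moreover have "\<exists>Z \<in> constructible_sets (qcoords A). {x \<in> qdom A. ?g (qmap A x) = c} = qdom A \<inter> Z" for c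
  proof -
    have U: "UNIV \<in> constructible_sets (qcoords A)"
      using constructible_sets.zeros[OF poly_functions.const[of 0]] by simp
    then have E: "{} \<in> constructible_sets (qcoords A)"
      using constructible_sets.compl by fastforce
    have q: "qmap A x = Q" if "x \<in> qdom A" for x
      using that A by (auto simp: points_def)
    show ?thesis
    proof (cases "?g Q = c")
      case True
      then show ?thesis using q by (intro bexI[OF _ U]) auto
    next
      case False
      then show ?thesis using q by (intro bexI[OF _ E]) auto
    qed
  qed
  ultimately have g: "?g \<in> constructible_functions A"
    by (auto simp: constructible_functions_def) (simp add: pullback_def)
  show ?thesis
  proof (cases "points A = {Q}")
    case True
    have "{a \<in> points A. \<pi> a = y \<and> ?g a = c} = (if \<pi> Q = y \<and> f (\<rho> Q) = c then {Q} else {})" for c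
      using True by (auto simp: pullback_def)
    then have "topspace (subtopology (analytic_topology A) {a \<in> points A. \<pi> a = y \<and> ?g a = c}) =
        (if \<pi> Q = y \<and> f (\<rho> Q) = c then {Q} else {})" for c
      using True by (simp add: topspace_analytic_topology)
    then have "euler_char (subtopology (analytic_topology A) {a \<in> points A. \<pi> a = y \<and> ?g a = c}) =
        (if \<pi> Q = y \<and> f (\<rho> Q) = c then 1 else 0)" for c
      by (auto intro: euler_char_point euler_char_empty)
    moreover have "?g ` points A = {f (\<rho> Q)}"
      using True by (simp add: pullback_def)
    ultimately show ?thesis
      using g True by (cases "f (\<rho> Q) = 0") (auto simp: pushforward_def)
  next
    case False
    then have "points A = {}" using A by blast
    then show ?thesis by (simp add: pushforward_def)
  qed
qed

section \<open>Exchanging the two short arms\<close>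

lemma swap_ends_involutive:
  assumes "n \<ge> 4"
  shows "swap_ends n (swap_ends n i) = i"
  using assms by (auto simp: swap_ends_def)

lemma star_star: "n \<ge> 4 \<Longrightarrow> star n (star n v) = v"
  by (simp add: star_def fun_eq_iff swap_ends_involutive)

lemma swap_ends_vertices: "n \<ge> 4 \<Longrightarrow> swap_ends n i \<in> vertices n \<longleftrightarrow> i \<in> vertices n"
  by (auto simp: swap_ends_def vertices_def)

lemma swap_ends_Omega:
  assumes n: "n \<ge> 4"
  shows "map_prod (swap_ends n) (swap_ends n) h \<in> Omega n \<longleftrightarrow> h \<in> Omega n"
proof -
  have 1: "map_prod (swap_ends n) (swap_ends n) h \<in> Omega n" if h: "h \<in> Omega n" for h
  proof -
    from h consider i where "1 \<le> i" "i \<le> n - 2" "h = (i, i + 1)" | "h = (n - 2, n)"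
      by (auto simp: Omega_def)
    then show ?thesis
    proof cases
      case (1 i)
      then show ?thesis
        using n by (cases "i = n - 2") (auto simp: Omega_def swap_ends_def)
    qed (use n in \<open>auto simp: Omega_def swap_ends_def\<close>)
  qed
  have "map_prod (swap_ends n) (swap_ends n) (map_prod (swap_ends n) (swap_ends n) h) = h"
    by (cases h) (simp add: swap_ends_involutive[OF n])
  then show ?thesis using 1[of h] 1[of "map_prod (swap_ends n) (swap_ends n) h"] by auto
qed

lemma swap_ends_edges:
  assumes n: "n \<ge> 4"
  shows "map_prod (swap_ends n) (swap_ends n) h \<in> edges n \<longleftrightarrow> h \<in> edges n"
proof -
  have "h \<in> edges n \<longleftrightarrow> h \<in> Omega n \<or> prod.swap h \<in> Omega n" for h
    by (force simp: edges_def)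
  moreover have "prod.swap (map_prod (swap_ends n) (swap_ends n) h) =
      map_prod (swap_ends n) (swap_ends n) (prod.swap h)"
    by (cases h) simp
  ultimately show ?thesis by (simp only: swap_ends_Omega[OF n])
qed

lemma kappa_rep_kappa_rep: "n \<ge> 4 \<Longrightarrow> kappa_rep n (kappa_rep n R) = R"
  by (cases R) (auto simp: kappa_rep_def fun_eq_iff swap_ends_involutive)

text \<open>Relabelling by a diagram automorphism that preserves \<open>\<Omega>\<close>, hence also the signs \<open>\<epsilon>\<close>.\<close>

lemma kappa_rep_stable:
  assumes n: "n \<ge> 4" and R: "R \<in> Lambda_st n v w"
  shows "kappa_rep n R \<in> Lambda_st n (star n v) (star n w)"
proof -
  obtain x j where xj: "R = (x, j)" by fastforce
  define \<sigma> where "\<sigma> = swap_ends n"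
  define \<tau> where "\<tau> = map_prod \<sigma> \<sigma>"
  have \<sigma>\<sigma>: "\<sigma> (\<sigma> i) = i" for i unfolding \<sigma>_def by (rule swap_ends_involutive[OF n])
  have \<tau>\<tau>: "\<tau> (\<tau> h) = h" for h by (cases h) (simp add: \<tau>_def \<sigma>\<sigma>)
  have \<sigma>v: "\<sigma> i \<in> vertices n \<longleftrightarrow> i \<in> vertices n" for i unfolding \<sigma>_def by (rule swap_ends_vertices[OF n])
  have \<tau>e: "\<tau> h \<in> edges n \<longleftrightarrow> h \<in> edges n" for h unfolding \<tau>_def \<sigma>_def by (rule swap_ends_edges[OF n])
  have \<tau>s: "fst (\<tau> h) = \<sigma> (fst h)" "snd (\<tau> h) = \<sigma> (snd h)" "\<tau> (prod.swap h) = prod.swap (\<tau> h)" for h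
    by (cases h, simp add: \<tau>_def)+
  have eps: "eps n (\<tau> h) = eps n h" for h
    by (simp add: eps_def \<tau>_def \<sigma>_def swap_ends_Omega[OF n])
  have k: "kappa_rep n R = (x \<circ> \<tau>, j \<circ> \<sigma>)"
    by (simp add: kappa_rep_def xj \<tau>_def \<sigma>_def)
  have st: "star n v = v \<circ> \<sigma>" "star n w = w \<circ> \<sigma>" by (simp_all add: star_def \<sigma>_def)
  have x: "x \<in> edge_maps n v" and j: "j \<in> framing_maps n v w" and nil: "nilpotent_rep n v x"
    and mom: "moment_zero n v x" and stab: "\<And>S. S \<in> graded_subspaces n v \<Longrightarrow> x_stable n x S \<Longrightarrow>
           (\<forall>i \<in> vertices n. \<forall>s \<in> S i. j i *\<^sub>v s = 0\<^sub>v (w i)) \<Longrightarrow>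
           (\<forall>i \<in> vertices n. S i = {0\<^sub>v (v i)})"
    using R by (auto simp: Lambda_st_def Lambda_V_def xj)
  have "x \<circ> \<tau> \<in> edge_maps n (v \<circ> \<sigma>)"
    unfolding edge_maps_def
  proof (rule PiE_I)
    fix h assume "h \<in> edges n"
    then have "\<tau> h \<in> edges n" by (simp add: \<tau>e)
    from PiE_mem[OF x[unfolded edge_maps_def] this]
    show "(x \<circ> \<tau>) h \<in> carrier_mat ((v \<circ> \<sigma>) (snd h)) ((v \<circ> \<sigma>) (fst h))" by (simp add: \<tau>s)
  next
    fix h assume "h \<notin> edges n"
    then have "\<tau> h \<notin> edges n" by (simp add: \<tau>e)
    from PiE_arb[OF x[unfolded edge_maps_def] this] show "(x \<circ> \<tau>) h = undefined" by simp
  qed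
  moreover have "j \<circ> \<sigma> \<in> framing_maps n (v \<circ> \<sigma>) (w \<circ> \<sigma>)"
    using j unfolding framing_maps_def PiE_iff extensional_def by (simp add: \<sigma>v)
  moreover have "nilpotent_rep n (v \<circ> \<sigma>) (x \<circ> \<tau>)"
  proof -
    obtain N where N: "N \<ge> 1" and N0: "\<And>h hs. length (h # hs) = N \<Longrightarrow> set (h # hs) \<subseteq> edges n \<Longrightarrow>
        successively (\<lambda>h h'. snd h = fst h') (h # hs) \<Longrightarrow>
        foldl (\<lambda>A h'. x h' * A) (x h) hs = 0\<^sub>m (v (snd (last (h # hs)))) (v (fst h))"
      using nil unfolding nilpotent_rep_def by blast
    have "foldl (\<lambda>A h'. (x \<circ> \<tau>) h' * A) ((x \<circ> \<tau>) h) hs =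
        0\<^sub>m ((v \<circ> \<sigma>) (snd (last (h # hs)))) ((v \<circ> \<sigma>) (fst h))"
      if h: "length (h # hs) = N" "set (h # hs) \<subseteq> edges n"
        "successively (\<lambda>h h'. snd h = fst h') (h # hs)" for h hs
    proof -
      have "successively (\<lambda>h h'. snd h = fst h') (map \<tau> (h # hs))"
        unfolding successively_map using h(3) by (rule successively_mono) (auto simp: \<tau>s)
      moreover have "last (map \<tau> (h # hs)) = \<tau> (last (h # hs))"
        by (rule last_map) simp
      moreover have "foldl (\<lambda>A h'. x h' * A) A (map \<tau> hs) = foldl (\<lambda>A h'. (x \<circ> \<tau>) h' * A) A hs" for A
        by (simp add: foldl_map)
      moreover have "set (map \<tau> (h # hs)) \<subseteq> edges n"
        unfolding set_map by (rule image_subsetI, unfold \<tau>e) (rule subsetD[OF h(2)])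
      ultimately show ?thesis
        using N0[of "\<tau> h" "map \<tau> hs"] h(1) by (auto simp: \<tau>s)
    qed
    then show ?thesis using N unfolding nilpotent_rep_def by blast
  qed
  moreover have "moment_zero n (v \<circ> \<sigma>) (x \<circ> \<tau>)"
    unfolding moment_zero_def
  proof (intro ballI allI impI)
    fix i r c assume i: "i \<in> vertices n" and r: "r < (v \<circ> \<sigma>) i" and c: "c < (v \<circ> \<sigma>) i"
    have "(\<Sum>h \<in> {h \<in> edges n. snd h = i}. eps n h * ((x \<circ> \<tau>) h * (x \<circ> \<tau>) (prod.swap h)) $$ (r, c)) =
        (\<Sum>h \<in> {h \<in> edges n. snd h = \<sigma> i}. eps n h * (x h * x (prod.swap h)) $$ (r, c))"
      by (rule sum.reindex_bij_witness[of _ \<tau> \<tau>]) (auto simp: \<tau>\<tau> \<tau>s \<tau>e eps \<sigma>\<sigma>)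
    then show "(\<Sum>h \<in> {h \<in> edges n. snd h = i}. eps n h * ((x \<circ> \<tau>) h * (x \<circ> \<tau>) (prod.swap h)) $$ (r, c)) = 0"
      using mom i r c by (simp add: moment_zero_def \<sigma>v)
  qed
  moreover have "\<forall>i \<in> vertices n. S i = {0\<^sub>v ((v \<circ> \<sigma>) i)}"
    if S: "S \<in> graded_subspaces n (v \<circ> \<sigma>)" "x_stable n (x \<circ> \<tau>) S"
      "\<forall>i \<in> vertices n. \<forall>s \<in> S i. (j \<circ> \<sigma>) i *\<^sub>v s = 0\<^sub>v ((w \<circ> \<sigma>) i)" for S
  proof -
    have "S (\<sigma> i) \<in> {S. VectorSpace.subspace class_ring S (module_vec TYPE(complex) (v i))}"
      if "i \<in> vertices n" for i
    proof -
      have "\<sigma> i \<in> vertices n" using that by (simp add: \<sigma>v)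
      from PiE_mem[OF S(1)[unfolded graded_subspaces_def] this] show ?thesis by (simp add: \<sigma>\<sigma>)
    qed
    then have "S \<circ> \<sigma> \<in> graded_subspaces n v"
      using S(1) unfolding graded_subspaces_def PiE_iff extensional_def by (simp add: \<sigma>v)
    moreover have "x_stable n x (S \<circ> \<sigma>)"
      unfolding x_stable_def
    proof (intro ballI)
      fix h s assume "h \<in> edges n" "s \<in> (S \<circ> \<sigma>) (fst h)"
      then show "x h *\<^sub>v s \<in> (S \<circ> \<sigma>) (snd h)"
        using S(2) \<tau>e[of h] unfolding x_stable_def by (auto simp: \<tau>s \<tau>\<tau> dest!: bspec[of _ _ "\<tau> h"])
    qed
    moreover have "\<forall>i \<in> vertices n. \<forall>s \<in> (S \<circ> \<sigma>) i. j i *\<^sub>v s = 0\<^sub>v (w i)"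
    proof (intro ballI)
      fix i s assume "i \<in> vertices n" "s \<in> (S \<circ> \<sigma>) i"
      then show "j i *\<^sub>v s = 0\<^sub>v (w i)"
        using bspec[OF S(3), of "\<sigma> i"] by (auto simp: \<sigma>\<sigma> \<sigma>v)
    qed
    ultimately have "\<forall>i \<in> vertices n. (S \<circ> \<sigma>) i = {0\<^sub>v (v i)}" by (rule stab)
    then show ?thesis by (metis \<sigma>\<sigma> \<sigma>v comp_apply)
  qed
  ultimately show ?thesis
    unfolding k st Lambda_st_def Lambda_V_def by blast
qed

lemma kappa_Lambda_st:
  assumes n: "n \<ge> 4"
  shows "kappa n (Lambda_st n v w) = Lambda_st n (star n v) (star n w)"
proof (intro equalityI subsetI)
  fix R assume "R \<in> Lambda_st n (star n v) (star n w)"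
  then have "kappa_rep n R \<in> Lambda_st n v w"
    using kappa_rep_stable[OF n] star_star[OF n] by metis
  then show "R \<in> kappa n (Lambda_st n v w)"
    unfolding kappa_def by (metis image_eqI kappa_rep_kappa_rep[OF n])
qed (auto simp: kappa_def intro: kappa_rep_stable[OF n])

context short_arms begin

lemma swapped: "short_arms n q p"
  using n pq by unfold_locales auto

lemma star_unitv: "star n (unitv p) = unitv q"
  using n pq by (auto simp: star_def unitv_def swap_ends_def fun_eq_iff)

lemma nonempty_star: "short_arms.nonempty n q v \<longleftrightarrow> nonempty (star n v)"
proof -
  interpret S: short_arms n q p by (rule swapped)
  have "kappa n (Lambda_st n v (unitv q)) = Lambda_st n (star n v) (unitv p)"
    by (simp add: kappa_Lambda_st[OF n] S.star_unitv)
  then show ?thesis unfolding S.nonempty_def nonempty_def by (metis image_is_empty kappa_def)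
qed

lemma corr_down_eq:
  "corr_down n v (unitv p) u f y =
    (if u \<le> v \<and> nonempty v \<and> nonempty (v - u) \<and> y = Lambda_st n (v - u) (unitv p)
     then f (Lambda_st n v (unitv p)) else 0)"
  unfolding corr_down_def
  by (subst pushforward_pullback_point[of _ "flag_point v u"])
    (auto simp: points_flag_variety pi1_flag_point pi2_flag_point split: if_splits)

lemma corr_up_eq:
  "corr_up n v (unitv p) u f y =
    (if u \<le> v \<and> nonempty v \<and> nonempty (v - u) \<and> y = Lambda_st n v (unitv p)
     then f (Lambda_st n (v - u) (unitv p)) else 0)"
  unfolding corr_up_def
  by (subst pushforward_pullback_point[of _ "flag_point v u"])
    (auto simp: points_flag_variety pi1_flag_point pi2_flag_point split: if_splits)

lemma kappa_pull_eq:
  "kappa_pull n (unitv p) f v y =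
    (if short_arms.nonempty n q v \<and> y = Lambda_st n v (unitv q)
     then f (star n v) (Lambda_st n (star n v) (unitv p)) else 0)"
proof -
  interpret S: short_arms n q p by (rule swapped)
  show ?thesis
    using S.points_quiver_variety[of v]
    by (auto simp: kappa_pull_def pullback_def star_unitv S.nonempty_def kappa_Lambda_st[OF n] S.star_unitv)
qed

end


section \<open>Order ideals and sets of endpoints\<close>

definition count_upto :: "nat set \<Rightarrow> nat \<Rightarrow> nat" where
  "count_upto D r = card {d \<in> D. d \<le> r}"

lemma count_upto_Suc:
  assumes "finite D"
  shows "count_upto D (Suc r) = count_upto D r + (if Suc r \<in> D then 1 else 0)"
proof -
  have "{d \<in> D. d \<le> Suc r} = (if Suc r \<in> D then insert (Suc r) {d \<in> D. d \<le> r} else {d \<in> D. d \<le> r})"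
    by (auto simp: le_Suc_eq)
  then show ?thesis using assms by (auto simp: count_upto_def)
qed

lemma count_upto_insert:
  assumes "finite D" "k \<notin> D"
  shows "count_upto (insert k D) r = count_upto D r + (if k \<le> r then 1 else 0)"
proof -
  have "{d \<in> insert k D. d \<le> r} = (if k \<le> r then insert k {d \<in> D. d \<le> r} else {d \<in> D. d \<le> r})"
    by auto
  then show ?thesis using assms by (auto simp: count_upto_def)
qed

context short_arms begin

abbreviation endpoint_sets :: "nat set set" where
  "endpoint_sets \<equiv> Pow {1..n - 1}"

text \<open>The vector \<open>v\<^sub>Y\<^sup>+\<close> (if \<open>p = n\<close>) or \<open>v\<^sub>Y\<^sup>-\<close> (if \<open>p = n - 1\<close>) of the Young diagram with set of endpoints \<open>D\<close>.\<close>

definition dimv :: "nat set \<Rightarrow> dimvec" where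
  "dimv D r =
     (if 1 \<le> r \<and> r \<le> n - 2 then count_upto D r else if r = p then (card D + 1) div 2
      else if r = q then card D div 2 else 0)"

lemma endpoint_finite: "D \<in> endpoint_sets \<Longrightarrow> finite D"
  using finite_subset by auto

lemma count_upto_0: "D \<in> endpoint_sets \<Longrightarrow> count_upto D 0 = 0"
  by (auto simp: count_upto_def)

lemma count_upto_all: "D \<in> endpoint_sets \<Longrightarrow> count_upto D (n - 1) = card D"
  unfolding count_upto_def by (rule arg_cong[of _ _ card]) auto

lemma count_upto_step:
  assumes "D \<in> endpoint_sets" "1 \<le> r"
  shows "count_upto D r = count_upto D (r - 1) + (if r \<in> D then 1 else 0)"
  using count_upto_Suc[OF endpoint_finite[OF assms(1)], of "r - 1"] assms(2) by simp

lemma dimv_simps: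
  "1 \<le> r \<Longrightarrow> r \<le> n - 2 \<Longrightarrow> dimv D r = count_upto D r"
  "dimv D p = (card D + 1) div 2" "dimv D q = card D div 2" "r \<notin> vertices n \<Longrightarrow> dimv D r = 0"
  using ends_distinct n by (auto simp: dimv_def vertices_def)

lemma dimv_ends: "dimv D p + dimv D q = card D"
  by (simp add: dimv_simps)

lemma endpoint_sets_eqI:
  assumes D: "D \<in> endpoint_sets" and D': "D' \<in> endpoint_sets"
    and eq: "\<And>r. 1 \<le> r \<Longrightarrow> r \<le> n - 1 \<Longrightarrow> count_upto D r = count_upto D' r"
  shows "D = D'"
proof -
  have "r \<in> D \<longleftrightarrow> r \<in> D'" if "1 \<le> r" "r \<le> n - 1" for r
  proof -
    have "count_upto D (r - 1) = count_upto D' (r - 1)"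
      using eq[of "r - 1"] that count_upto_0[OF D] count_upto_0[OF D'] by (cases "r = 1") auto
    then show ?thesis
      using eq[OF that] count_upto_step[OF D that(1)] count_upto_step[OF D' that(1)]
      by (cases "r \<in> D"; cases "r \<in> D'") simp_all
  qed
  moreover have "1 \<le> r \<and> r \<le> n - 1" if "r \<in> D \<or> r \<in> D'" for r
    using D D' that by auto
  ultimately show ?thesis by blast
qed

lemma dimvec_eqI:
  assumes "\<And>r. 1 \<le> r \<Longrightarrow> r \<le> n - 2 \<Longrightarrow> v r = v' r" "v p = v' p" "v q = v' q"
    "\<And>r. r \<notin> vertices n \<Longrightarrow> v r = (v' r :: nat)"
  shows "v = v'"
proof
  show "v r = v' r" for r
    using assms vertex_cases[of r "v r = v' r"] by (cases "r \<in> vertices n") auto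
qed

lemma order_ideal_dimv:
  assumes D: "D \<in> endpoint_sets"
  shows "order_ideal (dimv D)"
  unfolding order_ideal_def
proof (intro conjI ballI allI impI)
  have s: "card D = count_upto D (n - 2) + (if n - 1 \<in> D then 1 else 0)"
    using count_upto_step[OF D, of "n - 1"] count_upto_all[OF D] n by (simp add: numeral_2_eq_2)
  show "dimv D 1 \<le> 1"
    using n count_upto_step[OF D, of 1] count_upto_0[OF D] by (simp add: dimv_simps)
  fix h k l assume h: "h \<in> edges n" and l: "pull h k = Some l" and k: "dimv D (snd h) \<le> k"
  show "dimv D (fst h) \<le> l"
    using h
  proof (cases rule: edge_cases)
    case to_p
    then show ?thesis using l k s n by (auto simp: pull_simps dimv_simps split: if_splits)
  next
    case to_q
    then show ?thesis using l k s n by (auto simp: pull_simps dimv_simps split: if_splits)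
  next
    case from_p
    then show ?thesis using l k s n by (auto simp: pull_simps dimv_simps split: if_splits elim!: oddE)
  next
    case from_q
    then show ?thesis using l k s n by (auto simp: pull_simps dimv_simps split: if_splits elim!: evenE)
  next
    case (out i)
    then show ?thesis using l k count_upto_step[OF D, of "Suc i"]
      by (auto simp: pull_simps dimv_simps split: if_splits)
  next
    case (inn i)
    then show ?thesis using l k count_upto_step[OF D, of "Suc i"]
      by (auto simp: pull_simps dimv_simps split: if_splits)
  qed
qed

text \<open>The arrows of the long arm bound the growth of \<open>v\<close> by \<open>0\<close> and \<open>1\<close> at every step, which gives the
endpoints up to \<open>n - 2\<close>. The four arrows at the tips leave one binary choice for \<open>v p\<close> if
\<open>v (n - 2)\<close> is even and for \<open>v q\<close> if it is odd: whether \<open>n - 1\<close> is an endpoint.\<close>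

lemma order_ideal_is_dimv:
  assumes v: "order_ideal v" and supp: "\<And>i. i \<notin> vertices n \<Longrightarrow> v i = 0"
  shows "\<exists>D \<in> endpoint_sets. v = dimv D"
proof -
  have pullD: "v (fst h) \<le> l" if "h \<in> edges n" "pull h k = Some l" "v (snd h) \<le> k" for h k l
    using v that unfolding order_ideal_def by blast
  have v0: "v 0 = 0" using supp[of 0] by (simp add: vertices_def)
  have up: "v i \<le> v (Suc i)" "v (Suc i) \<le> Suc (v i)" if "1 \<le> i" "i < n - 2" for i
    using pullD[OF edges_intros(5)[OF that] pull_simps(5)[OF that(2)], of "v (Suc i)"]
      pullD[OF edges_intros(6)[OF that] pull_simps(6)[OF that(2)], of "v i"] by auto
  have mp: "v (n - 2) \<le> 2 * v p" and mq: "v (n - 2) \<le> 2 * v q + 1"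
    using pullD[OF edges_intros(1) pull_simps(1), of "v p"] pullD[OF edges_intros(2) pull_simps(2), of "v q"]
    by auto
  have pm: "v p \<le> v (n - 2) div 2 + 1"
    using pullD[OF edges_intros(3), of "2 * (v (n - 2) div 2) + 1" "v (n - 2) div 2 + 1"]
    by (simp add: pull_simps)
  have qm: "v q \<le> (v (n - 2) + 1) div 2"
    using pullD[OF edges_intros(4), of "2 * ((v (n - 2) + 1) div 2)" "(v (n - 2) + 1) div 2"]
    by (simp add: pull_simps)
  define D where "D = {r \<in> {1..n - 2}. v r = Suc (v (r - 1))} \<union> (if v p + v q = Suc (v (n - 2)) then {n - 1} else {})"
  have D: "D \<in> endpoint_sets" using n by (auto simp: D_def split: if_splits)
  have c: "count_upto D r = v r" if "r \<le> n - 2" for r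
    using that
  proof (induction r)
    case 0
    then show ?case using count_upto_0[OF D] v0 by simp
  next
    case (Suc r)
    have "v r \<le> v (Suc r)" "v (Suc r) \<le> Suc (v r)"
      using up[of r] Suc.prems v v0 by (cases "r = 0"; simp add: order_ideal_def)+
    moreover have "Suc r \<in> D \<longleftrightarrow> v (Suc r) = Suc (v r)"
      using Suc.prems n by (auto simp: D_def)
    ultimately show ?case
      using count_upto_step[OF D, of "Suc r"] Suc by auto
  qed
  have "n - 1 \<in> D \<longleftrightarrow> v p + v q = Suc (v (n - 2))"
    using n by (auto simp: D_def)
  moreover have "card D = count_upto D (n - 2) + (if n - 1 \<in> D then 1 else 0)"
    using count_upto_step[OF D, of "n - 1"] count_upto_all[OF D] n by (simp add: numeral_2_eq_2)
  ultimately have card: "card D = v (n - 2) + (if v p + v q = Suc (v (n - 2)) then 1 else 0)"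
    using c[of "n - 2"] by simp
  have "v p = (card D + 1) div 2 \<and> v q = card D div 2"
  proof (cases "even (v (n - 2))")
    case True
    then obtain e where e: "v (n - 2) = 2 * e" by (elim evenE)
    then show ?thesis using mp mq pm qm card by auto
  next
    case False
    then obtain e where e: "v (n - 2) = 2 * e + 1" by (elim oddE)
    then show ?thesis using mp mq pm qm card by auto
  qed
  then have "v = dimv D"
    using c supp by (intro dimvec_eqI) (auto simp: dimv_simps)
  then show ?thesis using D by blast
qed

lemma nonempty_dimv:
  assumes v: "nonempty v" and supp: "\<And>i. i \<notin> vertices n \<Longrightarrow> v i = 0"
  shows "\<exists>D \<in> endpoint_sets. v = dimv D"
proof -
  obtain R where "R \<in> Lambda_st n v (unitv p)" using v by (auto simp: nonempty_def)
  then interpret S: stable_rep n p q v R by (rule stable_repI)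
  show ?thesis by (rule order_ideal_is_dimv[OF S.order_ideal_dim supp])
qed

lemma nonempty_down:
  assumes "nonempty v" "D \<in> endpoint_sets" "dimv D \<le> v"
  shows "nonempty (dimv D)"
  using assms stable_of_order_ideal[OF _ order_ideal_dimv[OF assms(2)], of _ v]
  unfolding nonempty_def le_fun_def by blast

lemma dimv_inj:
  assumes "D \<in> endpoint_sets" "D' \<in> endpoint_sets" "dimv D = dimv D'"
  shows "D = D'"
proof (rule endpoint_sets_eqI[OF assms(1,2)])
  fix r assume r: "1 \<le> r" "r \<le> n - 1"
  show "count_upto D r = count_upto D' r"
  proof (cases "r = n - 1")
    case True
    then show ?thesis
      using dimv_ends[of D] dimv_ends[of D'] assms(3) count_upto_all[OF assms(1)] count_upto_all[OF assms(2)]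
      by simp
  next
    case False
    then have "r \<le> n - 2" using r by simp
    then show ?thesis
      using r(1) dimv_simps(1)[of r D] dimv_simps(1)[of r D'] assms(3) by simp
  qed
qed

subsection \<open>Adding and moving rows\<close>

text \<open>The vectors \<open>y\<^sup>k\<close> and \<open>z\<^sup>k\<close>, for \<open>t = n - 1\<close> and \<open>t = n\<close>.\<close>

definition row_vec :: "nat \<Rightarrow> nat \<Rightarrow> dimvec" where
  "row_vec k t = (\<lambda>i. if k \<le> i \<and> i \<le> n - 2 \<or> i = t then 1 else 0)"

text \<open>The tip whose dimension grows when another row is added: \<open>\<lceil>s/2\<rceil>\<close> grows if \<open>s\<close> is even,
\<open>\<lfloor>s/2\<rfloor>\<close> if it is odd.\<close>

definition tip_of :: "nat set \<Rightarrow> nat" where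
  "tip_of D = (if even (card D) then p else q)"

lemma dimv_insert:
  assumes D: "D \<in> endpoint_sets" and k: "1 \<le> k" "k \<le> n - 1" "k \<notin> D"
  shows "dimv (insert k D) = dimv D + row_vec k (tip_of D)"
proof -
  have f: "finite D" by (rule endpoint_finite[OF D])
  have t: "tip_of D \<in> {p, q}" by (simp add: tip_of_def)
  show ?thesis
  proof (rule dimvec_eqI)
    show "dimv (insert k D) r = (dimv D + row_vec k (tip_of D)) r" if "1 \<le> r" "r \<le> n - 2" for r
      using that t ends_distinct by (auto simp: dimv_simps count_upto_insert[OF f k(3)] row_vec_def)
    show "dimv (insert k D) p = (dimv D + row_vec k (tip_of D)) p"
      "dimv (insert k D) q = (dimv D + row_vec k (tip_of D)) q"
      using f k ends_distinct by (auto simp: dimv_simps row_vec_def tip_of_def)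
    show "dimv (insert k D) r = (dimv D + row_vec k (tip_of D)) r" if "r \<notin> vertices n" for r
    proof -
      have "r \<noteq> tip_of D" "\<not> (k \<le> r \<and> r \<le> n - 2)"
        using that t ends_distinct k n by (auto simp: vertices_def)
      then show ?thesis using that by (auto simp: dimv_simps row_vec_def)
    qed
  qed
qed

text \<open>The dimension vector of a Young diagram grows by at most one at each step, so adding a row that
starts at \<open>k\<close> requires that none starts there yet.\<close>

lemma dimv_add_row:
  assumes D: "D \<in> endpoint_sets" and D': "D' \<in> endpoint_sets" and k: "1 \<le> k" "k \<le> n - 1"
    and t: "t \<in> {p, q}" and eq: "dimv D' = dimv D + row_vec k t"
  shows "k \<notin> D" "D' = insert k D" "t = tip_of D"
proof -
  have c: "count_upto D' r = count_upto D r + (if k \<le> r then 1 else 0)" if r: "1 \<le> r" "r \<le> n - 1" for r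
  proof (cases "r = n - 1")
    case True
    have "row_vec k t p + row_vec k t q = 1" using t ends_distinct by (auto simp: row_vec_def)
    then have "card D' = Suc (card D)" using dimv_ends[of D] dimv_ends[of D'] eq by simp
    then show ?thesis using True count_upto_all[OF D] count_upto_all[OF D'] k by simp
  next
    case False
    then have r2: "r \<le> n - 2" using r by simp
    then show ?thesis
      using fun_cong[OF eq, of r] r ends_distinct t by (auto simp: dimv_simps row_vec_def)
  qed
  show kD: "k \<notin> D"
  proof
    assume "k \<in> D"
    have "count_upto D' (k - 1) = count_upto D (k - 1)"
      using c[of "k - 1"] k count_upto_0[OF D] count_upto_0[OF D'] by (cases "k = 1") auto
    then show False
      using c[OF k] count_upto_step[OF D k(1)] count_upto_step[OF D' k(1)] \<open>k \<in> D\<close>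
      by (auto split: if_splits)
  qed
  show DD: "D' = insert k D"
    using D D' k c by (intro endpoint_sets_eqI) (auto simp: count_upto_insert[OF endpoint_finite[OF D] kD])
  have "row_vec k t p = row_vec k (tip_of D) p"
    using fun_cong[OF eq, of p] fun_cong[OF dimv_insert[OF D k kD], of p] DD by simp
  moreover have "row_vec k t' p = (if t' = p then 1 else 0)" for t'
    using ends_distinct by (simp add: row_vec_def)
  ultimately have "t = p \<longleftrightarrow> tip_of D = p"
    by (cases "t = p"; cases "tip_of D = p") simp_all
  moreover have "tip_of D \<in> {p, q}" by (simp add: tip_of_def)
  ultimately show "t = tip_of D" using t by auto
qed

lemma unitv_ends: "unitv p = row_vec (n - 1) p" "unitv q = row_vec (n - 1) q"
  using n by (auto simp: unitv_def row_vec_def fun_eq_iff)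

lemma dimv_move:
  assumes D: "D \<in> endpoint_sets" and k: "1 \<le> k" "k \<le> n - 2" "k \<notin> D" "Suc k \<in> D"
  shows "dimv (insert k (D - {Suc k})) = dimv D + unitv k"
proof -
  let ?C = "D - {Suc k}"
  have C: "?C \<in> endpoint_sets" using D by auto
  have "dimv D = dimv ?C + row_vec (Suc k) (tip_of ?C)"
    using dimv_insert[OF C, of "Suc k"] k by (simp add: insert_absorb)
  moreover have "dimv (insert k ?C) = dimv ?C + row_vec k (tip_of ?C)"
    using dimv_insert[OF C, of k] k by simp
  moreover have "row_vec k (tip_of ?C) = row_vec (Suc k) (tip_of ?C) + unitv k"
    using k ends_distinct by (auto simp: row_vec_def unitv_def tip_of_def fun_eq_iff)
  ultimately show ?thesis by (simp add: add.assoc)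
qed

text \<open>Raising the dimension at \<open>k\<close> alone means growing one step earlier, at \<open>k\<close> instead of \<open>k + 1\<close>.\<close>

lemma dimv_add_unitv:
  assumes D: "D \<in> endpoint_sets" and D': "D' \<in> endpoint_sets" and k: "1 \<le> k" "k \<le> n - 2"
    and eq: "dimv D' = dimv D + unitv k"
  shows "k \<notin> D" "Suc k \<in> D"
proof -
  have c: "count_upto D' r = count_upto D r + (if r = k then 1 else 0)" if r: "1 \<le> r" "r \<le> n - 1" for r
  proof (cases "r = n - 1")
    case True
    have "unitv k p + unitv k q = 0" using k ends_distinct by (auto simp: unitv_def)
    then have "card D' = card D" using dimv_ends[of D] dimv_ends[of D'] eq by simp
    then show ?thesis using True count_upto_all[OF D] count_upto_all[OF D'] k by auto
  next
    case False
    then have r2: "r \<le> n - 2" using r by simp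
    then show ?thesis
      using fun_cong[OF eq, of r] r by (auto simp: dimv_simps unitv_def)
  qed
  have k1: "k \<le> n - 1" using k by linarith
  have "count_upto D' (k - 1) = count_upto D (k - 1)"
    using c[of "k - 1"] k count_upto_0[OF D] count_upto_0[OF D'] by (cases "k = 1") auto
  then show "k \<notin> D"
    using c[OF k(1) k1] count_upto_step[OF D k(1)] count_upto_step[OF D' k(1)]
    by (cases "k \<in> D'"; cases "k \<in> D") simp_all
  have "count_upto D' (Suc k) = count_upto D (Suc k)" "count_upto D' k = Suc (count_upto D k)"
    using c[of k] c[of "Suc k"] k k1 n by auto
  then show "Suc k \<in> D"
    using count_upto_step[OF D, of "Suc k"] count_upto_step[OF D', of "Suc k"] by (auto split: if_splits)
qed

subsection \<open>Young diagrams\<close>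

lemma card_rows:
  assumes "Y \<in> young n"
  shows "card {i. i < length Y \<and> P (n - Y ! i)} = card {d \<in> (\<lambda>l. n - l) ` set Y. P d}"
proof -
  have dY: "distinct Y"
  proof -
    have "sorted_wrt (<) (rev Y)" using assms by (auto simp: young_def sorted_wrt_rev)
    then show ?thesis by (simp add: strict_sorted_iff)
  qed
  have inj: "inj_on (\<lambda>i. n - Y ! i) {..<length Y}"
  proof (rule inj_onI)
    fix i j assume ij: "i \<in> {..<length Y}" "j \<in> {..<length Y}" "n - Y ! i = n - Y ! j"
    have "l \<le> n - 1" if "l \<in> set Y" for l using assms that by (auto simp: young_def)
    then have "Y ! i \<le> n - 1" "Y ! j \<le> n - 1" using ij by auto
    then have "Y ! i = Y ! j" using ij(3) n by linarith
    then show "i = j" using dY ij by (simp add: nth_eq_iff_index_eq)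
  qed
  have "card ((\<lambda>i. n - Y ! i) ` {i. i < length Y \<and> P (n - Y ! i)}) = card {i. i < length Y \<and> P (n - Y ! i)}"
    by (intro card_image inj_on_subset[OF inj]) auto
  moreover have "(\<lambda>i. n - Y ! i) ` {i. i < length Y \<and> P (n - Y ! i)} = {d \<in> (\<lambda>l. n - l) ` set Y. P d}"
  proof (intro equalityI subsetI)
    fix d assume "d \<in> {d \<in> (\<lambda>l. n - l) ` set Y. P d}"
    then obtain i where "i < length Y" "d = n - Y ! i" "P d" by (auto simp: in_set_conv_nth)
    then show "d \<in> (\<lambda>i. n - Y ! i) ` {i. i < length Y \<and> P (n - Y ! i)}" by blast
  qed (auto intro!: imageI nth_mem)
  ultimately show ?thesis by simp
qed

lemma star_apply:
  "star n v p = v q" "star n v q = v p" "r \<le> n - 2 \<Longrightarrow> star n v r = v r" "r \<notin> vertices n \<Longrightarrow> star n v r = v r"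
  using n pq by (auto simp: star_def swap_ends_def vertices_def)

lemma star_dimv: "star n (dimv D) = short_arms.dimv n q p D"
proof -
  interpret S: short_arms n q p by (rule swapped)
  show ?thesis
    by (rule dimvec_eqI) (auto simp: star_apply dimv_simps S.dimv_simps)
qed

lemma v_young:
  assumes Y: "Y \<in> young n"
  shows "(if unitv p = unitv n then v_plus n Y else v_minus n Y) = dimv ((\<lambda>l. n - l) ` set Y)"
proof -
  let ?D = "(\<lambda>l. n - l) ` set Y"
  have len: "length Y = card ?D"
    using card_rows[OF Y, of "\<lambda>_. True"] by simp
  have half: "nat \<lceil>real s / 2\<rceil> = (s + 1) div 2" "nat \<lfloor>real s / 2\<rfloor> = s div 2" for s :: nat
    by linarith+
  have plus: "v_plus n Y = short_arms.dimv n n (n - 1) ?D"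
  proof -
    interpret S: short_arms n n "n - 1" using n by unfold_locales auto
    show ?thesis
    proof (rule S.dimvec_eqI)
      show "v_plus n Y r = S.dimv ?D r" if "1 \<le> r" "r \<le> n - 2" for r
        using card_rows[OF Y, of "\<lambda>d. d \<le> r"] that
        unfolding S.dimv_simps(1)[OF that] count_upto_def v_plus_def by simp
      have far: "\<not> (1 \<le> n \<and> n \<le> n - 2)" "\<not> (1 \<le> n - 1 \<and> n - 1 \<le> n - 2)" "n - 1 \<noteq> n"
        using n by auto
      show "v_plus n Y n = S.dimv ?D n"
        unfolding S.dimv_simps(2) v_plus_def if_not_P[OF far(1)] half len by (simp only: refl if_True)
      show "v_plus n Y (n - 1) = S.dimv ?D (n - 1)"
        unfolding S.dimv_simps(3) v_plus_def if_not_P[OF far(2)] if_not_P[OF far(3)] half len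
        by (simp only: refl if_True)
      show "v_plus n Y r = S.dimv ?D r" if "r \<notin> vertices n" for r
      proof -
        have out: "\<not> (1 \<le> r \<and> r \<le> n - 2)" "r \<noteq> n" "r \<noteq> n - 1"
          using that n by (auto simp: vertices_def)
        show ?thesis
          unfolding S.dimv_simps(4)[OF that] v_plus_def if_not_P[OF out(1)] if_not_P[OF out(2)]
            if_not_P[OF out(3)] ..
      qed
    qed
  qed
  show ?thesis
  proof (cases "p = n")
    case True
    then have "q = n - 1" using pq n by auto
    then show ?thesis using plus True by simp
  next
    case False
    then have pq': "p = n - 1" "q = n" using pq by auto
    interpret S: short_arms n n "n - 1" using n by unfold_locales auto
    have "unitv p \<noteq> unitv n" using False by (auto simp: unitv_def fun_eq_iff)
    then show ?thesis using plus S.star_dimv pq' by (simp add: v_minus_def)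
  qed
qed

lemma young_of_dimv:
  assumes D: "D \<in> endpoint_sets"
  shows "length (young_of n (unitv p) (dimv D)) = card D"
    "rows_before n k (young_of n (unitv p) (dimv D)) = card {d \<in> D. d < k}"
proof -
  define Y where "Y = rev (sorted_list_of_set ((\<lambda>d. n - d) ` D))"
  have f: "finite D" by (rule endpoint_finite[OF D])
  have setY: "set Y = (\<lambda>d. n - d) ` D" using f by (simp add: Y_def)
  have "sorted_wrt (\<lambda>x y. y < x) Y"
    using strict_sorted_list_of_set[of "(\<lambda>d. n - d) ` D"] by (simp add: Y_def sorted_wrt_rev)
  moreover have "set Y \<subseteq> {1..n - 1}"
  proof -
    have "n - d \<in> {1..n - 1}" if "d \<in> D" for d
    proof -
      have "1 \<le> d" "d \<le> n - 1" using that D by auto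
      then show ?thesis using n by auto
    qed
    then show ?thesis unfolding setY by blast
  qed
  ultimately have Y: "Y \<in> young n" by (simp add: young_def)
  have endY: "(\<lambda>l. n - l) ` set Y = D"
  proof -
    have "n - (n - d) = d" if "d \<in> D" for d
    proof -
      have "d \<le> n - 1" using that D by auto
      then show ?thesis by simp
    qed
    then show ?thesis unfolding setY by (simp add: image_image cong: image_cong_simp)
  qed
  have unique: "Y' = Y" if Y': "Y' \<in> young n" and eq: "dimv D = dimv ((\<lambda>l. n - l) ` set Y')" for Y'
  proof -
    have sub: "set Y' \<subseteq> {1..n - 1}" using Y' by (simp add: young_def)
    have "n - l \<in> {1..n - 1}" if "l \<in> set Y'" for l
    proof -
      have "1 \<le> l" "l \<le> n - 1" using that sub by auto
      then show ?thesis using n by auto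
    qed
    then have "(\<lambda>l. n - l) ` set Y' \<in> endpoint_sets" by blast
    then have "D = (\<lambda>l. n - l) ` set Y'" using dimv_inj[OF D _ eq] by simp
    moreover have "(\<lambda>d. n - d) ` (\<lambda>l. n - l) ` set Y' = set Y'"
    proof -
      have "n - (n - l) = l" if "l \<in> set Y'" for l
      proof -
        have "l \<le> n - 1" using that sub by auto
        then show ?thesis by simp
      qed
      then show ?thesis by (simp add: image_image cong: image_cong_simp)
    qed
    ultimately have "set Y' = set Y" unfolding setY by simp
    moreover have "sorted_wrt (<) (rev Y')" "sorted_wrt (<) (rev Y)"
      using Y Y' by (auto simp: young_def sorted_wrt_rev)
    ultimately have "rev Y' = rev Y"
      by (intro strict_sorted_equal) auto
    then show ?thesis by simp
  qed
  have "young_of n (unitv p) (dimv D) = Y"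
    unfolding young_of_def
  proof (rule the_equality)
    show "Y \<in> young n \<and> dimv D = (if unitv p = unitv n then v_plus n Y else v_minus n Y)"
      unfolding v_young[OF Y] endY using Y by blast
    show "Y' = Y" if "Y' \<in> young n \<and> dimv D = (if unitv p = unitv n then v_plus n Y' else v_minus n Y')" for Y'
      using that unique[of Y'] v_young[of Y'] by presburger
  qed
  then show "length (young_of n (unitv p) (dimv D)) = card D"
    "rows_before n k (young_of n (unitv p) (dimv D)) = card {d \<in> D. d < k}"
    using card_rows[OF Y, of "\<lambda>_. True"] card_rows[OF Y, of "\<lambda>d. d < k"] endY
    by (simp_all add: rows_before_def)
qed

end


section \<open>The operators in terms of sets of endpoints\<close>

text \<open>A quiver variety does not see the entries of \<open>v\<close> at indices that are not vertices. So it may be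
nonempty although \<open>v\<close> does not come from a Young diagram and \<^const>\<open>young_of\<close> is meaningless.
Functions in \<open>L(w)\<close> vanish at such \<open>v\<close>.\<close>

definition supported :: "nat \<Rightarrow> graded_fun \<Rightarrow> bool" where
  "supported n f \<longleftrightarrow> (\<forall>v y. f v y \<noteq> 0 \<longrightarrow> (\<forall>i. i \<notin> vertices n \<longrightarrow> v i = 0))"

context short_arms begin

text \<open>The value of \<open>f\<close> at the point that belongs to the Young diagram with endpoints \<open>D\<close>.\<close>

definition coef :: "graded_fun \<Rightarrow> nat set \<Rightarrow> complex" where
  "coef f D = f (dimv D) (Lambda_st n (dimv D) (unitv p))"

definition concentrated :: "graded_fun \<Rightarrow> bool" where
  "concentrated f \<longleftrightarrow> supported n f \<and> (\<forall>v y. f v y \<noteq> 0 \<longrightarrow> nonempty v \<and> y = Lambda_st n v (unitv p))"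

lemma concentrated_eqI:
  assumes f: "concentrated f" and g: "concentrated g"
    and eq: "\<And>D. D \<in> endpoint_sets \<Longrightarrow> nonempty (dimv D) \<Longrightarrow> coef f D = coef g D"
  shows "f = g"
proof (intro ext)
  fix v y
  show "f v y = g v y"
  proof (cases "nonempty v \<and> y = Lambda_st n v (unitv p) \<and> (\<forall>i. i \<notin> vertices n \<longrightarrow> v i = 0)")
    case True
    then obtain D where "D \<in> endpoint_sets" "v = dimv D" using nonempty_dimv by blast
    then show ?thesis using eq[of D] True by (simp add: coef_def)
  next
    case False
    have zero: "h v y = 0" if h: "concentrated h" for h
    proof (rule ccontr)
      assume nz: "h v y \<noteq> 0"
      have "v i = 0" if "i \<notin> vertices n" for i
        using h nz that unfolding concentrated_def supported_def by metis
      moreover have "nonempty v" "y = Lambda_st n v (unitv p)"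
        using h nz unfolding concentrated_def by metis+
      ultimately show False using False by metis
    qed
    show ?thesis using zero[OF f] zero[OF g] by simp
  qed
qed

lemma add_diff_dimvec: "(v :: dimvec) + u - u = v" "u \<le> v + u" "u \<le> v \<Longrightarrow> v - u + u = v"
  for u :: dimvec
  by (auto simp: fun_eq_iff le_fun_def)

lemma E_op_eq:
  "E_op n (unitv p) k f v y =
    (if nonempty (v + unitv k) \<and> nonempty v \<and> y = Lambda_st n v (unitv p)
     then f (v + unitv k) (Lambda_st n (v + unitv k) (unitv p)) else 0)"
  by (simp add: E_op_def corr_down_eq add_diff_dimvec)

lemma F_op_eq:
  "F_op n (unitv p) k f v y =
    (if unitv k \<le> v \<and> nonempty v \<and> nonempty (v - unitv k) \<and> y = Lambda_st n v (unitv p)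
     then f (v - unitv k) (Lambda_st n (v - unitv k) (unitv p)) else 0)"
  by (simp add: F_op_def corr_up_eq)

lemma sum_rows:
  assumes k: "1 \<le> k" "k \<le> n - 1"
  shows "(\<Sum>u \<in> {y_vec n k, z_vec n k}. g u) = g (row_vec k p) + g (row_vec k q)"
proof -
  have "y_vec n k = row_vec k (n - 1)" "z_vec n k = row_vec k n"
    using k n by (auto simp: y_vec_def z_vec_def row_vec_def fun_eq_iff)
  then have "{y_vec n k, z_vec n k} = {row_vec k p, row_vec k q}" using pq by auto
  moreover have "row_vec k p p \<noteq> row_vec k q p" using ends_distinct by (simp add: row_vec_def)
  then have "row_vec k p \<noteq> row_vec k q" by metis
  ultimately show ?thesis by simp
qed

definition sign :: "nat \<Rightarrow> dimvec \<Rightarrow> complex" where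
  "sign k v = (- 1) ^ rows_before n k (young_of n (unitv p) v)"

lemma a_op_eq:
  assumes k: "1 \<le> k" "k \<le> n - 1"
  shows "a_op n (unitv p) k f v y =
    (if short_arms.nonempty n q v \<and> y = Lambda_st n v (unitv q)
     then \<Sum>t \<in> {p, q}. (if nonempty (star n v + row_vec k t)
       then sign k (star n v + row_vec k t) *
         f (star n v + row_vec k t) (Lambda_st n (star n v + row_vec k t) (unitv p)) else 0) else 0)"
proof -
  have "k \<noteq> n" using k n by auto
  then show ?thesis
    using ends_distinct(1)
    by (simp add: a_op_def kappa_pull_eq sum_rows[OF k] corr_down_eq add_diff_dimvec nonempty_star sign_def)
qed

lemma b_op_eq:
  assumes k: "1 \<le> k" "k \<le> n - 1"
  shows "b_op n (unitv p) k f v y =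
    (if short_arms.nonempty n q v \<and> y = Lambda_st n v (unitv q)
     then \<Sum>t \<in> {p, q}. (if row_vec k t \<le> star n v \<and> nonempty (star n v - row_vec k t)
       then sign k (star n v - row_vec k t) *
         f (star n v - row_vec k t) (Lambda_st n (star n v - row_vec k t) (unitv p)) else 0) else 0)"
proof -
  have "k \<noteq> n" using k n by auto
  then show ?thesis
    using ends_distinct(1)
    by (simp add: b_op_def kappa_pull_eq sum_rows[OF k] corr_up_eq nonempty_star sign_def)
qed

lemma a_op_last_eq:
  "a_op n (unitv p) n f v y =
    (if short_arms.nonempty n q v \<and> y = Lambda_st n v (unitv q) \<and>
        even (unitv p n + length (young_of n (unitv p) (star n v)))
     then (- 1) ^ length (young_of n (unitv p) (star n v)) *
       f (star n v) (Lambda_st n (star n v) (unitv p)) else 0)"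
  by (simp add: a_op_def kappa_pull_eq)

lemma b_op_last_eq:
  "b_op n (unitv p) n f v y =
    (if short_arms.nonempty n q v \<and> y = Lambda_st n v (unitv q) \<and>
        odd (unitv p n + length (young_of n (unitv p) (star n v)))
     then (- 1) ^ length (young_of n (unitv p) (star n v)) *
       f (star n v) (Lambda_st n (star n v) (unitv p)) else 0)"
  by (simp add: b_op_def kappa_pull_eq)

lemma E_op_concentrated:
  assumes "supported n f"
  shows "concentrated (E_op n (unitv p) k f)"
  unfolding concentrated_def supported_def
proof (intro conjI allI impI)
  fix v y i assume nz: "E_op n (unitv p) k f v y \<noteq> 0"
  show "nonempty v" "y = Lambda_st n v (unitv p)"
    using nz by (auto simp: E_op_eq split: if_splits)
  assume "i \<notin> vertices n"
  moreover have "f (v + unitv k) (Lambda_st n (v + unitv k) (unitv p)) \<noteq> 0"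
    using nz by (simp add: E_op_eq split: if_splits)
  ultimately have "(v + unitv k) i = 0" using assms unfolding supported_def by blast
  then show "v i = 0" by simp
qed

lemma F_op_concentrated:
  assumes f: "supported n f" and k: "k \<in> vertices n"
  shows "concentrated (F_op n (unitv p) k f)"
  unfolding concentrated_def supported_def
proof (intro conjI allI impI)
  fix v y i assume nz: "F_op n (unitv p) k f v y \<noteq> 0"
  show "nonempty v" "y = Lambda_st n v (unitv p)"
    using nz by (auto simp: F_op_eq split: if_splits)
  assume i: "i \<notin> vertices n"
  moreover have "f (v - unitv k) (Lambda_st n (v - unitv k) (unitv p)) \<noteq> 0"
    using nz by (simp add: F_op_eq split: if_splits)
  ultimately have "(v - unitv k) i = 0" using f unfolding supported_def by blast
  then show "v i = 0" using i k by (auto simp: unitv_def split: if_splits)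
qed

lemma row_vec_support:
  assumes "1 \<le> k" "t \<in> {p, q}" "i \<notin> vertices n"
  shows "row_vec k t i = 0"
  using assms pq n by (auto simp: row_vec_def vertices_def)

lemma a_op_concentrated:
  assumes f: "supported n f" and k: "1 \<le> k" "k \<le> n"
  shows "short_arms.concentrated n q (a_op n (unitv p) k f)"
proof -
  interpret S: short_arms n q p by (rule swapped)
  show ?thesis
    unfolding S.concentrated_def supported_def
  proof (intro conjI allI impI)
    fix v y i assume nz: "a_op n (unitv p) k f v y \<noteq> 0"
    show "S.nonempty v" "y = Lambda_st n v (unitv q)"
      using nz k a_op_eq[of k f v y] a_op_last_eq[of f v y] by (cases "k = n"; auto split: if_splits)+
    assume i: "i \<notin> vertices n"
    have "\<exists>u y. f (star n v + u) y \<noteq> 0"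
    proof (cases "k = n")
      case True
      then have "f (star n v + 0) (Lambda_st n (star n v) (unitv p)) \<noteq> 0"
        using nz by (auto simp: a_op_last_eq split: if_splits)
      then show ?thesis by blast
    next
      case False
      then have k': "k \<le> n - 1" using k by simp
      have "\<exists>t\<in>{p, q}. f (star n v + row_vec k t) (Lambda_st n (star n v + row_vec k t) (unitv p)) \<noteq> 0"
      proof (rule ccontr)
        assume "\<not> ?thesis"
        then have "a_op n (unitv p) k f v y = 0"
          using a_op_eq[OF k(1) k', of f v y] ends_distinct(1) by simp
        with nz show False by simp
      qed
      then show ?thesis by blast
    qed
    then obtain u y where "f (star n v + u) y \<noteq> 0" by blast
    then have "(star n v + u) i = 0" using f i unfolding supported_def by blast
    then show "v i = 0" using star_apply(4)[OF i] by simp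
  qed
qed

lemma b_op_concentrated:
  assumes f: "supported n f" and k: "1 \<le> k" "k \<le> n"
  shows "short_arms.concentrated n q (b_op n (unitv p) k f)"
proof -
  interpret S: short_arms n q p by (rule swapped)
  show ?thesis
    unfolding S.concentrated_def supported_def
  proof (intro conjI allI impI)
    fix v y i assume nz: "b_op n (unitv p) k f v y \<noteq> 0"
    show "S.nonempty v" "y = Lambda_st n v (unitv q)"
      using nz k b_op_eq[of k f v y] b_op_last_eq[of f v y] by (cases "k = n"; auto split: if_splits)+
    assume i: "i \<notin> vertices n"
    have "\<exists>u y. u i = 0 \<and> f (star n v - u) y \<noteq> 0"
    proof (cases "k = n")
      case True
      have "star n v - 0 = star n v" by (simp add: fun_eq_iff)
      then have "f (star n v - 0) (Lambda_st n (star n v) (unitv p)) \<noteq> 0"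
        using nz True by (auto simp: b_op_last_eq split: if_splits)
      then show ?thesis by (metis zero_fun_apply)
    next
      case False
      then have k': "k \<le> n - 1" using k by simp
      have "\<exists>t\<in>{p, q}. f (star n v - row_vec k t) (Lambda_st n (star n v - row_vec k t) (unitv p)) \<noteq> 0"
      proof (rule ccontr)
        assume "\<not> ?thesis"
        then have "b_op n (unitv p) k f v y = 0"
          using b_op_eq[OF k(1) k', of f v y] ends_distinct(1) by simp
        with nz show False by simp
      qed
      then show ?thesis using row_vec_support[OF k(1) _ i] by blast
    qed
    then obtain u y where "u i = 0" "f (star n v - u) y \<noteq> 0" by blast
    then have "(star n v - u) i = 0" using f i unfolding supported_def by blast
    then show "v i = 0" using star_apply(4)[OF i] \<open>u i = 0\<close> by simp
  qed
qed

lemma nonempty_swapped: "short_arms.nonempty n q (short_arms.dimv n q p D) \<longleftrightarrow> nonempty (dimv D)"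
proof -
  interpret S: short_arms n q p by (rule swapped)
  show ?thesis by (simp add: nonempty_star S.star_dimv)
qed

lemma sign_dimv:
  "D \<in> endpoint_sets \<Longrightarrow> sign k (dimv D) = (- 1) ^ card {d \<in> D. d < k}"
  by (simp add: sign_def young_of_dimv)

lemma nonempty_add_row:
  assumes D: "D \<in> endpoint_sets" and k: "1 \<le> k" "k \<le> n - 1" and t: "t \<in> {p, q}"
    and ne: "nonempty (dimv D + row_vec k t)"
  shows "k \<notin> D" "t = tip_of D"
proof -
  obtain D' where D': "D' \<in> endpoint_sets" "dimv D + row_vec k t = dimv D'"
    using nonempty_dimv[OF ne] dimv_simps(4) row_vec_support[OF k(1) t] by auto
  show "k \<notin> D" "t = tip_of D"
    using dimv_add_row[OF D D'(1) k t] D'(2) by simp_all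
qed

lemma nonempty_diff_row:
  assumes D: "D \<in> endpoint_sets" and k: "1 \<le> k" "k \<le> n - 1" and t: "t \<in> {p, q}"
    and le: "row_vec k t \<le> dimv D" and ne: "nonempty (dimv D - row_vec k t)"
  shows "k \<in> D" "t = tip_of (D - {k})"
proof -
  obtain D' where D': "D' \<in> endpoint_sets" "dimv D - row_vec k t = dimv D'"
    using nonempty_dimv[OF ne] dimv_simps(4) by auto
  then have "dimv D = dimv D' + row_vec k t" using add_diff_dimvec(3)[OF le] by simp
  note r = dimv_add_row[OF D'(1) D k t this]
  then show "k \<in> D" "t = tip_of (D - {k})" by auto
qed

lemma sum_tips:
  assumes "\<And>t. t \<in> {p, q} \<Longrightarrow> t \<noteq> tip_of D \<Longrightarrow> g t = (0 :: complex)"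
  shows "(\<Sum>t \<in> {p, q}. g t) = g (tip_of D)"
proof (cases "even (card D)")
  case True
  then have "tip_of D = p" by (simp add: tip_of_def)
  then show ?thesis using assms[of q] ends_distinct(1) by simp
next
  case False
  then have "tip_of D = q" by (simp add: tip_of_def)
  then show ?thesis using assms[of p] ends_distinct(1) by simp
qed

text \<open>Of the two correspondences at most one is nonempty: the parity of \<open>card D\<close> decides at which tip the
added row ends.\<close>

lemma coef_a_op:
  assumes D: "D \<in> endpoint_sets" and ne: "nonempty (dimv D)" and k: "1 \<le> k" "k \<le> n - 1"
  shows "short_arms.coef n q p (a_op n (unitv p) k f) D =
    (if k \<notin> D \<and> nonempty (dimv (insert k D))
     then (- 1) ^ card {d \<in> D. d < k} * coef f (insert k D) else 0)"
proof -
  interpret S: short_arms n q p by (rule swapped)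
  let ?g = "\<lambda>t. if nonempty (dimv D + row_vec k t) then sign k (dimv D + row_vec k t) *
         f (dimv D + row_vec k t) (Lambda_st n (dimv D + row_vec k t) (unitv p)) else 0"
  have "S.coef (a_op n (unitv p) k f) D = (\<Sum>t \<in> {p, q}. ?g t)"
    unfolding S.coef_def a_op_eq[OF k] S.star_dimv using ne nonempty_swapped by simp
  also have "\<dots> = ?g (tip_of D)"
  proof (rule sum_tips)
    fix t assume "t \<in> {p, q}" "t \<noteq> tip_of D"
    then have "\<not> nonempty (dimv D + row_vec k t)" using nonempty_add_row(2)[OF D k] by blast
    then show "?g t = 0" by simp
  qed
  also have "\<dots> = (if k \<notin> D \<and> nonempty (dimv (insert k D))
     then (- 1) ^ card {d \<in> D. d < k} * coef f (insert k D) else 0)"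
  proof (cases "k \<in> D")
    case True
    have "tip_of D \<in> {p, q}" by (simp add: tip_of_def)
    then have "\<not> nonempty (dimv D + row_vec k (tip_of D))" using nonempty_add_row(1)[OF D k] True by blast
    then show ?thesis using True by simp
  next
    case False
    have "insert k D \<in> endpoint_sets" using D k by auto
    moreover have "{d \<in> insert k D. d < k} = {d \<in> D. d < k}" by auto
    ultimately show ?thesis
      using dimv_insert[OF D k False] sign_dimv[of "insert k D" k] False
      by (simp add: coef_def)
  qed
  finally show ?thesis .
qed

lemma dimv_remove:
  assumes D: "D \<in> endpoint_sets" and k: "1 \<le> k" "k \<le> n - 1" "k \<in> D"
  shows "dimv D - row_vec k (tip_of (D - {k})) = dimv (D - {k})"
    "row_vec k (tip_of (D - {k})) \<le> dimv D" "dimv (D - {k}) \<le> dimv D"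
proof -
  have C: "D - {k} \<in> endpoint_sets" using D by auto
  have "dimv D = dimv (D - {k}) + row_vec k (tip_of (D - {k}))"
    using dimv_insert[OF C k(1,2)] k(3) by (simp add: insert_absorb)
  then show "dimv D - row_vec k (tip_of (D - {k})) = dimv (D - {k})"
    "row_vec k (tip_of (D - {k})) \<le> dimv D" "dimv (D - {k}) \<le> dimv D"
    by (auto simp: add_diff_dimvec le_fun_def)
qed

lemma coef_b_op:
  assumes D: "D \<in> endpoint_sets" and ne: "nonempty (dimv D)" and k: "1 \<le> k" "k \<le> n - 1"
  shows "short_arms.coef n q p (b_op n (unitv p) k f) D =
    (if k \<in> D then (- 1) ^ card {d \<in> D. d < k} * coef f (D - {k}) else 0)"
proof -
  interpret S: short_arms n q p by (rule swapped)
  let ?g = "\<lambda>t. if row_vec k t \<le> dimv D \<and> nonempty (dimv D - row_vec k t)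
    then sign k (dimv D - row_vec k t) *
         f (dimv D - row_vec k t) (Lambda_st n (dimv D - row_vec k t) (unitv p)) else 0"
  have C: "D - {k} \<in> endpoint_sets" using D by auto
  have "S.coef (b_op n (unitv p) k f) D = (\<Sum>t \<in> {p, q}. ?g t)"
    unfolding S.coef_def b_op_eq[OF k] S.star_dimv using ne nonempty_swapped by simp
  also have "\<dots> = ?g (tip_of (D - {k}))"
  proof (rule sum_tips)
    fix t assume "t \<in> {p, q}" "t \<noteq> tip_of (D - {k})"
    then have "\<not> (row_vec k t \<le> dimv D \<and> nonempty (dimv D - row_vec k t))"
      using nonempty_diff_row(2)[OF D k] by blast
    then show "?g t = 0" by (rule if_not_P)
  qed
  also have "\<dots> = (if k \<in> D then (- 1) ^ card {d \<in> D. d < k} * coef f (D - {k}) else 0)"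
  proof (cases "k \<in> D")
    case False
    have "tip_of (D - {k}) \<in> {p, q}" by (simp add: tip_of_def)
    then have none: "\<not> (row_vec k (tip_of (D - {k})) \<le> dimv D \<and> nonempty (dimv D - row_vec k (tip_of (D - {k}))))"
      using nonempty_diff_row(1)[OF D k] False by blast
    show ?thesis unfolding if_not_P[OF none] using False by simp
  next
    case True
    note r = dimv_remove[OF D k True]
    have "nonempty (dimv (D - {k}))" by (rule nonempty_down[OF ne C r(3)])
    moreover have "{d \<in> D - {k}. d < k} = {d \<in> D. d < k}" by auto
    ultimately show ?thesis
      using sign_dimv[OF C, of k] r True by (simp add: coef_def)
  qed
  finally show ?thesis .
qed

lemma coef_a_op_last:
  assumes D: "D \<in> endpoint_sets" and ne: "nonempty (dimv D)"
  shows "short_arms.coef n q p (a_op n (unitv p) n f) D =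
    (if even (unitv p n + card D) then (- 1) ^ card D * coef f D else 0)"
proof -
  interpret S: short_arms n q p by (rule swapped)
  show ?thesis
    using ne nonempty_swapped young_of_dimv(1)[OF D]
    by (simp add: S.coef_def coef_def a_op_last_eq S.star_dimv)
qed

lemma coef_b_op_last:
  assumes D: "D \<in> endpoint_sets" and ne: "nonempty (dimv D)"
  shows "short_arms.coef n q p (b_op n (unitv p) n f) D =
    (if odd (unitv p n + card D) then (- 1) ^ card D * coef f D else 0)"
proof -
  interpret S: short_arms n q p by (rule swapped)
  show ?thesis
    using ne nonempty_swapped young_of_dimv(1)[OF D]
    by (simp add: S.coef_def coef_def b_op_last_eq S.star_dimv)
qed

lemma coef_E_op:
  assumes D: "D \<in> endpoint_sets" and ne: "nonempty (dimv D)" and k: "1 \<le> k" "k \<le> n - 2"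
  shows "coef (E_op n (unitv p) k f) D =
    (if k \<notin> D \<and> Suc k \<in> D \<and> nonempty (dimv (insert k (D - {Suc k})))
     then coef f (insert k (D - {Suc k})) else 0)"
proof -
  have "coef (E_op n (unitv p) k f) D = (if nonempty (dimv D + unitv k)
      then f (dimv D + unitv k) (Lambda_st n (dimv D + unitv k) (unitv p)) else 0)"
    using ne by (simp add: coef_def E_op_eq)
  also have "\<dots> = (if k \<notin> D \<and> Suc k \<in> D \<and> nonempty (dimv (insert k (D - {Suc k})))
     then coef f (insert k (D - {Suc k})) else 0)"
  proof (cases "k \<notin> D \<and> Suc k \<in> D")
    case True
    then show ?thesis using dimv_move[OF D k] by (simp add: coef_def)
  next
    case False
    have "\<not> nonempty (dimv D + unitv k)"
    proof
      assume ne': "nonempty (dimv D + unitv k)"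
      have "(dimv D + unitv k) i = 0" if "i \<notin> vertices n" for i
        using that k dimv_simps(4)[OF that] by (auto simp: unitv_def vertices_def)
      then obtain D' where "D' \<in> endpoint_sets" "dimv D + unitv k = dimv D'"
        using nonempty_dimv[OF ne'] by blast
      then show False using dimv_add_unitv[OF D _ k] False by metis
    qed
    then show ?thesis using False by auto
  qed
  finally show ?thesis .
qed

lemma coef_F_op:
  assumes D: "D \<in> endpoint_sets" and ne: "nonempty (dimv D)" and k: "1 \<le> k" "k \<le> n - 2"
  shows "coef (F_op n (unitv p) k f) D =
    (if k \<in> D \<and> Suc k \<notin> D then coef f (insert (Suc k) (D - {k})) else 0)"
proof -
  have eq: "coef (F_op n (unitv p) k f) D = (if unitv k \<le> dimv D \<and> nonempty (dimv D - unitv k)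
      then f (dimv D - unitv k) (Lambda_st n (dimv D - unitv k) (unitv p)) else 0)"
    using ne by (simp add: coef_def F_op_eq)
  show ?thesis
  proof (cases "k \<in> D \<and> Suc k \<notin> D")
    case True
    let ?D' = "insert (Suc k) (D - {k})"
    have D': "?D' \<in> endpoint_sets" using D k by auto
    have "insert k (?D' - {Suc k}) = D" using True by auto
    then have "dimv D = dimv ?D' + unitv k"
      using dimv_move[OF D' k] by simp
    then have "dimv D - unitv k = dimv ?D'" "unitv k \<le> dimv D" "dimv ?D' \<le> dimv D"
      by (auto simp: add_diff_dimvec le_fun_def)
    then show ?thesis using eq True nonempty_down[OF ne D'] by (simp add: coef_def)
  next
    case False
    have "\<not> (unitv k \<le> dimv D \<and> nonempty (dimv D - unitv k))"
    proof
      assume a: "unitv k \<le> dimv D \<and> nonempty (dimv D - unitv k)"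
      then obtain D' where D': "D' \<in> endpoint_sets" "dimv D - unitv k = dimv D'"
        using nonempty_dimv[of "dimv D - unitv k"] dimv_simps(4) by auto
      have eqD: "dimv D = dimv D' + unitv k" using D'(2) add_diff_dimvec(3) a by metis
      have "k \<notin> D'" "Suc k \<in> D'" using dimv_add_unitv[OF D'(1) D k eqD] by auto
      then have "dimv D = dimv (insert k (D' - {Suc k}))"
        using dimv_move[OF D'(1) k] eqD by simp
      moreover have "insert k (D' - {Suc k}) \<in> endpoint_sets" using D'(1) k by auto
      ultimately have "D = insert k (D' - {Suc k})" using dimv_inj[OF D] by blast
      then show False using False by auto
    qed
    then show ?thesis using eq False by auto
  qed
qed

text \<open>For the two tips \<open>E\<close> removes the shortest possible row, whose endpoint is \<open>n - 1\<close>.\<close>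

lemma coef_E_op_tip:
  assumes D: "D \<in> endpoint_sets" and ne: "nonempty (dimv D)" and t: "t \<in> {p, q}"
  shows "coef (E_op n (unitv p) t f) D =
    (if n - 1 \<notin> D \<and> t = tip_of D \<and> nonempty (dimv (insert (n - 1) D))
     then coef f (insert (n - 1) D) else 0)"
proof -
  have k: "1 \<le> n - 1" "n - 1 \<le> n - 1" using n by auto
  have u: "unitv t = row_vec (n - 1) t" using t unitv_ends by auto
  have eq: "coef (E_op n (unitv p) t f) D = (if nonempty (dimv D + row_vec (n - 1) t)
      then f (dimv D + row_vec (n - 1) t) (Lambda_st n (dimv D + row_vec (n - 1) t) (unitv p)) else 0)"
    using ne unfolding coef_def E_op_eq u by simp
  show ?thesis
  proof (cases "n - 1 \<notin> D \<and> t = tip_of D")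
    case True
    then have "dimv D + row_vec (n - 1) t = dimv (insert (n - 1) D)" using dimv_insert[OF D k] by simp
    then show ?thesis using True unfolding eq unfolding coef_def by simp
  next
    case False
    then have none: "\<not> nonempty (dimv D + row_vec (n - 1) t)" using nonempty_add_row[OF D k t] by blast
    have none': "\<not> (n - 1 \<notin> D \<and> t = tip_of D \<and> nonempty (dimv (insert (n - 1) D)))"
      using False by blast
    show ?thesis unfolding eq if_not_P[OF none] if_not_P[OF none'] ..
  qed
qed

lemma coef_F_op_tip:
  assumes D: "D \<in> endpoint_sets" and ne: "nonempty (dimv D)" and t: "t \<in> {p, q}"
  shows "coef (F_op n (unitv p) t f) D =
    (if n - 1 \<in> D \<and> t = tip_of (D - {n - 1}) then coef f (D - {n - 1}) else 0)"
proof -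
  have k: "1 \<le> n - 1" "n - 1 \<le> n - 1" using n by auto
  have u: "unitv t = row_vec (n - 1) t" using t unitv_ends by auto
  have C: "D - {n - 1} \<in> endpoint_sets" using D by auto
  have eq: "coef (F_op n (unitv p) t f) D = (if row_vec (n - 1) t \<le> dimv D \<and> nonempty (dimv D - row_vec (n - 1) t)
      then f (dimv D - row_vec (n - 1) t) (Lambda_st n (dimv D - row_vec (n - 1) t) (unitv p)) else 0)"
    using ne unfolding coef_def F_op_eq u by simp
  show ?thesis
  proof (cases "n - 1 \<in> D \<and> t = tip_of (D - {n - 1})")
    case True
    then have r: "dimv D - row_vec (n - 1) t = dimv (D - {n - 1})" "row_vec (n - 1) t \<le> dimv D"
      "dimv (D - {n - 1}) \<le> dimv D"
      using dimv_remove[OF D k] by auto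
    show ?thesis using True r nonempty_down[OF ne C r(3)] unfolding eq unfolding coef_def by simp
  next
    case False
    then have none: "\<not> (row_vec (n - 1) t \<le> dimv D \<and> nonempty (dimv D - row_vec (n - 1) t))"
      using nonempty_diff_row[OF D k t] by blast
    show ?thesis unfolding eq if_not_P[OF none] if_not_P[OF False] ..
  qed
qed

subsection \<open>The four identities\<close>

text \<open>The parity conditions in \<open>a\<^sub>n\<close> and \<open>b\<^sub>n\<close> involve the framing that the function has before \<open>\<kappa>\<^sup>*\<close> is
applied, so both \<open>w\<^sup>p\<close> and \<open>w\<^sup>q\<close> occur.\<close>

lemma tip_of_parity:
  "tip_of D = n \<longleftrightarrow> even (unitv q n + card D)" "tip_of D = n - 1 \<longleftrightarrow> odd (unitv q n + card D)"
  "tip_of D = n \<longleftrightarrow> odd (unitv p n + card D)" "tip_of D = n - 1 \<longleftrightarrow> even (unitv p n + card D)"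
proof -
  have tip: "tip_of D = p \<longleftrightarrow> even (card D)" "tip_of D = q \<longleftrightarrow> odd (card D)"
    using ends_distinct(1) by (simp_all add: tip_of_def)
  have "(tip_of D = n \<longleftrightarrow> even (unitv q n + card D)) \<and> (tip_of D = n - 1 \<longleftrightarrow> odd (unitv q n + card D)) \<and>
    (tip_of D = n \<longleftrightarrow> odd (unitv p n + card D)) \<and> (tip_of D = n - 1 \<longleftrightarrow> even (unitv p n + card D))"
    using pq
  proof
    assume pn: "p = n \<and> q = n - 1"
    then have t: "tip_of D = n \<longleftrightarrow> even (card D)" "tip_of D = n - 1 \<longleftrightarrow> odd (card D)"
      using tip by metis+
    have u: "unitv q n = 0" "unitv p n = 1"
      using pn ends_distinct(1) unfolding unitv_def by metis+
    show ?thesis unfolding t u by simp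
  next
    assume pn: "p = n - 1 \<and> q = n"
    then have t: "tip_of D = n \<longleftrightarrow> odd (card D)" "tip_of D = n - 1 \<longleftrightarrow> even (card D)"
      using tip by metis+
    have u: "unitv q n = 1" "unitv p n = 0"
      using pn ends_distinct(1) unfolding unitv_def by metis+
    show ?thesis unfolding t u by simp
  qed
  then show "tip_of D = n \<longleftrightarrow> even (unitv q n + card D)" "tip_of D = n - 1 \<longleftrightarrow> odd (unitv q n + card D)"
    "tip_of D = n \<longleftrightarrow> odd (unitv p n + card D)" "tip_of D = n - 1 \<longleftrightarrow> even (unitv p n + card D)"
    by blast+
qed

lemma endpoints_below_last:
  assumes "D \<in> endpoint_sets"
  shows "{d \<in> D. d < n - 1} = D - {n - 1}"
proof -
  have "d \<le> n - 1" if "d \<in> D" for d using assms that by auto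
  then show ?thesis by (auto intro: le_neq_implies_less)
qed

lemma concentrated_supported: "concentrated f \<Longrightarrow> supported n f"
  by (simp add: concentrated_def)

lemma sign_cancel: "(- 1 :: complex) ^ m * ((- 1) ^ m * c) = c"
  by (simp flip: mult.assoc power_add)

lemma sign_cancel_if:
  "(- 1 :: complex) ^ m * (if P then (- 1) ^ m * c else 0) = (if P then c else 0)"
  by (simp add: sign_cancel)

text \<open>Since \<open>k\<close> is not an endpoint after its removal, the numbers of endpoints below \<open>k\<close> and below \<open>k + 1\<close> agree
and the signs cancel.\<close>

lemma E_op_clifford:
  assumes f: "supported n f" and k: "1 \<le> k" "k \<le> n - 1"
  shows "E_op n (unitv p) k f = b_op n (unitv q) (k + 1) (a_op n (unitv p) k f)"
proof -
  interpret S: short_arms n q p by (rule swapped)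
  have kn: "k \<le> n" "1 \<le> k + 1" "k + 1 \<le> n" using k n by auto
  show ?thesis
  proof (rule concentrated_eqI)
    show "concentrated (E_op n (unitv p) k f)" by (rule E_op_concentrated[OF f])
    show "concentrated (b_op n (unitv q) (k + 1) (a_op n (unitv p) k f))"
      by (rule S.b_op_concentrated[OF S.concentrated_supported[OF a_op_concentrated[OF f k(1) kn(1)]] kn(2,3)])
    fix D assume D: "D \<in> endpoint_sets" and ne: "nonempty (dimv D)"
    have neS: "S.nonempty (S.dimv D)" using ne nonempty_swapped by simp
    let ?g = "a_op n (unitv p) k f"
    show "coef (E_op n (unitv p) k f) D = coef (b_op n (unitv q) (k + 1) ?g) D"
    proof (cases "k = n - 1")
      case False
      then have k2: "k \<le> n - 2" "1 \<le> k + 1" "k + 1 \<le> n - 1" using k by auto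
      let ?C = "D - {Suc k}"
      have C: "?C \<in> endpoint_sets" using D by auto
      have lhs: "coef (E_op n (unitv p) k f) D =
          (if k \<notin> D \<and> Suc k \<in> D \<and> nonempty (dimv (insert k ?C)) then coef f (insert k ?C) else 0)"
        by (rule coef_E_op[OF D ne k(1) k2(1)])
      have rhs: "coef (b_op n (unitv q) (k + 1) ?g) D =
          (if Suc k \<in> D then (- 1) ^ card {d \<in> D. d < Suc k} * S.coef ?g ?C else 0)"
        using S.coef_b_op[OF D neS k2(2,3), of ?g] by simp
      show ?thesis
      proof (cases "Suc k \<in> D")
        case False
        then show ?thesis unfolding lhs rhs by simp
      next
        case True
        have neC: "nonempty (dimv ?C)"
          using dimv_remove(3)[OF D _ _ True] k2 by (intro nonempty_down[OF ne C]) auto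
        have mid: "S.coef ?g ?C = (if k \<notin> ?C \<and> nonempty (dimv (insert k ?C))
            then (- 1) ^ card {d \<in> ?C. d < k} * coef f (insert k ?C) else 0)"
          by (rule coef_a_op[OF C neC k])
        show ?thesis
        proof (cases "k \<in> D")
          case False
          have "{d \<in> D. d < Suc k} = {d \<in> ?C. d < k}"
            using False by (auto simp: less_Suc_eq)
          then show ?thesis unfolding lhs rhs mid using False True by (simp add: sign_cancel)
        next
          case kD: True
          then show ?thesis unfolding lhs rhs mid by simp
        qed
      qed
    next
      case True
      have t: "n - 1 \<in> {p, q}" using pq by auto
      have lhs: "coef (E_op n (unitv p) k f) D =
          (if n - 1 \<notin> D \<and> n - 1 = tip_of D \<and> nonempty (dimv (insert (n - 1) D))
           then coef f (insert (n - 1) D) else 0)"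
        unfolding True by (rule coef_E_op_tip[OF D ne t])
      have kn': "k + 1 = n" using True n by simp
      have rhs: "coef (b_op n (unitv q) (k + 1) ?g) D =
          (if odd (unitv q n + card D) then (- 1) ^ card D * S.coef ?g D else 0)"
        unfolding kn' by (rule S.coef_b_op_last[OF D neS])
      have mid: "S.coef ?g D = (if n - 1 \<notin> D \<and> nonempty (dimv (insert (n - 1) D))
            then (- 1) ^ card (D - {n - 1}) * coef f (insert (n - 1) D) else 0)"
        using coef_a_op[OF D ne k, of f] unfolding True endpoints_below_last[OF D] .
      have tip: "n - 1 = tip_of D \<longleftrightarrow> odd (unitv q n + card D)"
        using tip_of_parity(2)[of D] by metis
      show ?thesis
        unfolding lhs rhs mid tip by (cases "n - 1 \<in> D") (simp_all add: sign_cancel)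
    qed
  qed
qed

text \<open>The intermediate set \<open>D - {k} \<union> {k + 1}\<close> has a point because its dimension vector is smaller than that of \<open>D\<close>.\<close>

lemma F_op_clifford:
  assumes f: "supported n f" and k: "1 \<le> k" "k \<le> n - 1"
  shows "F_op n (unitv p) k f = b_op n (unitv q) k (a_op n (unitv p) (k + 1) f)"
proof -
  interpret S: short_arms n q p by (rule swapped)
  have kn: "k \<le> n" "1 \<le> k + 1" "k + 1 \<le> n" "k \<in> vertices n" using k n by (auto simp: vertices_def)
  show ?thesis
  proof (rule concentrated_eqI)
    show "concentrated (F_op n (unitv p) k f)" by (rule F_op_concentrated[OF f kn(4)])
    show "concentrated (b_op n (unitv q) k (a_op n (unitv p) (k + 1) f))"
      by (rule S.b_op_concentrated[OF S.concentrated_supported[OF a_op_concentrated[OF f kn(2,3)]] k(1) kn(1)])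
    fix D assume D: "D \<in> endpoint_sets" and ne: "nonempty (dimv D)"
    have neS: "S.nonempty (S.dimv D)" using ne nonempty_swapped by simp
    let ?C = "D - {k}"
    have C: "?C \<in> endpoint_sets" using D by auto
    have neC: "nonempty (dimv ?C)" if "k \<in> D"
      using dimv_remove(3)[OF D k that] by (rule nonempty_down[OF ne C])
    let ?g = "a_op n (unitv p) (k + 1) f"
    have rhs: "coef (b_op n (unitv q) k ?g) D =
        (if k \<in> D then (- 1) ^ card {d \<in> D. d < k} * S.coef ?g ?C else 0)"
      by (rule S.coef_b_op[OF D neS k])
    show "coef (F_op n (unitv p) k f) D = coef (b_op n (unitv q) k ?g) D"
    proof (cases "k = n - 1")
      case False
      then have k2: "k \<le> n - 2" "1 \<le> k + 1" "k + 1 \<le> n - 1" using k by auto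
      let ?D' = "insert (Suc k) ?C"
      have lhs: "coef (F_op n (unitv p) k f) D =
          (if k \<in> D \<and> Suc k \<notin> D then coef f ?D' else 0)"
        by (rule coef_F_op[OF D ne k(1) k2(1)])
      show ?thesis
      proof (cases "k \<in> D")
        case False
        then show ?thesis unfolding lhs rhs by simp
      next
        case True
        have mid: "S.coef ?g ?C = (if Suc k \<notin> ?C \<and> nonempty (dimv ?D')
            then (- 1) ^ card {d \<in> ?C. d < Suc k} * coef f ?D' else 0)"
          using coef_a_op[OF C neC[OF True] k2(2,3), of f] by simp
        have "nonempty (dimv ?D')" if "Suc k \<notin> D"
        proof -
          have D': "?D' \<in> endpoint_sets" using D k2 by auto
          have "insert k (?D' - {Suc k}) = D" using that True by auto
          then have "dimv D = dimv ?D' + unitv k"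
            using dimv_move[OF D' k(1) k2(1)] by simp
          then have "dimv ?D' \<le> dimv D" by (simp add: le_fun_def)
          then show ?thesis by (rule nonempty_down[OF ne D'])
        qed
        moreover have "{d \<in> ?C. d < Suc k} = {d \<in> D. d < k}"
          by (auto simp: less_Suc_eq)
        ultimately show ?thesis
          unfolding lhs rhs mid using True by (cases "Suc k \<in> D") (simp_all add: sign_cancel)
      qed
    next
      case True
      have t: "n - 1 \<in> {p, q}" using pq by auto
      have lhs: "coef (F_op n (unitv p) k f) D =
          (if k \<in> D \<and> k = tip_of ?C then coef f ?C else 0)"
        unfolding True by (rule coef_F_op_tip[OF D ne t])
      have kn': "k + 1 = n" using True n by simp
      show ?thesis
      proof (cases "k \<in> D")
        case False
        then show ?thesis unfolding lhs rhs by simp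
      next
        case kD: True
        have mid: "S.coef ?g ?C = (if even (unitv p n + card ?C) then (- 1) ^ card ?C * coef f ?C else 0)"
          unfolding kn' by (rule coef_a_op_last[OF C neC[OF kD]])
        have below: "{d \<in> D. d < k} = ?C"
          unfolding True by (rule endpoints_below_last[OF D])
        have tip: "k = tip_of ?C \<longleftrightarrow> even (unitv p n + card ?C)"
          using tip_of_parity(4)[of ?C] True by metis
        show ?thesis
          unfolding lhs rhs mid tip below sign_cancel_if using kD by (simp only: simp_thms if_True)
      qed
    qed
  qed
qed

lemma E_op_last_clifford:
  assumes f: "supported n f"
  shows "E_op n (unitv p) n f = a_op n (unitv q) n (a_op n (unitv p) (n - 1) f)"
proof -
  interpret S: short_arms n q p by (rule swapped)
  have k: "1 \<le> n - 1" "n - 1 \<le> n" "1 \<le> n" "n - 1 \<le> n - 1" using n by auto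
  show ?thesis
  proof (rule concentrated_eqI)
    show "concentrated (E_op n (unitv p) n f)" by (rule E_op_concentrated[OF f])
    show "concentrated (a_op n (unitv q) n (a_op n (unitv p) (n - 1) f))"
      by (rule S.a_op_concentrated[OF S.concentrated_supported[OF a_op_concentrated[OF f k(1,2)]] k(3) order_refl])
    fix D assume D: "D \<in> endpoint_sets" and ne: "nonempty (dimv D)"
    have neS: "S.nonempty (S.dimv D)" using ne nonempty_swapped by simp
    have t: "n \<in> {p, q}" using pq by auto
    let ?g = "a_op n (unitv p) (n - 1) f"
    have lhs: "coef (E_op n (unitv p) n f) D =
        (if n - 1 \<notin> D \<and> n = tip_of D \<and> nonempty (dimv (insert (n - 1) D))
         then coef f (insert (n - 1) D) else 0)"
      by (rule coef_E_op_tip[OF D ne t])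
    have rhs: "coef (a_op n (unitv q) n ?g) D =
        (if even (unitv q n + card D) then (- 1) ^ card D * S.coef ?g D else 0)"
      by (rule S.coef_a_op_last[OF D neS])
    have mid: "S.coef ?g D = (if n - 1 \<notin> D \<and> nonempty (dimv (insert (n - 1) D))
          then (- 1) ^ card (D - {n - 1}) * coef f (insert (n - 1) D) else 0)"
      using coef_a_op[OF D ne k(1,4), of f] unfolding endpoints_below_last[OF D] .
    have tip: "n = tip_of D \<longleftrightarrow> even (unitv q n + card D)"
      using tip_of_parity(1)[of D] by metis
    show "coef (E_op n (unitv p) n f) D = coef (a_op n (unitv q) n ?g) D"
      unfolding lhs rhs mid tip by (cases "n - 1 \<in> D") (simp_all add: sign_cancel)
  qed
qed

lemma F_op_last_clifford:
  assumes f: "supported n f"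
  shows "F_op n (unitv p) n f = b_op n (unitv q) (n - 1) (b_op n (unitv p) n f)"
proof -
  interpret S: short_arms n q p by (rule swapped)
  have k: "1 \<le> n - 1" "n - 1 \<le> n" "1 \<le> n" "n - 1 \<le> n - 1" "n \<in> vertices n"
    using n by (auto simp: vertices_def)
  show ?thesis
  proof (rule concentrated_eqI)
    show "concentrated (F_op n (unitv p) n f)" by (rule F_op_concentrated[OF f k(5)])
    show "concentrated (b_op n (unitv q) (n - 1) (b_op n (unitv p) n f))"
      by (rule S.b_op_concentrated[OF S.concentrated_supported[OF b_op_concentrated[OF f k(3) order_refl]] k(1,2)])
    fix D assume D: "D \<in> endpoint_sets" and ne: "nonempty (dimv D)"
    have neS: "S.nonempty (S.dimv D)" using ne nonempty_swapped by simp
    have t: "n \<in> {p, q}" using pq by auto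
    let ?C = "D - {n - 1}"
    have C: "?C \<in> endpoint_sets" using D by auto
    have neC: "nonempty (dimv ?C)" if "n - 1 \<in> D"
      using dimv_remove(3)[OF D k(1,4) that] by (rule nonempty_down[OF ne C])
    let ?g = "b_op n (unitv p) n f"
    have lhs: "coef (F_op n (unitv p) n f) D =
        (if n - 1 \<in> D \<and> n = tip_of ?C then coef f ?C else 0)"
      by (rule coef_F_op_tip[OF D ne t])
    have rhs: "coef (b_op n (unitv q) (n - 1) ?g) D =
        (if n - 1 \<in> D then (- 1) ^ card ?C * S.coef ?g ?C else 0)"
      using S.coef_b_op[OF D neS k(1,4), of ?g] unfolding endpoints_below_last[OF D] .
    have tip: "n = tip_of ?C \<longleftrightarrow> odd (unitv p n + card ?C)"
      using tip_of_parity(3)[of ?C] by metis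
    show "coef (F_op n (unitv p) n f) D = coef (b_op n (unitv q) (n - 1) ?g) D"
    proof (cases "n - 1 \<in> D")
      case False
      then show ?thesis unfolding lhs rhs by simp
    next
      case True
      have mid: "S.coef ?g ?C = (if odd (unitv p n + card ?C) then (- 1) ^ card ?C * coef f ?C else 0)"
        by (rule coef_b_op_last[OF C neC[OF True]])
      show ?thesis unfolding lhs rhs mid tip sign_cancel_if using True by (simp only: simp_thms if_True)
    qed
  qed
qed

lemma L_space_supported:
  assumes "f \<in> L_space n (unitv p)"
  shows "supported n f"
proof -
  interpret M: Modules.module "\<lambda>(c :: complex) (f :: graded_fun) v y. c * f v y"
    by unfold_locales (auto simp: fun_eq_iff algebra_simps)
  have words: "supported n f" if "f \<in> F_words n (unitv p)" for f
    using that
  proof induction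
    case vac
    then show ?case by (auto simp: supported_def vacuum_def)
  next
    case (step f k)
    then show ?case
      by (auto simp: vertices_def intro!: concentrated_supported[OF F_op_concentrated])
  qed
  from assms show ?thesis
    unfolding L_space_def
  proof (induction rule: M.span_induct_alt)
    case base
    then show ?case by (simp add: supported_def)
  next
    case (step c g h)
    have "supported n g" using words step by blast
    show ?case
      unfolding supported_def
    proof (intro allI impI)
      fix v y i
      assume "((\<lambda>v y. c * g v y) + h) v y \<noteq> 0" and i: "i \<notin> vertices n"
      then have "g v y \<noteq> 0 \<or> h v y \<noteq> 0" by auto
      then show "v i = 0"
        using \<open>supported n g\<close> \<open>supported n h\<close> i unfolding supported_def by blast
    qed
  qed
qed

end

theorem proposition5p5:
  fixes n :: nat
  assumes "n \<ge> 4"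
  shows "\<forall>\<phi> \<in> spin_space n.
    (\<forall>k \<in> {1..n - 1}. E_spin n k \<phi> = b_spin n (k + 1) (a_spin n k \<phi>)) \<and>
    (\<forall>k \<in> {1..n - 1}. F_spin n k \<phi> = b_spin n k (a_spin n (k + 1) \<phi>)) \<and>
    E_spin n n \<phi> = a_spin n n (a_spin n (n - 1) \<phi>) \<and>
    F_spin n n \<phi> = b_spin n (n - 1) (b_spin n n \<phi>)"
proof
  fix \<phi> assume "\<phi> \<in> spin_space n"
  then obtain f g where \<phi>: "\<phi> = (f, g)" and f: "f \<in> L_space n (unitv (n - 1))" and g: "g \<in> L_space n (unitv n)"
    by (auto simp: spin_space_def)
  interpret P: short_arms n n "n - 1" using assms by unfold_locales auto
  interpret M: short_arms n "n - 1" n using assms by unfold_locales auto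
  note sf = M.L_space_supported[OF f] and sg = P.L_space_supported[OF g]
  show "(\<forall>k \<in> {1..n - 1}. E_spin n k \<phi> = b_spin n (k + 1) (a_spin n k \<phi>)) \<and>
    (\<forall>k \<in> {1..n - 1}. F_spin n k \<phi> = b_spin n k (a_spin n (k + 1) \<phi>)) \<and>
    E_spin n n \<phi> = a_spin n n (a_spin n (n - 1) \<phi>) \<and>
    F_spin n n \<phi> = b_spin n (n - 1) (b_spin n n \<phi>)"
    using M.E_op_clifford[OF sf] P.E_op_clifford[OF sg] M.F_op_clifford[OF sf] P.F_op_clifford[OF sg]
      M.E_op_last_clifford[OF sf] P.E_op_last_clifford[OF sg]
      M.F_op_last_clifford[OF sf] P.F_op_last_clifford[OF sg]
    by (simp add: \<phi> E_spin_def F_spin_def a_spin_def b_spin_def)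
qed

end
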